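(* Let $(G,\tau)$ be a symmetric group and let $S\subseteq G$ be a subsemigroup invariant under $s\mapsto s^\sharp:=\tau(s)^{-1}$. Let $\mathcal F$ be a complex Hilbert space. (i) If $(\pi,\mathcal E,\mathcal F)$ is a reflection positive $\mathcal F$-cyclic representation of $G_\tau$ and $P\colon\mathcal E\to\mathcal F$ is the orthogonal projection, then $\varphi(g):=P\pi(g)P^*$ is a reflection positive function $G\to B(\mathcal F)$ with respect to $S$, and $\varphi(\mathbf 1)=\mathbf 1_{\mathcal F}$. (ii) Let $\varphi\colon G\to B(\mathcal F)$ be a reflection positive function with respect to $S$ with $\varphi(\mathbf 1)=\mathbf 1_{\mathcal F}$, and let $\mathcal H_\varphi\subseteq\mathcal F^G$ be the Hilbert space with reproducing kernel $K(x,y)=\varphi(xy^{-1})$, on which $G$ acts by $(\pi_\varphi(g)f)(x):=f(xg)$ and $\tau$ acts by $(\tau f)(x):=f(\tau(x))$. Identify $\mathcal F$ with the subspace $\mathrm{ev}_{\mathbf 1}^*\mathcal F\subseteq\mathcal H_\varphi$. Then $(\pi_\varphi,\mathcal H_\varphi,\mathcal F)$ is a reflection positive $\mathcal F$-cyclic representation, and, with $\mathcal E:=\mathcal H_\varphi$, $\mathcal E_+:=\overline{\mathrm{span}\,\pi_\varphi(S)\mathcal F}$ and $\hat{\mathcal E}$ the associated Hilbert space, there is an $S$-equivariant unitary map $$\Gamma\colon\hat{\mathcal E}\to\mathcal H_{\varphi|_S},\qquad \Gamma([f])=f|_S\quad (f\in\mathcal E_+).$$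
   Context: A symmetric group is a pair $(G,\tau)$ of a group $G$ and an automorphism $\tau$ of $G$ with $\tau^2=\mathrm{id}_G$ (possibly $\tau=\mathrm{id}_G$). Put $g^\sharp:=\tau(g)^{-1}$ and $G_\tau:=G\rtimes\{\mathbf 1,\tau\}$. A subsemigroup $S$ with $S^\sharp=S$ becomes an involutive semigroup $(S,\sharp)$. Inner products are linear in the first argument. Positive definite kernels: a kernel $K\colon X\times X\to B(\mathcal F)$ is positive definite if $\sum_{j,k}\langle K(x_j,x_k)v_k,v_j\rangle\ge 0$ for all finite sequences $(x_j,v_j)$ in $X\times\mathcal F$. The reproducing kernel Hilbert space $\mathcal H_K\subseteq\mathcal F^X$ is the unique Hilbert space of functions $X\to\mathcal F$ with continuous point evaluations $\mathrm{ev}_x\colon\mathcal H_K\to\mathcal F$, $f\mapsto f(x)$, satisfying $K(x,y)=\mathrm{ev}_x\mathrm{ev}_y^*$. A function $\varphi$ on an involutive semigroup $(T,* )$ is positive definite if the kernel $(s,t)\mapsto\varphi(st^* )$ is positive definite; $\mathcal H_\varphi\subseteq\mathcal F^T$ denotes the reproducing kernel Hilbert space of this kernel. For the group $G$ the involution is $g^*=g^{-1}$; for $S$ it is $\sharp$. $S$ acts on $\mathcal H_{\varphi|_S}$ by right translations $(s.f)(t)=f(ts)$. Reflection positive function (with respect to $S$): $\varphi\colon G\to B(\mathcal F)$ such that (RP1) $\varphi$ is positive definite on $G$; (RP2) $\varphi\circ\tau=\varphi$; (RP3) $\varphi|_S$ is positive definite on $(S,\sharp)$. Reflection positive $\mathcal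 F$-cyclic representation: a triple $(\pi,\mathcal E,\mathcal F)$, where $(\pi,\mathcal E)$ is a unitary representation of $G_\tau$ on a Hilbert space, $\mathcal F\subseteq\mathcal E$ is a closed subspace that is $G$-cyclic (i.e. $\mathrm{span}\,\pi(G)\mathcal F$ is dense in $\mathcal E$) and fixed pointwise by $\theta:=\pi(\tau)$, and the closed subspace $\mathcal E_+:=\overline{\mathrm{span}\,\pi(S)\mathcal F}$ is $\theta$-positive, i.e. $\langle\theta v,v\rangle\ge0$ for $v\in\mathcal E_+$. The space $\hat{\mathcal E}$: with $\mathcal N:=\{v\in\mathcal E_+:\langle\theta v,v\rangle=0\}$, $\hat{\mathcal E}$ is the Hilbert completion of $\mathcal E_+/\mathcal N$ with respect to $\|[v]\|=\sqrt{\langle\theta v,v\rangle}$, $[v]$ being the class of $v$. $S$ acts on $\hat{\mathcal E}$ by $\hat\pi(s)[v]=[\pi(s)v]$. *)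

theory Defs
  imports
    "HOL-Analysis.Analysis"
    "HOL-Algebra.Group"
    "HOL-Library.Function_Algebras"
begin

section \<open>Complex Hilbert spaces\<close>

class complex_vector = ab_group_add +
  fixes scaleC :: "complex \<Rightarrow> 'a \<Rightarrow> 'a"  (infixr \<open>*\<^sub>C\<close> 75)
  assumes scaleC_add_right: "a *\<^sub>C (x + y) = a *\<^sub>C x + a *\<^sub>C y"
    and scaleC_add_left: "(a + b) *\<^sub>C x = a *\<^sub>C x + b *\<^sub>C x"
    and scaleC_scaleC: "a *\<^sub>C (b *\<^sub>C x) = (a * b) *\<^sub>C x"
    and scaleC_one: "1 *\<^sub>C x = x"

global_interpretation complex_vector: vector_space "scaleC :: complex \<Rightarrow> 'a \<Rightarrow> 'a :: complex_vector"
  by unfold_locales (simp_all add: scaleC_add_right scaleC_add_left scaleC_scaleC scaleC_one)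

instantiation "fun" :: (type, complex_vector) complex_vector
begin

definition scaleC_fun :: "complex \<Rightarrow> ('a \<Rightarrow> 'b) \<Rightarrow> 'a \<Rightarrow> 'b" where
  "scaleC_fun a f = (\<lambda>x. a *\<^sub>C f x)"

instance
  by standard
    (simp_all add: scaleC_fun_def fun_eq_iff scaleC_add_right scaleC_add_left scaleC_scaleC scaleC_one)

end

text \<open>
  A Hilbert space is a linear subspace \<^term>\<open>hspace H\<close> of some type of class
  \<^class>\<open>complex_vector\<close>, with an inner product that is meaningful only on this subspace.
  This allows Hilbert spaces of functions, closed subspaces and completions to be treated alike.
  Likewise, operators are functions on the ambient type and only their values on \<^term>\<open>hspace H\<close>
  matter.
\<close>

record 'a hilb =
  hspace :: "'a set"
  hinner :: "'a \<Rightarrow> 'a \<Rightarrow> complex"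

definition hnorm :: "'a hilb \<Rightarrow> 'a \<Rightarrow> real" where
  "hnorm H v = sqrt (Re (hinner H v v))"

text \<open>The value \<open>0\<close> off the space makes \<^locale>\<open>Metric_space\<close> applicable, since some of its
  axioms are not relativised to the carrier.\<close>

definition hdist :: "('a::complex_vector) hilb \<Rightarrow> 'a \<Rightarrow> 'a \<Rightarrow> real" where
  "hdist H v w = (if v \<in> hspace H \<and> w \<in> hspace H then hnorm H (v - w) else 0)"

definition htop :: "('a::complex_vector) hilb \<Rightarrow> 'a topology" where
  "htop H = Metric_space.mtopology (hspace H) (hdist H)"

definition pre_hilbert :: "('a::complex_vector) hilb \<Rightarrow> bool" where
  "pre_hilbert H \<longleftrightarrow>
     complex_vector.subspace (hspace H) \<and>
     (\<forall>u\<in>hspace H. \<forall>v\<in>hspace H. \<forall>w\<in>hspace H.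
        hinner H (u + v) w = hinner H u w + hinner H v w) \<and>
     (\<forall>a. \<forall>v\<in>hspace H. \<forall>w\<in>hspace H. hinner H (a *\<^sub>C v) w = a * hinner H v w) \<and>
     (\<forall>v\<in>hspace H. \<forall>w\<in>hspace H. hinner H w v = cnj (hinner H v w)) \<and>
     (\<forall>v\<in>hspace H. hinner H v v \<in> \<real>\<^sub>\<ge>\<^sub>0 \<and> (hinner H v v = 0 \<longrightarrow> v = 0))"

definition hilbert :: "('a::complex_vector) hilb \<Rightarrow> bool" where
  "hilbert H \<longleftrightarrow> pre_hilbert H \<and> Metric_space.mcomplete (hspace H) (hdist H)"

definition hsub :: "'a hilb \<Rightarrow> 'a set \<Rightarrow> 'a hilb" where
  "hsub H V = \<lparr>hspace = V, hinner = hinner H\<rparr>"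

definition closed_subspace :: "('a::complex_vector) hilb \<Rightarrow> 'a set \<Rightarrow> bool" where
  "closed_subspace H V \<longleftrightarrow> complex_vector.subspace V \<and> closedin (htop H) V"

definition closed_span :: "('a::complex_vector) hilb \<Rightarrow> 'a set \<Rightarrow> 'a set" where
  "closed_span H A = htop H closure_of (complex_vector.span A)"

definition linear_between ::
    "('a::complex_vector) set \<Rightarrow> ('b::complex_vector) set \<Rightarrow> ('a \<Rightarrow> 'b) \<Rightarrow> bool" where
  "linear_between V W A \<longleftrightarrow>
     A ` V \<subseteq> W \<and>
     (\<forall>u\<in>V. \<forall>v\<in>V. A (u + v) = A u + A v) \<and>
     (\<forall>a. \<forall>v\<in>V. A (a *\<^sub>C v) = a *\<^sub>C A v)"

definition bounded_op :: "('a::complex_vector) hilb \<Rightarrow> ('a \<Rightarrow> 'a) \<Rightarrow> bool" where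
  "bounded_op H A \<longleftrightarrow>
     linear_between (hspace H) (hspace H) A \<and>
     (\<exists>C. \<forall>v\<in>hspace H. hnorm H (A v) \<le> C * hnorm H v)"

definition unitary_map ::
    "('a::complex_vector) hilb \<Rightarrow> ('b::complex_vector) hilb \<Rightarrow> ('a \<Rightarrow> 'b) \<Rightarrow> bool" where
  "unitary_map H K U \<longleftrightarrow>
     linear_between (hspace H) (hspace K) U \<and>
     bij_betw U (hspace H) (hspace K) \<and>
     (\<forall>v\<in>hspace H. \<forall>w\<in>hspace H. hinner K (U v) (U w) = hinner H v w)"

definition hadjoint :: "'a hilb \<Rightarrow> 'b hilb \<Rightarrow> ('a \<Rightarrow> 'b) \<Rightarrow> 'b \<Rightarrow> 'a" where
  "hadjoint H K A w =
     (THE v. v \<in> hspace H \<and> (\<forall>u\<in>hspace H. hinner K (A u) w = hinner H u v))"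

definition orth_proj :: "('a::complex_vector) hilb \<Rightarrow> 'a set \<Rightarrow> 'a \<Rightarrow> 'a" where
  "orth_proj H V v = (THE w. w \<in> V \<and> (\<forall>u\<in>V. hinner H (v - w) u = 0))"


section \<open>Positive definite kernels and reproducing kernel Hilbert spaces\<close>

definition pos_def_kernel ::
    "'x set \<Rightarrow> ('f::complex_vector) hilb \<Rightarrow> ('x \<Rightarrow> 'x \<Rightarrow> 'f \<Rightarrow> 'f) \<Rightarrow> bool" where
  "pos_def_kernel X F K \<longleftrightarrow>
     (\<forall>x\<in>X. \<forall>y\<in>X. bounded_op F (K x y)) \<and>
     (\<forall>(n::nat) x v. (\<forall>j<n. x j \<in> X \<and> v j \<in> hspace F) \<longrightarrow>
        (\<Sum>j<n. \<Sum>k<n. hinner F (K (x j) (x k) (v k)) (v j)) \<in> \<real>\<^sub>\<ge>\<^sub>0)"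

text \<open>Functions on a subset \<open>X\<close> of a type are encoded as functions vanishing off \<open>X\<close>.\<close>

definition functions_on :: "'x set \<Rightarrow> ('f::complex_vector) hilb \<Rightarrow> ('x \<Rightarrow> 'f) set" where
  "functions_on X F = {f. (\<forall>x\<in>X. f x \<in> hspace F) \<and> (\<forall>x. x \<notin> X \<longrightarrow> f x = 0)}"

definition restrict0 :: "'x set \<Rightarrow> ('x \<Rightarrow> 'f::zero) \<Rightarrow> 'x \<Rightarrow> 'f" where
  "restrict0 X f = (\<lambda>x. if x \<in> X then f x else 0)"

definition is_rkhs ::
    "'x set \<Rightarrow> ('f::complex_vector) hilb \<Rightarrow> ('x \<Rightarrow> 'x \<Rightarrow> 'f \<Rightarrow> 'f) \<Rightarrow> ('x \<Rightarrow> 'f) hilb \<Rightarrow> bool" where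
  "is_rkhs X F K H \<longleftrightarrow>
     hilbert H \<and> hspace H \<subseteq> functions_on X F \<and>
     (\<forall>x\<in>X. continuous_map (htop H) (htop F) (\<lambda>f. f x)) \<and>
     (\<forall>x\<in>X. \<forall>y\<in>X. \<forall>v\<in>hspace F. K x y v = hadjoint H F (\<lambda>f. f y) v x)"

text \<open>For a positive definite kernel, this space exists and is unique up to the irrelevant values of
  \<^const>\<open>hinner\<close> off \<^const>\<open>hspace\<close>; therefore \<open>SOME\<close> and not \<open>THE\<close>.\<close>

definition rkhs ::
    "'x set \<Rightarrow> ('f::complex_vector) hilb \<Rightarrow> ('x \<Rightarrow> 'x \<Rightarrow> 'f \<Rightarrow> 'f) \<Rightarrow> ('x \<Rightarrow> 'f) hilb" where
  "rkhs X F K = (SOME H. is_rkhs X F K H)"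


section \<open>Symmetric groups and involutive semigroups\<close>

definition symmetric_group :: "('g, 'm) monoid_scheme \<Rightarrow> ('g \<Rightarrow> 'g) \<Rightarrow> bool" where
  "symmetric_group G \<tau> \<longleftrightarrow> group G \<and> \<tau> \<in> iso G G \<and> (\<forall>g\<in>carrier G. \<tau> (\<tau> g) = g)"

definition sharp :: "('g, 'm) monoid_scheme \<Rightarrow> ('g \<Rightarrow> 'g) \<Rightarrow> 'g \<Rightarrow> 'g" where
  "sharp G \<tau> g = inv\<^bsub>G\<^esub> (\<tau> g)"

definition sharp_subsemigroup :: "('g, 'm) monoid_scheme \<Rightarrow> ('g \<Rightarrow> 'g) \<Rightarrow> 'g set \<Rightarrow> bool" where
  "sharp_subsemigroup G \<tau> S \<longleftrightarrow>
     S \<subseteq> carrier G \<and> (\<forall>s\<in>S. \<forall>t\<in>S. s \<otimes>\<^bsub>G\<^esub> t \<in> S) \<and> sharp G \<tau> ` S = S"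

text \<open>The semidirect product of \<open>G\<close> with the two-element group \<open>{1, \<tau>}\<close>, where \<open>True\<close> stands
  for \<open>\<tau>\<close>. It is a group of order two also when \<open>\<tau>\<close> is the identity on \<open>G\<close>.\<close>

definition semidirect_tau :: "('g, 'm) monoid_scheme \<Rightarrow> ('g \<Rightarrow> 'g) \<Rightarrow> ('g \<times> bool) monoid" where
  "semidirect_tau G \<tau> =
     \<lparr>carrier = carrier G \<times> UNIV,
      mult = (\<lambda>(g, a) (h, b). (g \<otimes>\<^bsub>G\<^esub> (if a then \<tau> h else h), a \<noteq> b)),
      one = (\<one>\<^bsub>G\<^esub>, False)\<rparr>"

text \<open>Involutive semigroups are subsets \<open>T\<close> of \<open>G\<close> with the multiplication of \<open>G\<close> and an
  involution \<open>star\<close>: \<open>G\<close> itself with the inverse, or \<open>S\<close> with \<^const>\<open>sharp\<close>. Only the values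
  of \<open>\<phi>\<close> on \<open>T\<close> enter below, so that no explicit restriction to \<open>S\<close> is needed.\<close>

definition fun_kernel ::
    "('g, 'm) monoid_scheme \<Rightarrow> ('g \<Rightarrow> 'g) \<Rightarrow> ('g \<Rightarrow> 'f \<Rightarrow> 'f) \<Rightarrow> 'g \<Rightarrow> 'g \<Rightarrow> 'f \<Rightarrow> 'f" where
  "fun_kernel G star \<phi> s t = \<phi> (s \<otimes>\<^bsub>G\<^esub> star t)"

definition pos_def_function ::
    "('g, 'm) monoid_scheme \<Rightarrow> 'g set \<Rightarrow> ('g \<Rightarrow> 'g) \<Rightarrow> ('f::complex_vector) hilb
      \<Rightarrow> ('g \<Rightarrow> 'f \<Rightarrow> 'f) \<Rightarrow> bool" where
  "pos_def_function G T star F \<phi> \<longleftrightarrow> pos_def_kernel T F (fun_kernel G star \<phi>)"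

definition fun_rkhs ::
    "('g, 'm) monoid_scheme \<Rightarrow> 'g set \<Rightarrow> ('g \<Rightarrow> 'g) \<Rightarrow> ('f::complex_vector) hilb
      \<Rightarrow> ('g \<Rightarrow> 'f \<Rightarrow> 'f) \<Rightarrow> ('g \<Rightarrow> 'f) hilb" where
  "fun_rkhs G T star F \<phi> = rkhs T F (fun_kernel G star \<phi>)"

definition right_transl ::
    "('g, 'm) monoid_scheme \<Rightarrow> 'g set \<Rightarrow> 'g \<Rightarrow> ('g \<Rightarrow> 'f::zero) \<Rightarrow> 'g \<Rightarrow> 'f" where
  "right_transl G T s f = restrict0 T (\<lambda>t. f (t \<otimes>\<^bsub>G\<^esub> s))"


section \<open>Reflection positivity\<close>

definition reflection_positive_function ::
    "('g, 'm) monoid_scheme \<Rightarrow> ('g \<Rightarrow> 'g) \<Rightarrow> 'g set \<Rightarrow> ('f::complex_vector) hilb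
      \<Rightarrow> ('g \<Rightarrow> 'f \<Rightarrow> 'f) \<Rightarrow> bool" where
  "reflection_positive_function G \<tau> S F \<phi> \<longleftrightarrow>
     (\<forall>g\<in>carrier G. bounded_op F (\<phi> g)) \<and>
     pos_def_function G (carrier G) (\<lambda>g. inv\<^bsub>G\<^esub> g) F \<phi> \<and>
     (\<forall>g\<in>carrier G. \<forall>v\<in>hspace F. \<phi> (\<tau> g) v = \<phi> g v) \<and>
     pos_def_function G S (sharp G \<tau>) F \<phi>"

definition unitary_rep ::
    "('k, 'm) monoid_scheme \<Rightarrow> ('e::complex_vector) hilb \<Rightarrow> ('k \<Rightarrow> 'e \<Rightarrow> 'e) \<Rightarrow> bool" where
  "unitary_rep K E \<pi> \<longleftrightarrow>
     (\<forall>x\<in>carrier K. unitary_map E E (\<pi> x)) \<and>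
     (\<forall>x\<in>carrier K. \<forall>y\<in>carrier K. \<forall>v\<in>hspace E. \<pi> (x \<otimes>\<^bsub>K\<^esub> y) v = \<pi> x (\<pi> y v))"

definition Eplus ::
    "'g set \<Rightarrow> ('e::complex_vector) hilb \<Rightarrow> ('g \<times> bool \<Rightarrow> 'e \<Rightarrow> 'e) \<Rightarrow> 'e set \<Rightarrow> 'e set" where
  "Eplus S E \<pi> F = closed_span E {\<pi> (s, False) v |s v. s \<in> S \<and> v \<in> F}"

definition theta ::
    "('g, 'm) monoid_scheme \<Rightarrow> ('g \<times> bool \<Rightarrow> 'e \<Rightarrow> 'e) \<Rightarrow> 'e \<Rightarrow> 'e" where
  "theta G \<pi> = \<pi> (\<one>\<^bsub>G\<^esub>, True)"

definition reflection_positive_cyclic_rep ::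
    "('g, 'm) monoid_scheme \<Rightarrow> ('g \<Rightarrow> 'g) \<Rightarrow> 'g set \<Rightarrow> ('g \<times> bool \<Rightarrow> 'e \<Rightarrow> 'e)
      \<Rightarrow> ('e::complex_vector) hilb \<Rightarrow> 'e set \<Rightarrow> bool" where
  "reflection_positive_cyclic_rep G \<tau> S \<pi> E F \<longleftrightarrow>
     hilbert E \<and>
     unitary_rep (semidirect_tau G \<tau>) E \<pi> \<and>
     closed_subspace E F \<and>
     closed_span E {\<pi> (g, False) v |g v. g \<in> carrier G \<and> v \<in> F} = hspace E \<and>
     (\<forall>v\<in>F. theta G \<pi> v = v) \<and>
     (\<forall>v\<in>Eplus S E \<pi> F. hinner E (theta G \<pi> v) v \<in> \<real>\<^sub>\<ge>\<^sub>0)"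

definition null_space ::
    "('g, 'm) monoid_scheme \<Rightarrow> 'g set \<Rightarrow> ('g \<times> bool \<Rightarrow> 'e \<Rightarrow> 'e)
      \<Rightarrow> ('e::complex_vector) hilb \<Rightarrow> 'e set \<Rightarrow> 'e set" where
  "null_space G S \<pi> E F = {v \<in> Eplus S E \<pi> F. hinner E (theta G \<pi> v) v = 0}"

definition null_class ::
    "('g, 'm) monoid_scheme \<Rightarrow> 'g set \<Rightarrow> ('g \<times> bool \<Rightarrow> 'e \<Rightarrow> 'e)
      \<Rightarrow> ('e::complex_vector) hilb \<Rightarrow> 'e set \<Rightarrow> 'e \<Rightarrow> 'e set" where
  "null_class G S \<pi> E F v = {v + n |n. n \<in> null_space G S \<pi> E F}"

text \<open>\<open>Eh\<close>, together with the embedding \<open>j\<close> of the quotient space of cosets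
  (\<^const>\<open>null_class\<close>), is a Hilbert completion of this quotient: \<open>j\<close> is linear for the
  operations induced on cosets, isometric, and has dense range.\<close>

definition hat_completion ::
    "('g, 'm) monoid_scheme \<Rightarrow> 'g set \<Rightarrow> ('g \<times> bool \<Rightarrow> 'e \<Rightarrow> 'e)
      \<Rightarrow> ('e::complex_vector) hilb \<Rightarrow> 'e set
      \<Rightarrow> ('h::complex_vector) hilb \<Rightarrow> ('e set \<Rightarrow> 'h) \<Rightarrow> bool" where
  "hat_completion G S \<pi> E F Eh j \<longleftrightarrow>
     hilbert Eh \<and>
     linear_between (Eplus S E \<pi> F) (hspace Eh) (\<lambda>v. j (null_class G S \<pi> E F v)) \<and>
     (\<forall>v\<in>Eplus S E \<pi> F.
        hnorm Eh (j (null_class G S \<pi> E F v)) = sqrt (Re (hinner E (theta G \<pi> v) v))) \<and>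
     htop Eh closure_of ((\<lambda>v. j (null_class G S \<pi> E F v)) ` Eplus S E \<pi> F) = hspace Eh"

text \<open>The action of \<open>s\<close> on the completion is the bounded operator, unique by density, that is
  given on classes by \<open>[v] \<mapsto> [\<pi>(s) v]\<close>. (\<open>SOME\<close>, because the values off the space are
  irrelevant.)\<close>

definition hat_action ::
    "('g, 'm) monoid_scheme \<Rightarrow> 'g set \<Rightarrow> ('g \<times> bool \<Rightarrow> 'e \<Rightarrow> 'e)
      \<Rightarrow> ('e::complex_vector) hilb \<Rightarrow> 'e set
      \<Rightarrow> ('h::complex_vector) hilb \<Rightarrow> ('e set \<Rightarrow> 'h) \<Rightarrow> 'g \<Rightarrow> 'h \<Rightarrow> 'h" where
  "hat_action G S \<pi> E F Eh j s =
     (SOME A. bounded_op Eh A \<and>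
        (\<forall>v\<in>Eplus S E \<pi> F.
           A (j (null_class G S \<pi> E F v)) = j (null_class G S \<pi> E F (\<pi> (s, False) v))))"


section \<open>The representation of a reflection positive function\<close>

definition compression ::
    "('e::complex_vector) hilb \<Rightarrow> 'e set \<Rightarrow> ('g \<times> bool \<Rightarrow> 'e \<Rightarrow> 'e) \<Rightarrow> 'g \<Rightarrow> 'e \<Rightarrow> 'e" where
  "compression E F \<pi> g = (let P = orth_proj E F in P \<circ> \<pi> (g, False) \<circ> hadjoint E (hsub E F) P)"

definition tau_action ::
    "('g, 'm) monoid_scheme \<Rightarrow> ('g \<Rightarrow> 'g) \<Rightarrow> ('g \<Rightarrow> 'f::zero) \<Rightarrow> 'g \<Rightarrow> 'f" where
  "tau_action G \<tau> f = restrict0 (carrier G) (\<lambda>x. f (\<tau> x))"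

definition pi_phi ::
    "('g, 'm) monoid_scheme \<Rightarrow> ('g \<Rightarrow> 'g) \<Rightarrow> 'g \<times> bool \<Rightarrow> ('g \<Rightarrow> 'f::zero) \<Rightarrow> 'g \<Rightarrow> 'f" where
  "pi_phi G \<tau> = (\<lambda>(g, b) f. right_transl G (carrier G) g (if b then tau_action G \<tau> f else f))"

end

theory Submission
  imports Defs
begin

text \<open>
  Part (i): \<open>\<Sum>\<langle>\<phi>(x\<^sub>j x\<^sub>k\<inverse>)v\<^sub>k,v\<^sub>j\<rangle>\<close> is \<open>\<parallel>u\<parallel>\<^sup>2\<close> for \<open>u = \<Sum>\<pi>(x\<^sub>k\<inverse>)v\<^sub>k\<close>, and
  \<open>\<Sum>\<langle>\<phi>(s\<^sub>j s\<^sub>k\<^sup>\<sharp>)v\<^sub>k,v\<^sub>j\<rangle>\<close> is \<open>\<langle>\<theta>u,u\<rangle>\<close> for \<open>u = \<Sum>\<pi>(s\<^sub>k\<^sup>\<sharp>)v\<^sub>k \<in> E\<^sub>+\<close>.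

  Part (ii): translations of \<open>G\<close> and \<open>\<tau>\<close> permute the arguments of the kernel and preserve it, so they
  permute the kernel functions \<open>K(\<cdot>,y)v\<close> and act unitarily. Restriction to \<open>S\<close> sends
  \<open>\<pi>(s)\<iota>v\<close> to the kernel function of \<open>\<phi>|\<^sub>S\<close> at \<open>s\<^sup>\<sharp>\<close>, and
  \<open>\<langle>f|\<^sub>S,g|\<^sub>S\<rangle> = \<langle>\<theta>f,g\<rangle>\<close> holds on these generators, hence on their span and, because convergence is
  pointwise, on \<open>E\<^sub>+\<close>. This gives positivity of \<open>\<theta>\<close> and the isometry \<open>[f] \<mapsto> f|\<^sub>S\<close> with dense range.
\<close>

text \<open>Two obstacles lie outside this outline. \<open>rkhs\<close> and
  \<open>hat_action\<close> are choices by \<open>SOME\<close>, so each can be used only after an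
  object of the required kind has been constructed. For \<open>rkhs\<close> this is a completion of
  the formal combinations of kernel functions, realized inside the space of functions; the bounds on
  point evaluations make its limits pointwise and its form definite. For \<open>hat_action\<close>
  it is a bounded operator on the completion, and isometry of \<open>\<pi>(s)\<close> in the norm of
  \<open>E\<close> does not give one, since the seminorm coming from \<open>\<theta>\<close> can be
  much smaller than that norm. What gives it is contractivity in the seminorm itself. Both
  constructions involve forms that may be degenerate, on formal combinations and on
  \<open>E_+\<close>, so Cauchy-Schwarz and the calculus of limits are set up for semi-inner
  products.\<close>

text \<open>It yields Cauchy-Schwarz and, with \<open>A = 0\<close>, turns the first-order condition
  of a minimization into an equation.\<close>

lemma discriminant_le:
  fixes A C D :: real
  assumes "\<And>t. 0 \<le> A - 2 * t * C + t\<^sup>2 * D" "0 \<le> D"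
  shows "C\<^sup>2 \<le> A * D"
proof (cases "D = 0")
  case True
  have "C = 0"
  proof (rule ccontr)
    assume "C \<noteq> 0"
    \<comment> \<open>At this \<open>t\<close> the affine function \<open>A - 2 * t * C\<close> has
      the value -1.\<close>
    with assms(1)[of "(A + 1) / (2 * C)"] True show False by simp
  qed
  with True show ?thesis by simp
next
  case False
  with assms(2) have "0 < D" by simp
  \<comment> \<open>The quadratic attains its minimum at \<open>t = C / D\<close>.\<close>
  have "0 \<le> A - 2 * (C / D) * C + (C / D)\<^sup>2 * D" by (rule assms(1))
  also have "\<dots> = A - C\<^sup>2 / D" using \<open>0 < D\<close> by (simp add: field_simps power2_eq_square)
  finally show ?thesis using \<open>0 < D\<close> by (simp add: field_simps)
qed

section \<open>Semi-inner products\<close>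

text \<open>Definiteness is left out in order to cover the form on formal combinations of kernel
  functions and the form given by \<theta> on \<open>Eplus\<close>, both of which may be
  degenerate.\<close>

locale semi_hilb =
  fixes H :: "('a::complex_vector) hilb"
  assumes subspace: "complex_vector.subspace (hspace H)"
    and add_left: "\<lbrakk>u \<in> hspace H; v \<in> hspace H; w \<in> hspace H\<rbrakk>
      \<Longrightarrow> hinner H (u + v) w = hinner H u w + hinner H v w"
    and scale_left: "\<lbrakk>v \<in> hspace H; w \<in> hspace H\<rbrakk> \<Longrightarrow> hinner H (a *\<^sub>C v) w = a * hinner H v w"
    and herm: "\<lbrakk>v \<in> hspace H; w \<in> hspace H\<rbrakk> \<Longrightarrow> hinner H w v = cnj (hinner H v w)"
    and nonneg: "v \<in> hspace H \<Longrightarrow> 0 \<le> Re (hinner H v v)"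
begin

lemma zero_mem [simp]: "0 \<in> hspace H"
  using subspace by (rule complex_vector.subspace_0)

lemma add_mem [simp]: "\<lbrakk>v \<in> hspace H; w \<in> hspace H\<rbrakk> \<Longrightarrow> v + w \<in> hspace H"
  using subspace by (rule complex_vector.subspace_add)

lemma diff_mem [simp]: "\<lbrakk>v \<in> hspace H; w \<in> hspace H\<rbrakk> \<Longrightarrow> v - w \<in> hspace H"
  using subspace by (rule complex_vector.subspace_diff)

lemma scale_mem [simp]: "v \<in> hspace H \<Longrightarrow> a *\<^sub>C v \<in> hspace H"
  using subspace by (rule complex_vector.subspace_scale)

lemma sum_mem: "(\<And>i. i \<in> I \<Longrightarrow> f i \<in> hspace H) \<Longrightarrow> sum f I \<in> hspace H"
  using subspace by (rule complex_vector.subspace_sum)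

lemma add_right:
  "\<lbrakk>u \<in> hspace H; v \<in> hspace H; w \<in> hspace H\<rbrakk> \<Longrightarrow> hinner H u (v + w) = hinner H u v + hinner H u w"
  by (metis add_left add_mem complex_cnj_add herm)

lemma scale_right:
  "\<lbrakk>v \<in> hspace H; w \<in> hspace H\<rbrakk> \<Longrightarrow> hinner H v (a *\<^sub>C w) = cnj a * hinner H v w"
  by (metis scale_left scale_mem complex_cnj_mult herm)

lemma zero_left [simp]: "v \<in> hspace H \<Longrightarrow> hinner H 0 v = 0"
  using add_left[of 0 0 v] by simp

lemma zero_right [simp]: "v \<in> hspace H \<Longrightarrow> hinner H v 0 = 0"
  using add_right[of v 0 0] by simp

lemma diff_left:
  "\<lbrakk>u \<in> hspace H; v \<in> hspace H; w \<in> hspace H\<rbrakk> \<Longrightarrow> hinner H (u - v) w = hinner H u w - hinner H v w"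
  using add_left[of "u - v" v w] by simp

lemma diff_right:
  "\<lbrakk>u \<in> hspace H; v \<in> hspace H; w \<in> hspace H\<rbrakk> \<Longrightarrow> hinner H u (v - w) = hinner H u v - hinner H u w"
  using add_right[of u "v - w" w] by simp

lemma sum_left:
  assumes "\<And>i. i \<in> I \<Longrightarrow> f i \<in> hspace H" "w \<in> hspace H"
  shows "hinner H (sum f I) w = (\<Sum>i\<in>I. hinner H (f i) w)"
  using assms(1)
proof (induction I rule: infinite_finite_induct)
  case (insert i I)
  then show ?case by (simp add: add_left assms(2) sum_mem)
qed (simp_all add: assms)

lemma sum_right:
  assumes "\<And>i. i \<in> I \<Longrightarrow> f i \<in> hspace H" "w \<in> hspace H"
  shows "hinner H w (sum f I) = (\<Sum>i\<in>I. hinner H w (f i))"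
  using assms(1)
proof (induction I rule: infinite_finite_induct)
  case (insert i I)
  then show ?case by (simp add: add_right assms(2) sum_mem)
qed (simp_all add: assms)

lemma norm_nonneg [simp]: "v \<in> hspace H \<Longrightarrow> 0 \<le> hnorm H v"
  by (simp add: hnorm_def nonneg)

lemma norm_sq: "v \<in> hspace H \<Longrightarrow> (hnorm H v)\<^sup>2 = Re (hinner H v v)"
  by (simp add: hnorm_def nonneg)

lemma inner_self: "v \<in> hspace H \<Longrightarrow> hinner H v v = complex_of_real ((hnorm H v)\<^sup>2)"
proof -
  assume v: "v \<in> hspace H"
  have "Im (hinner H v v) = 0" using arg_cong[OF herm[OF v v], of Im] by simp
  then show ?thesis by (simp add: complex_eq_iff norm_sq v)
qed

lemma Re_commute: "\<lbrakk>v \<in> hspace H; w \<in> hspace H\<rbrakk> \<Longrightarrow> Re (hinner H w v) = Re (hinner H v w)"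
  by (metis complex_cnj herm complex.sel(1) cnj.sel(1))

lemma norm_add_sq:
  "\<lbrakk>v \<in> hspace H; w \<in> hspace H\<rbrakk>
    \<Longrightarrow> (hnorm H (v + w))\<^sup>2 = (hnorm H v)\<^sup>2 + 2 * Re (hinner H v w) + (hnorm H w)\<^sup>2"
  by (simp add: norm_sq add_left add_right Re_commute[of v w])

lemma norm_diff_sq:
  "\<lbrakk>v \<in> hspace H; w \<in> hspace H\<rbrakk>
    \<Longrightarrow> (hnorm H (v - w))\<^sup>2 = (hnorm H v)\<^sup>2 - 2 * Re (hinner H v w) + (hnorm H w)\<^sup>2"
  by (simp add: norm_sq diff_left diff_right Re_commute[of v w])

lemma norm_scale: "v \<in> hspace H \<Longrightarrow> hnorm H (a *\<^sub>C v) = cmod a * hnorm H v"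
proof -
  assume v: "v \<in> hspace H"
  have "hinner H (a *\<^sub>C v) (a *\<^sub>C v) = (a * cnj a) * hinner H v v"
    using v by (simp add: scale_left scale_right)
  also have "\<dots> = complex_of_real ((cmod a)\<^sup>2 * (hnorm H v)\<^sup>2)"
    using v by (simp only: complex_norm_square[symmetric] inner_self of_real_mult)
  finally have "(hnorm H (a *\<^sub>C v))\<^sup>2 = (cmod a * hnorm H v)\<^sup>2"
    using v by (simp add: norm_sq[of "a *\<^sub>C v"] power_mult_distrib)
  then show ?thesis using v by (simp add: power2_eq_iff_nonneg)
qed

lemma norm_zero [simp]: "hnorm H 0 = 0"
  using norm_scale[of 0 0] by simp

lemma norm_uminus: "v \<in> hspace H \<Longrightarrow> hnorm H (- v) = hnorm H v"
  using norm_scale[of v "-1"] by simp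

lemma norm_minus_commute: "\<lbrakk>v \<in> hspace H; w \<in> hspace H\<rbrakk> \<Longrightarrow> hnorm H (v - w) = hnorm H (w - v)"
  using norm_uminus[of "v - w"] by simp

text \<open>The vector subtracted from \<open>v\<close> is \<open>t * c\<close> times
  \<open>w\<close> with \<open>c = hinner H v w\<close>. The factor \<open>c\<close> makes the mixed
  term real, so real \<open>t\<close> suffice, and nothing is divided by the norm of
  \<open>w\<close>, which may be zero for nonzero \<open>w\<close>.\<close>

lemma cauchy_schwarz:
  assumes v: "v \<in> hspace H" and w: "w \<in> hspace H"
  shows "cmod (hinner H v w) \<le> hnorm H v * hnorm H w"
proof -
  define c where "c = hinner H v w"
  define C where "C = (cmod c)\<^sup>2"
  have quad: "0 \<le> (hnorm H v)\<^sup>2 - 2 * t * C + t\<^sup>2 * (C * (hnorm H w)\<^sup>2)" for t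
  proof -
    have "hinner H v ((complex_of_real t * c) *\<^sub>C w) = complex_of_real t * (c * cnj c)"
      using v w by (simp add: scale_right c_def)
    then have "Re (hinner H v ((complex_of_real t * c) *\<^sub>C w)) = t * C"
      by (simp add: complex_norm_square[symmetric] C_def del: of_real_power)
    then have "(hnorm H (v - (complex_of_real t * c) *\<^sub>C w))\<^sup>2
        = (hnorm H v)\<^sup>2 - 2 * (t * C) + t\<^sup>2 * (C * (hnorm H w)\<^sup>2)"
      using v w by (simp add: norm_diff_sq norm_scale norm_mult power_mult_distrib C_def)
    then show ?thesis by (metis zero_le_power2 mult.assoc)
  qed
  have "C\<^sup>2 \<le> (hnorm H v)\<^sup>2 * (C * (hnorm H w)\<^sup>2)"
    by (rule discriminant_le[OF quad]) (simp add: C_def)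
  then have "C * C \<le> C * (hnorm H v * hnorm H w)\<^sup>2"
    by (simp add: power2_eq_square algebra_simps)
  moreover have "0 \<le> C" by (simp add: C_def)
  ultimately have "C \<le> (hnorm H v * hnorm H w)\<^sup>2"
    by (cases "C = 0") (auto simp: mult_le_cancel_left)
  then show ?thesis
    using v w by (simp add: C_def c_def power2_le_iff_abs_le)
qed

lemma Re_inner_le: "\<lbrakk>v \<in> hspace H; w \<in> hspace H\<rbrakk> \<Longrightarrow> Re (hinner H v w) \<le> hnorm H v * hnorm H w"
  using cauchy_schwarz[of v w] complex_Re_le_cmod[of "hinner H v w"] by linarith

lemma norm_triangle:
  assumes v: "v \<in> hspace H" and w: "w \<in> hspace H"
  shows "hnorm H (v + w) \<le> hnorm H v + hnorm H w"
proof -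
  have "(hnorm H (v + w))\<^sup>2 \<le> (hnorm H v + hnorm H w)\<^sup>2"
    using v w Re_inner_le[OF v w] by (simp add: norm_add_sq power2_sum)
  then show ?thesis using v w by (simp add: power2_le_iff_abs_le)
qed

lemma norm_triangle_diff:
  "\<lbrakk>u \<in> hspace H; v \<in> hspace H; w \<in> hspace H\<rbrakk>
    \<Longrightarrow> hnorm H (u - w) \<le> hnorm H (u - v) + hnorm H (v - w)"
  using norm_triangle[of "u - v" "v - w"] by simp

lemma norm_diff_abs_le:
  assumes "v \<in> hspace H" "w \<in> hspace H"
  shows "\<bar>hnorm H v - hnorm H w\<bar> \<le> hnorm H (v - w)"
  using norm_triangle[of "v - w" w] norm_triangle[of "w - v" v] norm_minus_commute[of v w] assms
  by simp

lemma parallelogram: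
  "\<lbrakk>v \<in> hspace H; w \<in> hspace H\<rbrakk>
    \<Longrightarrow> (hnorm H (v + w))\<^sup>2 + (hnorm H (v - w))\<^sup>2 = 2 * (hnorm H v)\<^sup>2 + 2 * (hnorm H w)\<^sup>2"
  by (simp add: norm_add_sq norm_diff_sq)

lemma polarization_Re:
  "\<lbrakk>v \<in> hspace H; w \<in> hspace H\<rbrakk>
    \<Longrightarrow> Re (hinner H v w) = ((hnorm H (v + w))\<^sup>2 - (hnorm H v)\<^sup>2 - (hnorm H w)\<^sup>2) / 2"
  by (simp add: norm_add_sq)

text \<open>The second argument is conjugate linear, so replacing \<open>w\<close> by \<i> times
  \<open>w\<close> multiplies the product by -\<i> and moves its imaginary part into the real part.
  Polarization of real parts thereby determines the whole product.\<close>

lemma inner_Im: "\<lbrakk>v \<in> hspace H; w \<in> hspace H\<rbrakk> \<Longrightarrow> Im (hinner H v w) = Re (hinner H v (\<i> *\<^sub>C w))"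
  by (simp add: scale_right)

end

section \<open>Convergent and Cauchy sequences for a semi-inner product\<close>

text \<open>Membership of all terms is included because norms mean nothing off the space. In a
  degenerate space limits are not unique.\<close>

definition hconv :: "('a::complex_vector) hilb \<Rightarrow> (nat \<Rightarrow> 'a) \<Rightarrow> 'a \<Rightarrow> bool" where
  "hconv H f x \<longleftrightarrow>
     (\<forall>n. f n \<in> hspace H) \<and> x \<in> hspace H \<and> (\<lambda>n. hnorm H (f n - x)) \<longlonglongrightarrow> 0"

definition hcauchy :: "('a::complex_vector) hilb \<Rightarrow> (nat \<Rightarrow> 'a) \<Rightarrow> bool" where
  "hcauchy H f \<longleftrightarrow>
     (\<forall>n. f n \<in> hspace H) \<and> (\<forall>e>0. \<exists>N. \<forall>m\<ge>N. \<forall>n\<ge>N. hnorm H (f m - f n) < e)"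

context semi_hilb
begin

lemma hconv_cauchy:
  assumes "hconv H f x" shows "hcauchy H f"
  unfolding hcauchy_def
proof (intro conjI allI impI)
  show mem: "f n \<in> hspace H" for n using assms by (simp add: hconv_def)
  fix e :: real assume "e > 0"
  moreover have "(\<lambda>n. hnorm H (f n - x)) \<longlonglongrightarrow> 0" and x: "x \<in> hspace H"
    using assms by (simp_all add: hconv_def)
  ultimately obtain N where N: "\<And>n. n \<ge> N \<Longrightarrow> \<bar>hnorm H (f n - x)\<bar> < e / 2"
    using LIMSEQ_D[of "\<lambda>n. hnorm H (f n - x)" 0 "e / 2"] by auto
  show "\<exists>N. \<forall>m\<ge>N. \<forall>n\<ge>N. hnorm H (f m - f n) < e"
  proof (intro exI allI impI)
    fix m n assume "N \<le> m" "N \<le> n"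
    then show "hnorm H (f m - f n) < e"
      using norm_triangle_diff[OF mem[of m] x mem[of n]] N[of m] N[of n]
        norm_minus_commute[OF x mem[of n]] by linarith
  qed
qed

lemma hconv_norm:
  assumes "hconv H f x" shows "(\<lambda>n. hnorm H (f n)) \<longlonglongrightarrow> hnorm H x"
proof (rule Lim_transform2[OF tendsto_const])
  show "(\<lambda>n. hnorm H x - hnorm H (f n)) \<longlonglongrightarrow> 0"
  proof (rule tendsto_rabs_zero_cancel, rule real_tendsto_sandwich)
    show "\<forall>\<^sub>F n in sequentially. 0 \<le> \<bar>hnorm H x - hnorm H (f n)\<bar>" by simp
    show "\<forall>\<^sub>F n in sequentially. \<bar>hnorm H x - hnorm H (f n)\<bar> \<le> hnorm H (f n - x)"
      using assms norm_diff_abs_le by (intro always_eventually allI) (metis hconv_def norm_minus_commute)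
    show "(\<lambda>n. hnorm H (f n - x)) \<longlonglongrightarrow> 0" using assms by (simp add: hconv_def)
  qed simp
qed

lemma hconv_inner:
  assumes "hconv H f x" "hconv H g y"
  shows "(\<lambda>n. hinner H (f n) (g n)) \<longlonglongrightarrow> hinner H x y"
proof (rule Lim_transform2[OF tendsto_const])
  have mem: "f n \<in> hspace H" "g n \<in> hspace H" "x \<in> hspace H" "y \<in> hspace H" for n
    using assms by (simp_all add: hconv_def)
  have bound: "cmod (hinner H x y - hinner H (f n) (g n))
      \<le> hnorm H (f n - x) * hnorm H (g n) + hnorm H x * hnorm H (g n - y)" for n
  proof -
    have "hinner H x y - hinner H (f n) (g n) = - (hinner H (f n - x) (g n) + hinner H x (g n - y))"
      using mem by (simp add: diff_left diff_right)
    then have "cmod (hinner H x y - hinner H (f n) (g n))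
        \<le> cmod (hinner H (f n - x) (g n)) + cmod (hinner H x (g n - y))"
      by (simp only: norm_minus_cancel) (rule norm_triangle_ineq)
    also have "\<dots> \<le> hnorm H (f n - x) * hnorm H (g n) + hnorm H x * hnorm H (g n - y)"
      using mem by (intro add_mono cauchy_schwarz) auto
    finally show ?thesis .
  qed
  have "(\<lambda>n. hnorm H (f n - x) * hnorm H (g n) + hnorm H x * hnorm H (g n - y))
      \<longlonglongrightarrow> 0 * hnorm H y + hnorm H x * 0"
    using assms hconv_norm[OF assms(2)] by (intro tendsto_intros) (simp_all add: hconv_def)
  then have lim: "(\<lambda>n. hnorm H (f n - x) * hnorm H (g n) + hnorm H x * hnorm H (g n - y)) \<longlonglongrightarrow> 0"
    by simp
  show "(\<lambda>n. hinner H x y - hinner H (f n) (g n)) \<longlonglongrightarrow> 0"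
    by (rule Lim_null_comparison[OF _ lim]) (simp add: bound)
qed

lemma hconv_const [simp]: "x \<in> hspace H \<Longrightarrow> hconv H (\<lambda>n. x) x"
  by (simp add: hconv_def)

lemma hconv_add:
  assumes "hconv H f x" "hconv H g y" shows "hconv H (\<lambda>n. f n + g n) (x + y)"
proof -
  have mem: "f n \<in> hspace H" "g n \<in> hspace H" "x \<in> hspace H" "y \<in> hspace H" for n
    using assms by (simp_all add: hconv_def)
  have "(\<lambda>n. hnorm H (f n - x) + hnorm H (g n - y)) \<longlonglongrightarrow> 0 + 0"
    using assms by (intro tendsto_add) (simp_all add: hconv_def)
  then have lim: "(\<lambda>n. hnorm H (f n - x) + hnorm H (g n - y)) \<longlonglongrightarrow> 0" by simp
  have bound: "norm (hnorm H (f n + g n - (x + y))) \<le> hnorm H (f n - x) + hnorm H (g n - y)" for n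
    using mem norm_triangle[of "f n - x" "g n - y"] by (simp add: algebra_simps)
  have "(\<lambda>n. hnorm H (f n + g n - (x + y))) \<longlonglongrightarrow> 0"
    by (rule Lim_null_comparison[OF always_eventually[OF allI[OF bound]] lim])
  then show ?thesis using mem by (simp add: hconv_def)
qed

lemma hconv_scale:
  assumes "hconv H f x" shows "hconv H (\<lambda>n. a *\<^sub>C f n) (a *\<^sub>C x)"
proof -
  have mem: "f n \<in> hspace H" "x \<in> hspace H" for n
    using assms by (simp_all add: hconv_def)
  have "(\<lambda>n. cmod a * hnorm H (f n - x)) \<longlonglongrightarrow> cmod a * 0"
    using assms by (intro tendsto_mult tendsto_const) (simp add: hconv_def)
  moreover have "hnorm H (a *\<^sub>C f n - a *\<^sub>C x) = cmod a * hnorm H (f n - x)" for n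
    using mem norm_scale[of "f n - x" a] by (simp add: complex_vector.scale_right_diff_distrib)
  ultimately show ?thesis using mem by (simp add: hconv_def)
qed

lemma hconv_diff:
  assumes "hconv H f x" "hconv H g y" shows "hconv H (\<lambda>n. f n - g n) (x - y)"
  using hconv_add[OF assms(1) hconv_scale[OF assms(2), of "-1"]] by simp

lemma hcauchy_add:
  assumes "hcauchy H f" "hcauchy H g" shows "hcauchy H (\<lambda>n. f n + g n)"
  unfolding hcauchy_def
proof (intro conjI allI impI)
  have mem: "f n \<in> hspace H" "g n \<in> hspace H" for n
    using assms by (simp_all add: hcauchy_def)
  then show "f n + g n \<in> hspace H" for n by simp
  fix e :: real assume "e > 0"
  then have "e / 2 > 0" by simp
  then obtain N1 N2 where N: "\<And>m n. \<lbrakk>m \<ge> N1; n \<ge> N1\<rbrakk> \<Longrightarrow> hnorm H (f m - f n) < e / 2"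
    "\<And>m n. \<lbrakk>m \<ge> N2; n \<ge> N2\<rbrakk> \<Longrightarrow> hnorm H (g m - g n) < e / 2"
    using assms unfolding hcauchy_def by metis
  show "\<exists>N. \<forall>m\<ge>N. \<forall>n\<ge>N. hnorm H (f m + g m - (f n + g n)) < e"
  proof (intro exI[of _ "max N1 N2"] allI impI)
    fix m n assume "max N1 N2 \<le> m" "max N1 N2 \<le> n"
    then show "hnorm H (f m + g m - (f n + g n)) < e"
      using N(1)[of m n] N(2)[of m n] norm_triangle[of "f m - f n" "g m - g n"] mem
      by (simp add: algebra_simps)
  qed
qed

lemma hcauchy_scale:
  assumes "hcauchy H f" shows "hcauchy H (\<lambda>n. a *\<^sub>C f n)"
  unfolding hcauchy_def
proof (intro conjI allI impI)
  have mem: "f n \<in> hspace H" for n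
    using assms by (simp add: hcauchy_def)
  then show "a *\<^sub>C f n \<in> hspace H" for n by simp
  fix e :: real assume e: "e > 0"
  \<comment> \<open>The summand 1 keeps the quotient positive when \<open>a = 0\<close>.\<close>
  then have "e / (cmod a + 1) > 0" by (simp add: add_nonneg_pos)
  then obtain N where N: "\<And>m n. \<lbrakk>m \<ge> N; n \<ge> N\<rbrakk> \<Longrightarrow> hnorm H (f m - f n) < e / (cmod a + 1)"
    using assms unfolding hcauchy_def by metis
  show "\<exists>N. \<forall>m\<ge>N. \<forall>n\<ge>N. hnorm H (a *\<^sub>C f m - a *\<^sub>C f n) < e"
  proof (intro exI[of _ N] allI impI)
    fix m n assume "N \<le> m" "N \<le> n"
    have "hnorm H (a *\<^sub>C f m - a *\<^sub>C f n) = cmod a * hnorm H (f m - f n)"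
      using mem norm_scale[of "f m - f n" a] by (simp add: complex_vector.scale_right_diff_distrib)
    also have "\<dots> \<le> cmod a * (e / (cmod a + 1))"
      using N[OF \<open>N \<le> m\<close> \<open>N \<le> n\<close>] by (intro mult_left_mono) auto
    also have "\<dots> < e"
      using e norm_ge_zero[of a] by (auto simp: divide_less_eq algebra_simps not_less)
    finally show "hnorm H (a *\<^sub>C f m - a *\<^sub>C f n) < e" .
  qed
qed

lemma hcauchy_diff:
  assumes "hcauchy H f" "hcauchy H g" shows "hcauchy H (\<lambda>n. f n - g n)"
  using hcauchy_add[OF assms(1) hcauchy_scale[OF assms(2), of "-1"]] by simp

lemma hcauchy_bounded:
  assumes "hcauchy H f" obtains M where "M > 0" "\<And>n. hnorm H (f n) \<le> M"
proof -
  have mem: "f n \<in> hspace H" for n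
    using assms by (simp add: hcauchy_def)
  obtain N where N: "\<And>m n. \<lbrakk>m \<ge> N; n \<ge> N\<rbrakk> \<Longrightarrow> hnorm H (f m - f n) < 1"
    using assms unfolding hcauchy_def by (meson zero_less_one)
  \<comment> \<open>The summand 1 covers the tail, which stays within distance 1 of
    \<open>f N\<close>, and makes \<open>M\<close> positive.\<close>
  define M where "M = Max ((\<lambda>n. hnorm H (f n)) ` {..N}) + 1"
  have le: "hnorm H (f n) \<le> M - 1" if "n \<le> N" for n
    unfolding M_def using that by simp
  have "hnorm H (f n) \<le> M" for n
  proof (cases "n \<le> N")
    case False
    then have "hnorm H (f n - f N) < 1" by (intro N) auto
    then show ?thesis using norm_diff_abs_le[OF mem[of n] mem[of N]] le[of N] by simp
  qed (use le[of n] in simp)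
  moreover have "M > 0" using le[of N] norm_nonneg[OF mem[of N]] by simp
  ultimately show ?thesis using that by blast
qed

text \<open>Only completeness of the complex numbers enters. The limit therefore exists in an
  incomplete space, and this is how the inner product of the completion is obtained.\<close>

lemma hcauchy_inner_convergent:
  assumes "hcauchy H f" "hcauchy H g"
  shows "convergent (\<lambda>n. hinner H (f n) (g n))"
proof (rule Cauchy_convergent, rule CauchyI)
  fix e :: real assume "e > 0"
  have mem: "f n \<in> hspace H" "g n \<in> hspace H" for n
    using assms by (simp_all add: hcauchy_def)
  obtain M1 where M1: "M1 > 0" "\<And>n. hnorm H (f n) \<le> M1" by (rule hcauchy_bounded[OF assms(1)]) blast
  obtain M2 where M2: "M2 > 0" "\<And>n. hnorm H (g n) \<le> M2" by (rule hcauchy_bounded[OF assms(2)]) blast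
  have "e / (2 * M2) > 0" "e / (2 * M1) > 0" using \<open>e > 0\<close> M1 M2 by auto
  then obtain N1 N2 where N: "\<And>m n. \<lbrakk>m \<ge> N1; n \<ge> N1\<rbrakk> \<Longrightarrow> hnorm H (f m - f n) < e / (2 * M2)"
    "\<And>m n. \<lbrakk>m \<ge> N2; n \<ge> N2\<rbrakk> \<Longrightarrow> hnorm H (g m - g n) < e / (2 * M1)"
    using assms unfolding hcauchy_def by metis
  show "\<exists>N. \<forall>m\<ge>N. \<forall>n\<ge>N. cmod (hinner H (f m) (g m) - hinner H (f n) (g n)) < e"
  proof (intro exI[of _ "max N1 N2"] allI impI)
    fix m n assume mn: "max N1 N2 \<le> m" "max N1 N2 \<le> n"
    have "hinner H (f m) (g m) - hinner H (f n) (g n)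
        = hinner H (f m - f n) (g m) + hinner H (f n) (g m - g n)"
      using mem by (simp add: diff_left diff_right)
    then have "cmod (hinner H (f m) (g m) - hinner H (f n) (g n))
        \<le> cmod (hinner H (f m - f n) (g m)) + cmod (hinner H (f n) (g m - g n))"
      by (simp only:) (rule norm_triangle_ineq)
    also have "\<dots> \<le> hnorm H (f m - f n) * hnorm H (g m) + hnorm H (f n) * hnorm H (g m - g n)"
      using mem by (intro add_mono cauchy_schwarz) auto
    also have "\<dots> \<le> hnorm H (f m - f n) * M2 + M1 * hnorm H (g m - g n)"
      using mem M1 M2 by (intro add_mono mult_mono) auto
    also have "\<dots> < e / (2 * M2) * M2 + M1 * (e / (2 * M1))"
      using N(1)[of m n] N(2)[of m n] mn M1 M2 by (intro add_strict_mono mult_strict_right_mono mult_strict_left_mono) auto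
    also have "\<dots> = e" using M1 M2 by simp
    finally show "cmod (hinner H (f m) (g m) - hinner H (f n) (g n)) < e" .
  qed
qed

end

section \<open>Definite inner products, their topology and completeness\<close>

locale pre_hilb = semi_hilb +
  assumes definite: "\<lbrakk>v \<in> hspace H; hinner H v v = 0\<rbrakk> \<Longrightarrow> v = 0"

lemma pre_hilbert_iff: "pre_hilbert H \<longleftrightarrow> pre_hilb H"
proof
  assume "pre_hilbert H"
  note * = this[unfolded pre_hilbert_def]
  note sub = *[THEN conjunct1]
    and add = *[THEN conjunct2, THEN conjunct1]
    and scale = *[THEN conjunct2, THEN conjunct2, THEN conjunct1]
    and herm = *[THEN conjunct2, THEN conjunct2, THEN conjunct2, THEN conjunct1]
    and pos = *[THEN conjunct2, THEN conjunct2, THEN conjunct2, THEN conjunct2]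
  show "pre_hilb H"
  proof (unfold_locales, goal_cases)
    case 1 show ?case by (rule sub)
  next
    case 2 then show ?case using add by blast
  next
    case 3 then show ?case using scale by blast
  next
    case 4 then show ?case using herm by blast
  next
    case 5 then show ?case using pos complex_nonneg_Reals_iff by blast
  next
    case 6 then show ?case using pos by blast
  qed
next
  assume "pre_hilb H"
  then interpret pre_hilb H .
  show "pre_hilbert H"
    unfolding pre_hilbert_def
    by (auto simp: subspace add_left scale_left complex_nonneg_Reals_iff definite nonneg inner_self
        intro: herm)
qed

context pre_hilb
begin

lemma norm_eq_0_iff: "v \<in> hspace H \<Longrightarrow> hnorm H v = 0 \<longleftrightarrow> v = 0"
  using definite inner_self by fastforce

lemma ext_inner:
  assumes "v \<in> hspace H" "w \<in> hspace H" "\<And>u. u \<in> hspace H \<Longrightarrow> hinner H u v = hinner H u w"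
  shows "v = w"
  using assms definite[of "v - w"] by (simp add: diff_right)

lemma hconv_unique:
  assumes "hconv H f x" "hconv H f y" shows "x = y"
proof -
  have "hconv H (\<lambda>n. f n - f n) (x - y)" by (rule hconv_diff[OF assms])
  then have "(\<lambda>n::nat. hnorm H (- (x - y))) \<longlonglongrightarrow> 0" and mem: "x - y \<in> hspace H"
    by (simp_all add: hconv_def)
  then have "hnorm H (- (x - y)) = 0" by (simp only: tendsto_const_iff[OF sequentially_bot])
  with mem show ?thesis using norm_eq_0_iff norm_uminus by fastforce
qed

sublocale M: Metric_space "hspace H" "hdist H"
proof
  show "0 \<le> hdist H v w" for v w by (simp add: hdist_def)
  show "hdist H v w = hdist H w v" for v w by (simp add: hdist_def norm_minus_commute)
  show "hdist H v w = 0 \<longleftrightarrow> v = w" if "v \<in> hspace H" "w \<in> hspace H" for v w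
    using that norm_eq_0_iff[of "v - w"] by (simp add: hdist_def)
  show "hdist H u w \<le> hdist H u v + hdist H v w"
    if "u \<in> hspace H" "v \<in> hspace H" "w \<in> hspace H" for u v w
    using that norm_triangle_diff by (simp add: hdist_def)
qed

lemma htop_eq: "htop H = M.mtopology"
  by (simp add: htop_def)

lemma topspace_htop [simp]: "topspace (htop H) = hspace H"
  by (simp add: htop_eq)

lemma hconv_iff_limitin:
  assumes "\<And>n. f n \<in> hspace H"
  shows "hconv H f x \<longleftrightarrow> limitin (htop H) f x sequentially"
  using assms by (auto simp: htop_eq M.limitin_metric_dist_null hconv_def hdist_def cong: conj_cong)

text \<open>Translates \<open>closure_of\<close> into sequences; arguments about dense subspaces and
  closed spans pass through this form.\<close>

lemma in_closure_of_iff: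
  assumes "A \<subseteq> hspace H"
  shows "x \<in> htop H closure_of A \<longleftrightarrow> (\<exists>f. (\<forall>n. f n \<in> A) \<and> hconv H f x)"
proof -
  have "hconv H f x \<longleftrightarrow> x \<in> hspace H \<and> limitin M.mtopology f x sequentially"
    if "\<forall>n. f n \<in> A" for f
    using that assms hconv_iff_limitin[of f x] by (auto simp: htop_eq hconv_def)
  then show ?thesis
    using assms unfolding htop_eq M.closure_of_sequentially by blast
qed

lemma closedin_iff:
  "closedin (htop H) A \<longleftrightarrow> A \<subseteq> hspace H \<and> (\<forall>f x. (\<forall>n. f n \<in> A) \<longrightarrow> hconv H f x \<longrightarrow> x \<in> A)"
proof -
  have "A \<subseteq> hspace H \<Longrightarrow> closedin (htop H) A \<longleftrightarrow> htop H closure_of A \<subseteq> A"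
    by (simp add: closure_of_subset_eq[symmetric])
  then show ?thesis
    using closedin_subset[of "htop H" A] in_closure_of_iff[of A] by (metis subset_iff topspace_htop)
qed

lemma mcomplete_iff: "M.mcomplete \<longleftrightarrow> (\<forall>f. hcauchy H f \<longrightarrow> (\<exists>x. hconv H f x))"
proof -
  have "M.MCauchy f \<longleftrightarrow> hcauchy H f" for f
  proof (cases "\<forall>n. f n \<in> hspace H")
    case True
    then show ?thesis
      by (auto simp: M.MCauchy_def hcauchy_def hdist_def image_subset_iff)
  qed (auto simp: M.MCauchy_def hcauchy_def)
  then show ?thesis
    unfolding M.mcomplete_def using hconv_iff_limitin
    by (metis hcauchy_def htop_eq)
qed

end

locale hilb = pre_hilb +
  assumes complete: "hcauchy H f \<Longrightarrow> \<exists>x. hconv H f x"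

lemma hilbert_iff: "hilbert H \<longleftrightarrow> hilb H"
  using pre_hilb.mcomplete_iff[of H]
  by (auto simp: hilbert_def hilb_def hilb_axioms_def pre_hilbert_iff)

section \<open>Linear maps\<close>

lemma linear_betweenD:
  assumes "linear_between V W T"
  shows "v \<in> V \<Longrightarrow> T v \<in> W"
    and "\<lbrakk>u \<in> V; v \<in> V\<rbrakk> \<Longrightarrow> T (u + v) = T u + T v"
    and "v \<in> V \<Longrightarrow> T (a *\<^sub>C v) = a *\<^sub>C T v"
  using assms by (auto simp: linear_between_def)

lemma linear_between_zero: "\<lbrakk>linear_between V W T; 0 \<in> V\<rbrakk> \<Longrightarrow> T 0 = 0"
  using linear_betweenD(3)[of V W T 0 0] by simp

lemma linear_between_diff:
  assumes T: "linear_between V W T" and V: "complex_vector.subspace V" and "u \<in> V" "v \<in> V"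
  shows "T (u - v) = T u - T v"
  using linear_betweenD(2)[OF T, of "u - v" v] complex_vector.subspace_diff[OF V] assms(3,4)
  by (simp add: algebra_simps)

text \<open>Polarization expresses real parts through norms, and imaginary parts are real parts with
  the second argument multiplied by \<i>.\<close>

lemma isometry_inner:
  assumes "semi_hilb H" "semi_hilb K" and T: "linear_between (hspace H) (hspace K) T"
    and iso: "\<And>v. v \<in> hspace H \<Longrightarrow> hnorm K (T v) = hnorm H v"
    and v: "v \<in> hspace H" and w: "w \<in> hspace H"
  shows "hinner K (T v) (T w) = hinner H v w"
proof -
  interpret H: semi_hilb H by fact
  interpret K: semi_hilb K by fact
  note [simp] = linear_betweenD(1)[OF T]
  have Re: "Re (hinner K (T a) (T b)) = Re (hinner H a b)" if "a \<in> hspace H" "b \<in> hspace H" for a b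
    using that by (simp add: K.polarization_Re H.polarization_Re iso flip: linear_betweenD(2)[OF T])
  have "Im (hinner K (T v) (T w)) = Im (hinner H v w)"
    using v w by (simp add: K.inner_Im H.inner_Im Re flip: linear_betweenD(3)[OF T])
  with Re[OF v w] show ?thesis by (rule complex_eqI)
qed

text \<open>Linearity is used one argument at a time: the left one is extended to the span against a
  fixed generator, then the right one. \<open>T1\<close> is there so that the form twisted by
  \<theta> is covered besides the plain inner product.\<close>

lemma inner_eq_on_span:
  assumes "semi_hilb H" "semi_hilb K" and A: "A \<subseteq> hspace H"
    and T1: "linear_between (hspace H) (hspace H) T1"
    and T: "linear_between (complex_vector.span A) (hspace K) T"
    and eq: "\<And>a b. \<lbrakk>a \<in> A; b \<in> A\<rbrakk> \<Longrightarrow> hinner K (T a) (T b) = hinner H (T1 a) b"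
    and u: "u \<in> complex_vector.span A" and w: "w \<in> complex_vector.span A"
  shows "hinner K (T u) (T w) = hinner H (T1 u) w"
proof -
  interpret H: semi_hilb H by fact
  interpret K: semi_hilb K by fact
  let ?S = "complex_vector.span A"
  have S: "v \<in> hspace H" if "v \<in> ?S" for v
    using that A H.subspace complex_vector.span_minimal by blast
  note mem = linear_betweenD(1)[OF T] linear_betweenD(1)[OF T1 S] S
  note span = complex_vector.span_zero complex_vector.span_add complex_vector.span_scale
    complex_vector.span_base
  have 1: "hinner K (T u) (T b) = hinner H (T1 u) b" if "u \<in> ?S" and b: "b \<in> A" for u b
  proof -
    have "?S \<subseteq> {u \<in> ?S. hinner K (T u) (T b) = hinner H (T1 u) b}"
    proof (rule complex_vector.span_minimal)
      show "complex_vector.subspace {u \<in> ?S. hinner K (T u) (T b) = hinner H (T1 u) b}"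
        using b
        by (auto simp: complex_vector.subspace_def mem span linear_between_zero[OF T]
            linear_between_zero[OF T1] linear_betweenD(2,3)[OF T] linear_betweenD(2,3)[OF T1 ]
            K.add_left H.add_left K.scale_left H.scale_left)
    qed (use b eq span in auto)
    with that show ?thesis by blast
  qed
  have "?S \<subseteq> {w \<in> ?S. hinner K (T u) (T w) = hinner H (T1 u) w}"
  proof (rule complex_vector.span_minimal)
    show "complex_vector.subspace {w \<in> ?S. hinner K (T u) (T w) = hinner H (T1 u) w}"
      using u
      by (auto simp: complex_vector.subspace_def mem span linear_between_zero[OF T]
          linear_between_zero[OF T1] linear_betweenD(2,3)[OF T] linear_betweenD(2,3)[OF T1]
          K.add_right H.add_right K.scale_right H.scale_right)
  qed (use 1 u span in auto)
  with w show ?thesis by blast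
qed

lemma hconv_map:
  assumes "semi_hilb H" "semi_hilb K" and T: "linear_between (hspace H) (hspace K) T"
    and bound: "\<And>v. v \<in> hspace H \<Longrightarrow> hnorm K (T v) \<le> C * hnorm H v"
    and f: "hconv H f x"
  shows "hconv K (\<lambda>n. T (f n)) (T x)"
proof -
  interpret H: semi_hilb H by fact
  interpret K: semi_hilb K by fact
  have mem: "f n \<in> hspace H" "x \<in> hspace H" for n using f by (simp_all add: hconv_def)
  note [simp] = linear_betweenD(1)[OF T]
  have "(\<lambda>n. C * hnorm H (f n - x)) \<longlonglongrightarrow> C * 0"
    using f by (intro tendsto_intros) (simp add: hconv_def)
  then have lim: "(\<lambda>n. C * hnorm H (f n - x)) \<longlonglongrightarrow> 0" by simp
  have le: "norm (hnorm K (T (f n) - T x)) \<le> C * hnorm H (f n - x)" for n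
    using mem bound[of "f n - x"] by (simp add: linear_between_diff[OF T H.subspace])
  have "(\<lambda>n. hnorm K (T (f n) - T x)) \<longlonglongrightarrow> 0"
    by (rule Lim_null_comparison[OF always_eventually[OF allI[OF le]] lim])
  with mem show ?thesis by (simp add: hconv_def)
qed

lemma bounded_linear_continuous_map:
  assumes "pre_hilb H" "pre_hilb K" and T: "linear_between (hspace H) (hspace K) T"
    and bound: "\<And>v. v \<in> hspace H \<Longrightarrow> hnorm K (T v) \<le> C * hnorm H v"
  shows "continuous_map (htop H) (htop K) T"
proof -
  interpret H: pre_hilb H by fact
  interpret K: pre_hilb K by fact
  note [simp] = linear_betweenD(1)[OF T]
  \<comment> \<open>\<open>C\<close> may be zero or negative; \<open>D\<close> is still a bound and
    is positive, so that \<open>e / D\<close> can serve as a radius.\<close>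
  define D where "D = \<bar>C\<bar> + 1"
  have D_pos: "D > 0" by (simp add: D_def)
  have D: "hnorm K (T v) \<le> D * hnorm H v" if "v \<in> hspace H" for v
  proof -
    have "C * hnorm H v \<le> D * hnorm H v" using that by (intro mult_right_mono) (auto simp: D_def)
    with bound[OF that] show "hnorm K (T v) \<le> D * hnorm H v" by linarith
  qed
  show ?thesis
    unfolding H.htop_eq K.htop_eq H.M.metric_continuous_map[OF K.M.Metric_space_axioms]
  proof (intro conjI ballI allI impI)
    fix a and e :: real assume a: "a \<in> hspace H" and e: "e > 0"
    show "\<exists>d>0. \<forall>x. x \<in> hspace H \<and> hdist H a x < d \<longrightarrow> hdist K (T a) (T x) < e"
    proof (intro exI[of _ "e / D"] conjI allI impI)
      show "e / D > 0" using e D_pos by simp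
      fix x assume x: "x \<in> hspace H \<and> hdist H a x < e / D"
      then have "hnorm H (a - x) < e / D" using a by (simp add: hdist_def split: if_splits)
      then have "D * hnorm H (a - x) < e"
        by (simp add: pos_less_divide_eq[OF D_pos] mult.commute)
      moreover have "hnorm K (T (a - x)) \<le> D * hnorm H (a - x)"
        using D[OF H.diff_mem] a x by blast
      ultimately have "hnorm K (T (a - x)) < e" by linarith
      then show "hdist K (T a) (T x) < e"
        using x a by (simp add: hdist_def linear_between_diff[OF T H.subspace])
    qed
  qed auto
qed

lemma continuous_linear_bounded:
  assumes "pre_hilb H" "pre_hilb K" and T: "linear_between (hspace H) (hspace K) T"
    and cont: "continuous_map (htop H) (htop K) T"
  obtains C where "C \<ge> 0" "\<And>v. v \<in> hspace H \<Longrightarrow> hnorm K (T v) \<le> C * hnorm H v"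
proof -
  interpret H: pre_hilb H by fact
  interpret K: pre_hilb K by fact
  note [simp] = linear_betweenD(1)[OF T]
  have T0: "T 0 = 0" using linear_between_zero[OF T] by simp
  have "\<forall>e>0. \<exists>d>0. \<forall>x. x \<in> hspace H \<and> hdist H 0 x < d \<longrightarrow> hdist K (T 0) (T x) < e"
    using cont H.zero_mem
    unfolding H.htop_eq K.htop_eq H.M.metric_continuous_map[OF K.M.Metric_space_axioms] by blast
  from this[rule_format, OF zero_less_one]
  obtain d where d: "d > 0" "\<And>x. \<lbrakk>x \<in> hspace H; hdist H 0 x < d\<rbrakk> \<Longrightarrow> hdist K (T 0) (T x) < 1"
    by metis
  have small: "hnorm K (T x) < 1" if "x \<in> hspace H" "hnorm H x < d" for x
    using d(2)[of x] that by (simp add: hdist_def T0 H.norm_uminus K.norm_uminus)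
  show ?thesis
  proof (rule that[of "2 / d"])
    show "2 / d \<ge> 0" using d by simp
    fix v assume v: "v \<in> hspace H"
    show "hnorm K (T v) \<le> 2 / d * hnorm H v"
    proof (cases "v = 0")
      case False
      then have pos: "hnorm H v > 0" using H.norm_eq_0_iff[OF v] H.norm_nonneg[OF v] by linarith
      \<comment> \<open>Scaling \<open>v\<close> to norm \<open>d / 2\<close> puts it inside the
        ball on which \<open>T\<close> is bounded by 1; undoing the scaling produces the constant
        \<open>2 / d\<close>.\<close>
      let ?a = "complex_of_real (d / (2 * hnorm H v))"
      have "hnorm H (?a *\<^sub>C v) < d" "cmod ?a = d / (2 * hnorm H v)"
        using v pos d(1) by (simp_all add: H.norm_scale norm_divide norm_mult)
      then have "d / (2 * hnorm H v) * hnorm K (T v) < 1"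
        using small[of "?a *\<^sub>C v"] v K.norm_scale[of "T v" ?a] by (simp add: linear_betweenD(3)[OF T])
      then show ?thesis using pos d(1) by (simp add: field_simps)
    qed (simp add: T0)
  qed
qed

section \<open>Closed subspaces\<close>

lemma hsub_simps [simp]:
  "hspace (hsub H W) = W" "hinner (hsub H W) = hinner H" "hnorm (hsub H W) = hnorm H"
  by (simp_all add: hsub_def hnorm_def fun_eq_iff)

context semi_hilb
begin

lemma semi_hilb_hsub:
  assumes "complex_vector.subspace W" "W \<subseteq> hspace H" shows "semi_hilb (hsub H W)"
proof (unfold_locales, goal_cases)
  case (4 v w) then show ?case using herm[of v w] assms by auto
qed (use assms in \<open>auto simp: subset_iff add_left scale_left nonneg\<close>)

lemma span_subset: "A \<subseteq> hspace H \<Longrightarrow> complex_vector.span A \<subseteq> hspace H"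
  using subspace by (rule complex_vector.span_minimal[rotated])

end

context pre_hilb
begin

lemma pre_hilb_hsub:
  assumes "complex_vector.subspace W" "W \<subseteq> hspace H" shows "pre_hilb (hsub H W)"
  using semi_hilb_hsub[OF assms] definite assms
  by (auto simp: pre_hilb_def pre_hilb_axioms_def)

lemma in_closed_span_iff:
  "A \<subseteq> hspace H \<Longrightarrow>
    x \<in> closed_span H A \<longleftrightarrow> (\<exists>f. (\<forall>n. f n \<in> complex_vector.span A) \<and> hconv H f x)"
  unfolding closed_span_def by (rule in_closure_of_iff[OF span_subset])

lemma closure_subspace:
  assumes W: "complex_vector.subspace W" "W \<subseteq> hspace H"
  shows "complex_vector.subspace (htop H closure_of W)"
proof (rule complex_vector.subspaceI)
  note iff = in_closure_of_iff[OF W(2)]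
  show "0 \<in> htop H closure_of W"
    unfolding iff by (rule exI[of _ "\<lambda>n. 0"]) (simp add: complex_vector.subspace_0[OF W(1)])
  show "x + y \<in> htop H closure_of W"
    if xy: "x \<in> htop H closure_of W" "y \<in> htop H closure_of W" for x y
  proof -
    obtain f g where fg: "\<forall>n. f n \<in> W" "hconv H f x" "\<forall>n. g n \<in> W" "hconv H g y"
      using xy unfolding iff by blast
    then show ?thesis unfolding iff
      by (intro exI[of _ "\<lambda>n. f n + g n"]) (simp add: hconv_add complex_vector.subspace_add[OF W(1)])
  qed
  show "a *\<^sub>C x \<in> htop H closure_of W" if x: "x \<in> htop H closure_of W" for a x
  proof -
    obtain f where "\<forall>n. f n \<in> W" "hconv H f x"
      using x unfolding iff by blast
    then show ?thesis unfolding iff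
      by (intro exI[of _ "\<lambda>n. a *\<^sub>C f n"]) (simp add: hconv_scale complex_vector.subspace_scale[OF W(1)])
  qed
qed

lemma closed_subspace_closed_span:
  "A \<subseteq> hspace H \<Longrightarrow> closed_subspace H (closed_span H A)"
  unfolding closed_subspace_def closed_span_def
  by (simp add: closure_subspace complex_vector.subspace_span span_subset)

lemma closed_span_subset: "closed_span H A \<subseteq> hspace H"
  unfolding closed_span_def using closure_of_subset_topspace[of "htop H"] by simp

lemma span_subset_closed_span:
  "A \<subseteq> hspace H \<Longrightarrow> complex_vector.span A \<subseteq> closed_span H A"
  unfolding closed_span_def by (rule closure_of_subset) (simp add: span_subset)

lemma subset_closed_span: "A \<subseteq> hspace H \<Longrightarrow> A \<subseteq> closed_span H A"
  using span_subset_closed_span complex_vector.span_superset by blast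

lemma closed_subspaceD:
  assumes "closed_subspace H W"
  shows "complex_vector.subspace W" "W \<subseteq> hspace H"
    and "\<lbrakk>\<And>n. f n \<in> W; hconv H f x\<rbrakk> \<Longrightarrow> x \<in> W"
  using assms unfolding closed_subspace_def closedin_iff by blast+

end

lemma (in hilb) hilb_hsub:
  assumes W: "closed_subspace H W" shows "hilb (hsub H W)"
proof -
  note W' = closed_subspaceD(1,2)[OF W]
  interpret W: pre_hilb "hsub H W" by (rule pre_hilb_hsub[OF W'])
  show ?thesis
  proof
    fix f assume f: "hcauchy (hsub H W) f"
    then have "hcauchy H f" using W' by (auto simp: hcauchy_def)
    then obtain x where x: "hconv H f x" using complete by blast
    moreover have "x \<in> W" using f by (intro closed_subspaceD(3)[OF W _ x]) (simp add: hcauchy_def)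
    ultimately show "\<exists>x. hconv (hsub H W) f x" using f by (auto simp: hconv_def hcauchy_def)
  qed
qed

section \<open>Riesz representation and orthogonal projection\<close>

context hilb
begin

text \<open>The representing vector minimizes \<open>\<parallel>u\<parallel>\<^sup>2 - 2 Re (L u)\<close>.\<close>

theorem riesz:
  assumes add: "\<And>u v. \<lbrakk>u \<in> hspace H; v \<in> hspace H\<rbrakk> \<Longrightarrow> L (u + v) = L u + L v"
    and scale: "\<And>a u. u \<in> hspace H \<Longrightarrow> L (a *\<^sub>C u) = a * L u"
    and bound: "\<And>u. u \<in> hspace H \<Longrightarrow> cmod (L u) \<le> C * hnorm H u"
  obtains v where "v \<in> hspace H" "\<And>u. u \<in> hspace H \<Longrightarrow> L u = hinner H u v"
proof -
  define q where "q u = (hnorm H u)\<^sup>2 - 2 * Re (L u)" for u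
  define m where "m = Inf (q ` hspace H)"
  \<comment> \<open>Bounding \<open>Re (L u)\<close> by \<open>C\<close> times the norm leaves the
    square of \<open>hnorm H u - C\<close>, minus the square of \<open>C\<close>.\<close>
  have "- C\<^sup>2 \<le> q u" if "u \<in> hspace H" for u
  proof -
    have "Re (L u) \<le> C * hnorm H u" using bound[OF that] complex_Re_le_cmod[of "L u"] by linarith
    moreover have "0 \<le> (hnorm H u - C)\<^sup>2" by simp
    ultimately show ?thesis unfolding q_def power2_diff by (simp add: mult.commute)
  qed
  then have bdd: "bdd_below (q ` hspace H)" by (auto intro!: bdd_belowI[of _ "- C\<^sup>2"])
  then have m_le: "m \<le> q u" if "u \<in> hspace H" for u
    unfolding m_def using that by (intro cInf_lower) auto
  have "\<exists>u\<in>hspace H. q u < m + inverse (real (Suc n))" for n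
  proof -
    have "\<exists>y\<in>q ` hspace H. y < m + inverse (real (Suc n))"
      using cInf_less_iff[OF _ bdd, of "m + inverse (real (Suc n))"] zero_mem
      unfolding m_def[symmetric] by fastforce
    then show ?thesis by blast
  qed
  then obtain x where x: "\<And>n. x n \<in> hspace H" "\<And>n. q (x n) < m + inverse (real (Suc n))"
    by metis
  \<comment> \<open>The midpoint of two nearly minimizing vectors cannot fall below
    \<open>m\<close>. By the parallelogram law this forces the vectors to be close, whence a
    minimizing sequence is Cauchy.\<close>
  have gap: "(hnorm H (x i - x j))\<^sup>2 \<le> 2 * inverse (real (Suc i)) + 2 * inverse (real (Suc j))" for i j
  proof -
    have mid: "(1/2) *\<^sub>C (x i + x j) \<in> hspace H" using x(1) by simp
    have "L ((1/2) *\<^sub>C (x i + x j)) = (1/2) * (L (x i) + L (x j))"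
      using x(1) by (simp only: scale add add_mem)
    then have "Re (L ((1/2) *\<^sub>C (x i + x j))) = (Re (L (x i)) + Re (L (x j))) / 2"
      by (simp only: times_complex.sel plus_complex.sel) simp
    moreover have "(hnorm H ((1/2) *\<^sub>C (x i + x j)))\<^sup>2 = (hnorm H (x i + x j))\<^sup>2 / 4"
      using x(1) by (simp add: norm_scale power_divide norm_divide)
    ultimately have "4 * q ((1/2) *\<^sub>C (x i + x j))
        = (hnorm H (x i + x j))\<^sup>2 - 4 * (Re (L (x i)) + Re (L (x j)))"
      by (simp add: q_def)
    also have "\<dots> = 2 * q (x i) + 2 * q (x j) - (hnorm H (x i - x j))\<^sup>2"
      using parallelogram[OF x(1) x(1), of i j] by (simp add: q_def)
    finally show ?thesis using m_le[OF mid] x(2)[of i] x(2)[of j] by linarith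
  qed
  have "hcauchy H x"
    unfolding hcauchy_def
  proof (intro conjI allI impI)
    fix e :: real assume e: "e > 0"
    \<comment> \<open>For indices beyond \<open>N\<close> the two summands in \<open>gap\<close> add
      up to at most four times \<open>inverse (real (Suc N))\<close>.\<close>
    then have "e\<^sup>2 / 4 > 0" by simp
    then obtain N where N: "inverse (real (Suc N)) < e\<^sup>2 / 4" by (metis reals_Archimedean)
    show "\<exists>N. \<forall>i\<ge>N. \<forall>j\<ge>N. hnorm H (x i - x j) < e"
    proof (intro exI[of _ N] allI impI)
      fix i j assume "N \<le> i" "N \<le> j"
      then have "inverse (real (Suc i)) \<le> inverse (real (Suc N))"
        "inverse (real (Suc j)) \<le> inverse (real (Suc N))"
        by (auto intro!: le_imp_inverse_le)
      with gap[of i j] N have "(hnorm H (x i - x j))\<^sup>2 < e\<^sup>2" by linarith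
      with e show "hnorm H (x i - x j) < e" by (meson less_imp_le power2_less_imp_less)
    qed
  qed (rule x)
  then obtain v where v: "hconv H x v" using complete by blast
  then have v_mem: "v \<in> hspace H" by (simp add: hconv_def)
  have Re: "Re (L w) = Re (hinner H w v)" if w: "w \<in> hspace H" for w
  proof -
    \<comment> \<open>First variation: \<open>q (x n)\<close> lies within
      \<open>inverse (real (Suc n))\<close> of the infimum, so moving \<open>x n\<close> by
      \<open>t\<close> times \<open>w\<close> lowers \<open>q\<close> by less than that. In the
      limit a quadratic in \<open>t\<close> with constant term 0 is nonnegative, and its linear
      coefficient must vanish.\<close>
    have "0 \<le> 0 - 2 * t * (Re (L w) - Re (hinner H v w)) + t\<^sup>2 * (hnorm H w)\<^sup>2" for t
    proof (rule LIMSEQ_le_const)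
      let ?g = "\<lambda>n. inverse (real (Suc n)) - 2 * t * (Re (L w) - Re (hinner H (x n) w)) + t\<^sup>2 * (hnorm H w)\<^sup>2"
      show "?g \<longlonglongrightarrow> 0 - 2 * t * (Re (L w) - Re (hinner H v w)) + t\<^sup>2 * (hnorm H w)\<^sup>2"
        using hconv_inner[OF v hconv_const[OF w]] LIMSEQ_inverse_real_of_nat
        by (intro tendsto_intros tendsto_Re)
      have "0 \<le> ?g n" for n
      proof -
        have "m \<le> q (x n + complex_of_real t *\<^sub>C w)" using x w by (intro m_le) simp
        also have "\<dots> = q (x n) + 2 * t * Re (hinner H (x n) w) + t\<^sup>2 * (hnorm H w)\<^sup>2 - 2 * t * Re (L w)"
          using x(1) w by (simp add: q_def add scale norm_add_sq norm_scale scale_right power_mult_distrib)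
        finally show ?thesis using x(2)[of n] by (simp add: algebra_simps)
      qed
      then show "\<exists>N. \<forall>n\<ge>N. 0 \<le> ?g n" by blast
    qed
    from discriminant_le[OF this] have "(Re (L w) - Re (hinner H v w))\<^sup>2 \<le> 0" by simp
    then show ?thesis using Re_commute[OF w v_mem] by simp
  qed
  have "L w = hinner H w v" if w: "w \<in> hspace H" for w
  proof (rule complex_eqI)
    show "Im (L w) = Im (hinner H w v)"
      using Re[of "\<i> *\<^sub>C w"] w v_mem by (simp add: scale scale_left)
  qed (rule Re[OF w])
  with v_mem that show ?thesis by blast
qed

text \<open>The subspace \<open>W\<close> is itself a Hilbert space, and the Riesz vector in
  \<open>W\<close> of the functional \<open>hinner H u v\<close> is the projection of
  \<open>v\<close>.\<close>

lemma orth_decomp: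
  assumes W: "closed_subspace H W" and v: "v \<in> hspace H"
  obtains w where "w \<in> W" "\<And>u. u \<in> W \<Longrightarrow> hinner H (v - w) u = 0"
proof -
  interpret W: hilb "hsub H W" by (rule hilb_hsub[OF W])
  have sub: "u \<in> hspace H" if "u \<in> W" for u using that closed_subspaceD(2)[OF W] by blast
  obtain w where w: "w \<in> W" "\<And>u. u \<in> W \<Longrightarrow> hinner H u v = hinner H u w"
  proof (rule W.riesz[of "\<lambda>u. hinner H u v" "hnorm H v"])
    fix u assume u: "u \<in> hspace (hsub H W)"
    show "cmod (hinner H u v) \<le> hnorm H v * hnorm (hsub H W) u"
      using cauchy_schwarz[of u v] u v sub by (simp add: mult.commute)
  qed (use v sub in \<open>auto simp: add_left scale_left\<close>)
  show ?thesis
  proof (rule that[OF w(1)])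
    fix u assume u: "u \<in> W"
    show "hinner H (v - w) u = 0"
      using w(2)[OF u] herm[of u v] herm[of u w] sub[OF u] sub[OF w(1)] v by (simp add: diff_left)
  qed
qed

lemma orth_proj_unique:
  assumes W: "closed_subspace H W" and v: "v \<in> hspace H"
    and w: "w \<in> W" "\<And>u. u \<in> W \<Longrightarrow> hinner H (v - w) u = 0"
  shows "orth_proj H W v = w"
  unfolding orth_proj_def
proof (rule the_equality)
  show "w \<in> W \<and> (\<forall>u\<in>W. hinner H (v - w) u = 0)" using w by blast
  fix w' assume w': "w' \<in> W \<and> (\<forall>u\<in>W. hinner H (v - w') u = 0)"
  note sub = closed_subspaceD(1,2)[OF W]
  have "w' - w \<in> W" using w w' sub(1) complex_vector.subspace_diff by blast
  then have "hinner H (v - w) (w' - w) - hinner H (v - w') (w' - w) = 0" using w w' by simp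
  moreover have "hinner H (v - w) (w' - w) - hinner H (v - w') (w' - w) = hinner H (w' - w) (w' - w)"
    using w w' v sub(2) by (subst diff_left[symmetric]) (auto simp: subset_iff)
  ultimately have "w' - w = 0" using w w' sub(2) by (intro definite diff_mem) auto
  then show "w' = w" by simp
qed

lemma orth_proj_props:
  assumes W: "closed_subspace H W" and v: "v \<in> hspace H"
  shows "orth_proj H W v \<in> W" "u \<in> W \<Longrightarrow> hinner H (v - orth_proj H W v) u = 0"
  using orth_decomp[OF W v] orth_proj_unique[OF W v] by metis+

text \<open>The component of a vector orthogonal to the closed span is orthogonal to
  \<open>A\<close>, hence zero.\<close>

lemma closed_span_eqI:
  assumes A: "A \<subseteq> hspace H"
    and total: "\<And>f. \<lbrakk>f \<in> hspace H; \<And>a. a \<in> A \<Longrightarrow> hinner H f a = 0\<rbrakk> \<Longrightarrow> f = 0"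
  shows "closed_span H A = hspace H"
proof
  show "hspace H \<subseteq> closed_span H A"
  proof
    fix f assume f: "f \<in> hspace H"
    obtain w where w: "w \<in> closed_span H A" "\<And>u. u \<in> closed_span H A \<Longrightarrow> hinner H (f - w) u = 0"
      using orth_decomp[OF closed_subspace_closed_span[OF A] f] by blast
    have "f - w = 0"
      using subset_closed_span[OF A] w closed_span_subset f by (intro total diff_mem) auto
    with w(1) show "f \<in> closed_span H A" by simp
  qed
qed (rule closed_span_subset)

lemma hadjoint_unique:
  assumes "v \<in> hspace H" "\<And>u. u \<in> hspace H \<Longrightarrow> hinner K (T u) w = hinner H u v"
  shows "hadjoint H K T w = v"
  unfolding hadjoint_def
proof (rule the_equality)
  show "v' = v" if "v' \<in> hspace H \<and> (\<forall>u\<in>hspace H. hinner K (T u) w = hinner H u v')" for v'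
    using that assms by (intro ext_inner) auto
qed (use assms in blast)

lemma hadjoint_props:
  assumes "semi_hilb K" and T: "linear_between (hspace H) (hspace K) T"
    and bound: "\<And>v. v \<in> hspace H \<Longrightarrow> hnorm K (T v) \<le> C * hnorm H v" and w: "w \<in> hspace K"
  shows "hadjoint H K T w \<in> hspace H"
    and "u \<in> hspace H \<Longrightarrow> hinner K (T u) w = hinner H u (hadjoint H K T w)"
proof -
  interpret K: semi_hilb K by fact
  note [simp] = linear_betweenD(1)[OF T]
  obtain v where "v \<in> hspace H" "\<And>u. u \<in> hspace H \<Longrightarrow> hinner K (T u) w = hinner H u v"
  proof (rule riesz[of "\<lambda>u. hinner K (T u) w" "C * hnorm K w"])
    fix u assume u: "u \<in> hspace H"
    have "cmod (hinner K (T u) w) \<le> hnorm K (T u) * hnorm K w"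
      using u w by (intro K.cauchy_schwarz) auto
    also have "\<dots> \<le> C * hnorm H u * hnorm K w"
      using bound[OF u] w by (intro mult_right_mono) auto
    finally show "cmod (hinner K (T u) w) \<le> C * hnorm K w * hnorm H u" by (simp add: algebra_simps)
  qed (use w in \<open>simp_all add: linear_betweenD(2,3)[OF T] K.add_left K.scale_left\<close>)
  moreover from this have "hadjoint H K T w = v" by (rule hadjoint_unique)
  ultimately show "hadjoint H K T w \<in> hspace H"
    "u \<in> hspace H \<Longrightarrow> hinner K (T u) w = hinner H u (hadjoint H K T w)" by simp_all
qed

end

section \<open>Extension of isometries\<close>

text \<open>The unitary is built as a relation \<open>Q\<close>, the set of joint limits of pairs
  \<open>(J d, R d)\<close>. Equality of norms makes \<open>Q\<close> single-valued in both
  directions even if \<open>J\<close> and \<open>R\<close> are not injective; density and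
  completeness make it total in both directions. Treating the two sides alike yields bijectivity
  along with existence.\<close>

lemma isometric_extension:
  assumes "hilb H" "hilb K" and D: "complex_vector.subspace D"
    and J: "linear_between D (hspace H) J" and R: "linear_between D (hspace K) R"
    and iso: "\<And>d. d \<in> D \<Longrightarrow> hnorm K (R d) = hnorm H (J d)"
    and J_dense: "htop H closure_of (J ` D) = hspace H"
    and R_dense: "htop K closure_of (R ` D) = hspace K"
  obtains U where "unitary_map H K U" "\<And>d. d \<in> D \<Longrightarrow> U (J d) = R d"
proof -
  interpret H: hilb H by fact
  interpret K: hilb K by fact
  note [simp] = linear_betweenD(1)[OF J] linear_betweenD(1)[OF R]
  note D_closed = complex_vector.subspace_add[OF D] complex_vector.subspace_scale[OF D]
    complex_vector.subspace_diff[OF D]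
  define Q where "Q x y \<longleftrightarrow> (\<exists>d. (\<forall>n. d n \<in> D) \<and> hconv H (\<lambda>n. J (d n)) x \<and> hconv K (\<lambda>n. R (d n)) y)"
    for x y
  have Q_mem: "x \<in> hspace H" "y \<in> hspace K" if "Q x y" for x y
    using that by (auto simp: Q_def hconv_def)
  have Q_add: "Q (x + x') (y + y')" if xy: "Q x y" "Q x' y'" for x x' y y'
  proof -
    obtain d d' where "\<forall>n. d n \<in> D" "hconv H (\<lambda>n. J (d n)) x" "hconv K (\<lambda>n. R (d n)) y"
      "\<forall>n. d' n \<in> D" "hconv H (\<lambda>n. J (d' n)) x'" "hconv K (\<lambda>n. R (d' n)) y'"
      using xy unfolding Q_def by blast
    then show ?thesis
      unfolding Q_def
      by (intro exI[of _ "\<lambda>n. d n + d' n"])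
        (simp add: D_closed linear_betweenD(2)[OF J] linear_betweenD(2)[OF R] H.hconv_add K.hconv_add)
  qed
  have Q_scale: "Q (a *\<^sub>C x) (a *\<^sub>C y)" if xy: "Q x y" for a x y
  proof -
    obtain d where "\<forall>n. d n \<in> D" "hconv H (\<lambda>n. J (d n)) x" "hconv K (\<lambda>n. R (d n)) y"
      using xy unfolding Q_def by blast
    then show ?thesis
      unfolding Q_def
      by (intro exI[of _ "\<lambda>n. a *\<^sub>C d n"])
        (simp add: D_closed linear_betweenD(3)[OF J] linear_betweenD(3)[OF R] H.hconv_scale K.hconv_scale)
  qed
  have Q_norm: "hnorm K y = hnorm H x" if xy: "Q x y" for x y
  proof -
    obtain d where d: "\<forall>n. d n \<in> D" "hconv H (\<lambda>n. J (d n)) x" "hconv K (\<lambda>n. R (d n)) y"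
      using xy unfolding Q_def by blast
    show ?thesis
      using LIMSEQ_unique[OF K.hconv_norm[OF d(3)]] H.hconv_norm[OF d(2)] d(1) by (simp add: iso)
  qed
  have Q_diff: "Q (x - x') (y - y')" if "Q x y" "Q x' y'" for x x' y y'
    using Q_add[OF that(1) Q_scale[OF that(2), of "-1"]] by simp
  have Q_right_unique: "y = y'" if "Q x y" "Q x y'" for x y y'
    using Q_norm[OF Q_diff[OF that]] Q_mem[OF that(1)] Q_mem[OF that(2)] K.norm_eq_0_iff[of "y - y'"]
    by simp
  have Q_left_unique: "x = x'" if "Q x y" "Q x' y" for x x' y
    using Q_norm[OF Q_diff[OF that]] Q_mem[OF that(1)] Q_mem[OF that(2)] H.norm_eq_0_iff[of "x - x'"]
    by simp
  have same: "hnorm K (R d - R d') = hnorm H (J d - J d')" if "d \<in> D" "d' \<in> D" for d d'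
    using iso[of "d - d'"] that by (simp add: D_closed linear_between_diff[OF J D] linear_between_diff[OF R D])
  have Q_total: "\<exists>y. Q x y" if x: "x \<in> hspace H" for x
  proof -
    obtain f where f: "\<And>n. f n \<in> J ` D" "hconv H f x"
      using x J_dense H.in_closure_of_iff[of "J ` D" x] by (auto simp: image_subset_iff)
    have "\<forall>n. \<exists>e. e \<in> D \<and> f n = J e" using f(1) by blast
    then obtain d where d: "\<forall>n. d n \<in> D \<and> f n = J (d n)" by (rule choice[THEN exE])
    then have "f = (\<lambda>n. J (d n))" by blast
    with d f(2) have d: "\<forall>n. d n \<in> D" "hconv H (\<lambda>n. J (d n)) x"
      by simp_all
    then have "hcauchy K (\<lambda>n. R (d n))"
      using H.hconv_cauchy[OF d(2)] by (simp add: hcauchy_def same)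
    then show ?thesis using K.complete d unfolding Q_def by blast
  qed
  have Q_surj: "\<exists>x. Q x y" if y: "y \<in> hspace K" for y
  proof -
    obtain f where f: "\<And>n. f n \<in> R ` D" "hconv K f y"
      using y R_dense K.in_closure_of_iff[of "R ` D" y] by (auto simp: image_subset_iff)
    have "\<forall>n. \<exists>e. e \<in> D \<and> f n = R e" using f(1) by blast
    then obtain d where d: "\<forall>n. d n \<in> D \<and> f n = R (d n)" by (rule choice[THEN exE])
    then have "f = (\<lambda>n. R (d n))" by blast
    with d f(2) have d: "\<forall>n. d n \<in> D" "hconv K (\<lambda>n. R (d n)) y"
      by simp_all
    then have "hcauchy H (\<lambda>n. J (d n))"
      using K.hconv_cauchy[OF d(2)] by (simp add: hcauchy_def same)
    then show ?thesis using H.complete d unfolding Q_def by blast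
  qed
  define U where "U x = (THE y. Q x y)" for x
  have Q_U: "Q x (U x)" if "x \<in> hspace H" for x
    unfolding U_def using Q_total[OF that] Q_right_unique by (metis theI)
  have U_eq: "U x = y" if "Q x y" for x y
    using Q_U[OF Q_mem(1)[OF that]] that Q_right_unique by blast
  have lin: "linear_between (hspace H) (hspace K) U"
    unfolding linear_between_def
    using Q_U Q_mem(2) by (auto intro!: U_eq Q_add Q_scale)
  show ?thesis
  proof (rule that[of U])
    show "unitary_map H K U"
      unfolding unitary_map_def
    proof (intro conjI ballI lin)
      show "bij_betw U (hspace H) (hspace K)"
        unfolding bij_betw_def inj_on_def using Q_U Q_mem Q_left_unique Q_surj U_eq
        by (auto simp: image_iff) metis+
      show "hinner K (U v) (U w) = hinner H v w" if "v \<in> hspace H" "w \<in> hspace H" for v w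
        using that Q_norm[OF Q_U]
        by (intro isometry_inner[OF H.semi_hilb_axioms K.semi_hilb_axioms lin]) auto
    qed
    show "U (J d) = R d" if "d \<in> D" for d
      using that by (intro U_eq, unfold Q_def) (auto intro!: exI[of _ "\<lambda>n. d"])
  qed
qed

section \<open>Existence of reproducing kernel Hilbert spaces\<close>

lemma scaleC_fun_apply [simp]: "(a *\<^sub>C f) x = a *\<^sub>C f x"
  by (simp add: scaleC_fun_def)

lemma functions_onI:
  "\<lbrakk>\<And>x. x \<in> X \<Longrightarrow> f x \<in> hspace F; \<And>x. x \<notin> X \<Longrightarrow> f x = 0\<rbrakk> \<Longrightarrow> f \<in> functions_on X F"
  by (simp add: functions_on_def)

lemma functions_onD:
  assumes "f \<in> functions_on X F"
  shows "x \<in> X \<Longrightarrow> f x \<in> hspace F" "x \<notin> X \<Longrightarrow> f x = 0"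
  using assms by (auto simp: functions_on_def)

text \<open>\<open>B(u,u)\<close> is real for \<open>u = v + w\<close> and for \<open>u = v + \<i>w\<close>.\<close>

lemma hermitian_of_nonneg:
  assumes V: "complex_vector.subspace V"
    and addl: "\<And>u v w. \<lbrakk>u \<in> V; v \<in> V; w \<in> V\<rbrakk> \<Longrightarrow> B (u + v) w = B u w + B v w"
    and addr: "\<And>u v w. \<lbrakk>u \<in> V; v \<in> V; w \<in> V\<rbrakk> \<Longrightarrow> B w (u + v) = B w u + B w v"
    and scalel: "\<And>a v w. \<lbrakk>v \<in> V; w \<in> V\<rbrakk> \<Longrightarrow> B (a *\<^sub>C v) w = a * B v w"
    and scaler: "\<And>a v w. \<lbrakk>v \<in> V; w \<in> V\<rbrakk> \<Longrightarrow> B w (a *\<^sub>C v) = cnj a * B w v"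
    and pos: "\<And>v. v \<in> V \<Longrightarrow> B v v \<in> \<real>\<^sub>\<ge>\<^sub>0"
    and v: "v \<in> V" and w: "w \<in> V"
  shows "B w v = cnj (B v w)"
proof -
  have real: "Im (B u u) = 0" if "u \<in> V" for u
    using pos[OF that] complex_nonneg_Reals_iff by blast
  have sum: "Im (B v w) + Im (B w v) = 0" if "w \<in> V" for w
  proof -
    have "v + w \<in> V" using v that complex_vector.subspace_add[OF V] by blast
    then have "Im (B (v + w) (v + w)) = 0" by (rule real)
    then show ?thesis using v that \<open>v + w \<in> V\<close> real[OF v] real[OF that] by (simp add: addl addr)
  qed
  have "\<i> *\<^sub>C w \<in> V" using w complex_vector.subspace_scale[OF V] by blast
  then have "Im (B v (\<i> *\<^sub>C w)) + Im (B (\<i> *\<^sub>C w) v) = 0" by (rule sum)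
  then have "Re (B w v) = Re (B v w)" using v w by (simp add: scalel scaler)
  then show ?thesis using sum[OF w] by (simp add: complex_eq_iff)
qed

section \<open>Formal combinations of kernel functions\<close>

locale pd_kernel = F: hilb F for F :: "('f::complex_vector) hilb" +
  fixes X :: "'x set" and K :: "'x \<Rightarrow> 'x \<Rightarrow> 'f \<Rightarrow> 'f"
  assumes pd: "pos_def_kernel X F K"
begin

lemma K_bounded: "\<lbrakk>x \<in> X; y \<in> X\<rbrakk> \<Longrightarrow> bounded_op F (K x y)"
  using pd by (simp add: pos_def_kernel_def)

lemma K_linear: "\<lbrakk>x \<in> X; y \<in> X\<rbrakk> \<Longrightarrow> linear_between (hspace F) (hspace F) (K x y)"
  using K_bounded by (auto simp: bounded_op_def)

lemma K_mem [simp]: "\<lbrakk>x \<in> X; y \<in> X; v \<in> hspace F\<rbrakk> \<Longrightarrow> K x y v \<in> hspace F"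
  using K_linear linear_betweenD(1) by blast

lemma K_zero [simp]: "\<lbrakk>x \<in> X; y \<in> X\<rbrakk> \<Longrightarrow> K x y 0 = 0"
  using linear_between_zero[OF K_linear] by simp

text \<open>A finitely supported \<open>d\<close> encodes the formal combination of the kernel functions
  \<open>K(\<cdot>,y) (d y)\<close>; \<open>comb d\<close> is the resulting function.\<close>

definition supp :: "('x \<Rightarrow> 'f) \<Rightarrow> 'x set" where "supp d = {x. d x \<noteq> 0}"

definition comb :: "('x \<Rightarrow> 'f) \<Rightarrow> 'x \<Rightarrow> 'f" where
  "comb d = restrict0 X (\<lambda>x. \<Sum>y\<in>supp d. K x y (d y))"

text \<open>Unfolding \<open>comb\<close>, the form is the double sum of
  \<open>hinner F (K x y (d y)) (e x)\<close>, the Gram form of the kernel functions.\<close>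

definition pre :: "('x \<Rightarrow> 'f) hilb" where
  "pre = \<lparr>hspace = {d \<in> functions_on X F. finite (supp d)},
          hinner = (\<lambda>d e. \<Sum>x\<in>supp e. hinner F (comb d x) (e x))\<rparr>"

lemma preD: "d \<in> hspace pre \<Longrightarrow> finite (supp d)" "d \<in> hspace pre \<Longrightarrow> supp d \<subseteq> X"
  "d \<in> hspace pre \<Longrightarrow> x \<in> X \<Longrightarrow> d x \<in> hspace F"
  by (auto simp: pre_def supp_def functions_on_def)

lemma pre_subspace: "complex_vector.subspace (hspace pre)"
proof (rule complex_vector.subspaceI)
  show "0 \<in> hspace pre" by (simp add: pre_def functions_on_def supp_def)
  show "d + e \<in> hspace pre" if "d \<in> hspace pre" "e \<in> hspace pre" for d e
  proof -
    have "supp (d + e) \<subseteq> supp d \<union> supp e" by (auto simp: supp_def)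
    then have "finite (supp (d + e))" using that preD(1) by (metis finite_UnI finite_subset)
    then show ?thesis using that by (simp add: pre_def functions_on_def)
  qed
  show "a *\<^sub>C d \<in> hspace pre" if "d \<in> hspace pre" for a d
  proof -
    have "supp (a *\<^sub>C d) \<subseteq> supp d" by (auto simp: supp_def)
    then have "finite (supp (a *\<^sub>C d))" using that preD(1) by (metis finite_subset)
    then show ?thesis using that by (simp add: pre_def functions_on_def)
  qed
qed

text \<open>Supports change under addition, so sums are compared over a common finite set; the
  additional terms vanish because \<open>K x y 0 = 0\<close>.\<close>

lemma comb_eq:
  assumes "d \<in> hspace pre" "finite A" "supp d \<subseteq> A" "A \<subseteq> X" "x \<in> X"
  shows "comb d x = (\<Sum>y\<in>A. K x y (d y))"
proof -
  have "(\<Sum>y\<in>supp d. K x y (d y)) = (\<Sum>y\<in>A. K x y (d y))"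
    using assms by (intro sum.mono_neutral_left) (auto simp: supp_def)
  then show ?thesis using assms by (simp add: comb_def restrict0_def)
qed

lemma comb_off: "x \<notin> X \<Longrightarrow> comb d x = 0"
  by (simp add: comb_def restrict0_def)

lemma comb_mem: "d \<in> hspace pre \<Longrightarrow> x \<in> X \<Longrightarrow> comb d x \<in> hspace F"
  using preD[of d] by (subst comb_eq[of d "supp d"]) (auto intro!: F.sum_mem K_mem)

lemma comb_functions_on: "d \<in> hspace pre \<Longrightarrow> comb d \<in> functions_on X F"
  by (simp add: functions_onI comb_mem comb_off)

lemma comb_add:
  assumes d: "d \<in> hspace pre" and e: "e \<in> hspace pre" shows "comb (d + e) = comb d + comb e"
proof
  fix x
  show "comb (d + e) x = (comb d + comb e) x"
  proof (cases "x \<in> X")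
    case True
    let ?A = "supp d \<union> supp e"
    have A: "finite ?A" "?A \<subseteq> X" "supp d \<subseteq> ?A" "supp e \<subseteq> ?A" "supp (d + e) \<subseteq> ?A"
      using preD[OF d] preD[OF e] by (auto simp: supp_def)
    have "K x y ((d + e) y) = K x y (d y) + K x y (e y)" if "y \<in> ?A" for y
      using that preD(2)[OF d] preD(2)[OF e] True preD(3)[OF d] preD(3)[OF e]
        linear_betweenD(2)[OF K_linear[of x y]]
      by (auto simp: subset_iff)
    then show ?thesis
      using True A complex_vector.subspace_add[OF pre_subspace d e]
      by (simp add: comb_eq[OF _ A(1) _ A(2)] d e sum.distrib[symmetric])
  qed (simp add: comb_off)
qed

lemma comb_scale:
  assumes d: "d \<in> hspace pre" shows "comb (a *\<^sub>C d) = a *\<^sub>C comb d"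
proof
  fix x
  show "comb (a *\<^sub>C d) x = (a *\<^sub>C comb d) x"
  proof (cases "x \<in> X")
    case True
    have A: "finite (supp d)" "supp d \<subseteq> X" "supp d \<subseteq> supp d" "supp (a *\<^sub>C d) \<subseteq> supp d"
      using preD[OF d] by (auto simp: supp_def)
    have "K x y ((a *\<^sub>C d) y) = a *\<^sub>C K x y (d y)" if "y \<in> supp d" for y
      using that A(2) True preD(3)[OF d] linear_betweenD(3)[OF K_linear[of x y]]
      by (simp add: subset_iff)
    then show ?thesis
      using True A complex_vector.subspace_scale[OF pre_subspace d]
      by (simp add: comb_eq[OF _ A(1) _ A(2)] d complex_vector.scale_sum_right)
  qed (simp add: comb_off)
qed

lemma inner_pre_eq:
  assumes "d \<in> hspace pre" "e \<in> hspace pre" "finite A" "supp e \<subseteq> A" "A \<subseteq> X"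
  shows "hinner pre d e = (\<Sum>x\<in>A. hinner F (comb d x) (e x))"
proof -
  have "(\<Sum>x\<in>supp e. hinner F (comb d x) (e x)) = (\<Sum>x\<in>A. hinner F (comb d x) (e x))"
    using assms comb_mem by (intro sum.mono_neutral_left) (auto simp: supp_def subset_iff)
  then show ?thesis by (simp add: pre_def)
qed

lemma pre_nonneg:
  assumes d: "d \<in> hspace pre" shows "hinner pre d d \<in> \<real>\<^sub>\<ge>\<^sub>0"
proof -
  \<comment> \<open>Positive definiteness is stated for finite sequences, so the support is
    enumerated.\<close>
  obtain h and n :: nat where h: "bij_betw h {..<n} (supp d)"
    using ex_bij_betw_nat_finite[OF preD(1)[OF d]] by (auto simp: atLeast0LessThan)
  have hX: "h j \<in> X" if "j < n" for j
    using preD(2)[OF d] h that by (auto simp: bij_betw_def)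
  have "hinner pre d d = (\<Sum>x\<in>supp d. \<Sum>y\<in>supp d. hinner F (K x y (d y)) (d x))"
    using preD[OF d] by (simp add: inner_pre_eq[OF d d, of "supp d"] comb_eq[OF d, of "supp d"]
        F.sum_left subset_iff)
  also have "\<dots> = (\<Sum>j<n. \<Sum>y\<in>supp d. hinner F (K (h j) y (d y)) (d (h j)))"
    by (rule sum.reindex_bij_betw[OF h, symmetric])
  also have "\<dots> = (\<Sum>j<n. \<Sum>k<n. hinner F (K (h j) (h k) (d (h k))) (d (h j)))"
    by (intro sum.cong refl sum.reindex_bij_betw[OF h, symmetric])
  also have "\<dots> \<in> \<real>\<^sub>\<ge>\<^sub>0"
    using pd hX preD(3)[OF d hX] unfolding pos_def_kernel_def by (elim conjE allE impE) auto
  finally show ?thesis .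
qed

text \<open>Hermitian symmetry is no axiom of \<open>pos_def_kernel\<close>; it is deduced from
  sesquilinearity and nonnegativity over the complex scalars.\<close>

sublocale pre: semi_hilb pre
proof -
  note sub = pre_subspace
  have addl: "hinner pre (u + v) w = hinner pre u w + hinner pre v w"
    if u: "u \<in> hspace pre" and v: "v \<in> hspace pre" and w: "w \<in> hspace pre" for u v w
    using that complex_vector.subspace_add[OF sub u v] preD[OF w] comb_mem[OF u] comb_mem[OF v]
    by (simp add: inner_pre_eq[OF _ w, of _ "supp w"] comb_add sum.distrib[symmetric] subset_iff F.add_left)
  have scalel: "hinner pre (a *\<^sub>C v) w = a * hinner pre v w"
    if v: "v \<in> hspace pre" and w: "w \<in> hspace pre" for a v w
    using that complex_vector.subspace_scale[OF sub v] preD[OF w] comb_mem[OF v]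
    by (simp add: inner_pre_eq[OF _ w, of _ "supp w"] comb_scale sum_distrib_left subset_iff F.scale_left)
  have addr: "hinner pre w (u + v) = hinner pre w u + hinner pre w v"
    if u: "u \<in> hspace pre" and v: "v \<in> hspace pre" and w: "w \<in> hspace pre" for u v w
  proof -
    let ?A = "supp u \<union> supp v"
    have A: "finite ?A" "?A \<subseteq> X" "supp u \<subseteq> ?A" "supp v \<subseteq> ?A" "supp (u + v) \<subseteq> ?A"
      using preD[OF u] preD[OF v] by (auto simp: supp_def)
    then have "hinner F (comb w x) ((u + v) x) = hinner F (comb w x) (u x) + hinner F (comb w x) (v x)"
      if "x \<in> ?A" for x
      using that preD(2,3)[OF u] preD(2,3)[OF v] comb_mem[OF w] by (auto simp: F.add_right subset_iff)
    then show ?thesis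
      using u v w A complex_vector.subspace_add[OF sub u v]
      by (simp add: inner_pre_eq[OF _ _ A(1) _ A(2)] sum.distrib[symmetric])
  qed
  have scaler: "hinner pre w (a *\<^sub>C v) = cnj a * hinner pre w v"
    if v: "v \<in> hspace pre" and w: "w \<in> hspace pre" for a v w
  proof -
    have A: "finite (supp v)" "supp v \<subseteq> X" "supp v \<subseteq> supp v" "supp (a *\<^sub>C v) \<subseteq> supp v"
      using preD[OF v] by (auto simp: supp_def)
    then have "hinner F (comb w x) ((a *\<^sub>C v) x) = cnj a * hinner F (comb w x) (v x)"
      if "x \<in> supp v" for x
      using that preD(3)[OF v] comb_mem[OF w] by (simp add: F.scale_right subset_iff)
    then show ?thesis
      using v w A complex_vector.subspace_scale[OF sub v]
      by (simp add: inner_pre_eq[OF _ _ A(1) _ A(2)] sum_distrib_left)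
  qed
  show "semi_hilb pre"
  proof (unfold_locales, goal_cases)
    case (4 v w) then show ?case
      by (intro hermitian_of_nonneg[where B = "hinner pre", OF sub addl addr scalel scaler pre_nonneg])
  next
    case (5 v) then show ?case using pre_nonneg complex_nonneg_Reals_iff by blast
  qed (use sub addl scalel in auto)
qed

lemma comb_diff: "\<lbrakk>d \<in> hspace pre; e \<in> hspace pre\<rbrakk> \<Longrightarrow> comb (d - e) = comb d - comb e"
  using comb_add[of "d - e" e] by (simp add: algebra_simps)

definition delta :: "'x \<Rightarrow> 'f \<Rightarrow> 'x \<Rightarrow> 'f" where
  "delta y v = (\<lambda>x. if x = y then v else 0)"

text \<open>An inclusion only, because \<open>v\<close> may be zero.\<close>

lemma supp_delta: "supp (delta y v) \<subseteq> {y}"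
  by (auto simp: supp_def delta_def)

lemma delta_mem [simp]: "\<lbrakk>y \<in> X; v \<in> hspace F\<rbrakk> \<Longrightarrow> delta y v \<in> hspace pre"
  using finite_subset[OF supp_delta] by (auto simp: pre_def functions_on_def delta_def)

lemma comb_delta: "\<lbrakk>x \<in> X; y \<in> X; v \<in> hspace F\<rbrakk> \<Longrightarrow> comb (delta y v) x = K x y v"
  using comb_eq[OF delta_mem _ supp_delta] by (simp add: delta_def)

text \<open>The reproducing property before completion: point masses play the role of kernel
  functions.\<close>

lemma inner_delta:
  "\<lbrakk>d \<in> hspace pre; y \<in> X; v \<in> hspace F\<rbrakk> \<Longrightarrow> hinner pre d (delta y v) = hinner F (comb d y) v"
  using inner_pre_eq[OF _ delta_mem _ supp_delta] by (simp add: delta_def)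

text \<open>For \<open>v = comb d x\<close>, the reproducing property writes the square of the norm
  of \<open>v\<close> as a product of \<open>d\<close> with \<open>delta x v\<close>. Cauchy-Schwarz
  applies, and the squared norm of \<open>delta x v\<close> is \<open>hinner F (K x x v) v\<close>,
  bounded by \<open>\<bar>M\<bar>\<close> times the square of the norm of \<open>v\<close>. The
  absolute value is taken since a bound \<open>M\<close> may be negative when \<open>F\<close> is
  trivial.\<close>

lemma comb_bound:
  assumes x: "x \<in> X"
  obtains C where "C \<ge> 0" "\<And>d. d \<in> hspace pre \<Longrightarrow> hnorm F (comb d x) \<le> C * hnorm pre d"
proof -
  obtain M where M: "\<And>v. v \<in> hspace F \<Longrightarrow> hnorm F (K x x v) \<le> M * hnorm F v"
    using K_bounded[OF x x] by (auto simp: bounded_op_def)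
  let ?C = "sqrt \<bar>M\<bar>"
  have "hnorm F (comb d x) \<le> ?C * hnorm pre d" if d: "d \<in> hspace pre" for d
  proof -
    define v where "v = comb d x"
    have v: "v \<in> hspace F" unfolding v_def using d x by (rule comb_mem)
    have "(hnorm pre (delta x v))\<^sup>2 = Re (hinner F (K x x v) v)"
      using x v by (simp add: pre.norm_sq inner_delta comb_delta)
    also have "\<dots> \<le> hnorm F (K x x v) * hnorm F v" using x v by (intro F.Re_inner_le) auto
    also have "\<dots> \<le> \<bar>M\<bar> * hnorm F v * hnorm F v"
    proof (rule mult_right_mono)
      have "M * hnorm F v \<le> \<bar>M\<bar> * hnorm F v" using v by (intro mult_right_mono) auto
      then show "hnorm F (K x x v) \<le> \<bar>M\<bar> * hnorm F v" using M[OF v] by linarith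
    qed (simp add: v)
    also have "\<dots> = (?C * hnorm F v)\<^sup>2" by (simp add: power_mult_distrib power2_eq_square)
    finally have delta: "hnorm pre (delta x v) \<le> ?C * hnorm F v"
      using v by (simp add: power2_le_iff_abs_le x)
    have "(hnorm F v)\<^sup>2 = Re (hinner pre d (delta x v))"
      using d x v by (simp add: F.norm_sq inner_delta v_def)
    also have "\<dots> \<le> hnorm pre d * hnorm pre (delta x v)" using d x v by (intro pre.Re_inner_le) auto
    also have "\<dots> \<le> hnorm pre d * (?C * hnorm F v)" using d delta by (intro mult_left_mono) auto
    finally have "hnorm F v * hnorm F v \<le> (?C * hnorm pre d) * hnorm F v"
      by (simp add: power2_eq_square algebra_simps)
    then show ?thesis
      using F.norm_nonneg[OF v] pre.norm_nonneg[OF d] unfolding v_def[symmetric]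
      by (cases "hnorm F v = 0") (auto simp: mult_le_cancel_right)
  qed
  then show ?thesis by (intro that[of ?C]) auto
qed

text \<open>The completion is realized by pointwise limits of Cauchy sequences of combinations.\<close>

definition represents :: "(nat \<Rightarrow> 'x \<Rightarrow> 'f) \<Rightarrow> ('x \<Rightarrow> 'f) \<Rightarrow> bool" where
  "represents d f \<longleftrightarrow> hcauchy pre d \<and> f \<in> functions_on X F \<and> (\<forall>x\<in>X. hconv F (\<lambda>n. comb (d n) x) (f x))"

lemma representsD:
  assumes "represents d f"
  shows "hcauchy pre d" "d n \<in> hspace pre" "f \<in> functions_on X F"
    and "x \<in> X \<Longrightarrow> hconv F (\<lambda>n. comb (d n) x) (f x)"
  using assms by (simp_all add: represents_def hcauchy_def)

lemma represents_add:
  assumes "represents d f" "represents e g" shows "represents (\<lambda>n. d n + e n) (f + g)"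
  unfolding represents_def
proof (intro conjI ballI)
  show "f + g \<in> functions_on X F"
    using assms[THEN representsD(3)] by (simp add: functions_on_def)
  show "hconv F (\<lambda>n. comb (d n + e n) x) ((f + g) x)" if "x \<in> X" for x
    using F.hconv_add[OF representsD(4)[OF assms(1) that] representsD(4)[OF assms(2) that]] assms[THEN representsD(2)]
    by (simp add: comb_add)
qed (intro pre.hcauchy_add assms[THEN representsD(1)])

lemma represents_scale:
  assumes "represents d f" shows "represents (\<lambda>n. a *\<^sub>C d n) (a *\<^sub>C f)"
  unfolding represents_def
proof (intro conjI ballI)
  show "a *\<^sub>C f \<in> functions_on X F"
    using representsD(3)[OF assms] by (simp add: functions_on_def)
  show "hconv F (\<lambda>n. comb (a *\<^sub>C d n) x) ((a *\<^sub>C f) x)" if "x \<in> X" for x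
    using F.hconv_scale[OF representsD(4)[OF assms that]] representsD(2)[OF assms]
    by (simp add: comb_scale)
qed (intro pre.hcauchy_scale representsD(1)[OF assms])

lemma represents_diff: "\<lbrakk>represents d f; represents e g\<rbrakk> \<Longrightarrow> represents (\<lambda>n. d n - e n) (f - g)"
  using represents_add[OF _ represents_scale[of e g "-1"]] by simp

lemma represents_const: "d \<in> hspace pre \<Longrightarrow> represents (\<lambda>n. d) (comb d)"
  unfolding represents_def
  using pre.hconv_cauchy[OF pre.hconv_const] by (simp add: comb_functions_on comb_mem)

lemma represents_exists:
  assumes d: "hcauchy pre d" shows "\<exists>f. represents d f"
proof -
  have mem: "d n \<in> hspace pre" for n using d by (simp add: hcauchy_def)
  have "\<exists>y. hconv F (\<lambda>n. comb (d n) x) y" if x: "x \<in> X" for x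
  proof (rule F.complete, unfold hcauchy_def, intro conjI allI impI)
    show "comb (d n) x \<in> hspace F" for n using mem x by (rule comb_mem)
    obtain C where C: "C \<ge> 0" "\<And>d. d \<in> hspace pre \<Longrightarrow> hnorm F (comb d x) \<le> C * hnorm pre d"
      using comb_bound[OF x] by blast
    fix e :: real assume e: "e > 0"
    then have "e / (C + 1) > 0" using C by simp
    then obtain N where N: "\<And>m n. \<lbrakk>m \<ge> N; n \<ge> N\<rbrakk> \<Longrightarrow> hnorm pre (d m - d n) < e / (C + 1)"
      using d unfolding hcauchy_def by metis
    show "\<exists>N. \<forall>m\<ge>N. \<forall>n\<ge>N. hnorm F (comb (d m) x - comb (d n) x) < e"
    proof (intro exI[of _ N] allI impI)
      fix m n assume mn: "N \<le> m" "N \<le> n"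
      have "hnorm F (comb (d m) x - comb (d n) x) \<le> C * hnorm pre (d m - d n)"
        using C(2)[of "d m - d n"] mem by (simp add: comb_diff)
      also have "\<dots> \<le> C * (e / (C + 1))" using N[OF mn] C(1) by (intro mult_left_mono) auto
      also have "\<dots> < e" using C(1) e by (simp add: field_simps)
      finally show "hnorm F (comb (d m) x - comb (d n) x) < e" .
    qed
  qed
  then obtain f where f: "\<And>x. x \<in> X \<Longrightarrow> hconv F (\<lambda>n. comb (d n) x) (f x)" by metis
  \<comment> \<open>The choice of \<open>f\<close> is arbitrary off \<open>X\<close>, where a member
    of \<open>functions_on\<close> has to vanish.\<close>
  then have "restrict0 X f \<in> functions_on X F"
    by (intro functions_onI) (auto simp: restrict0_def hconv_def)
  with d f show ?thesis unfolding represents_def by (intro exI[of _ "restrict0 X f"]) (simp add: restrict0_def)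
qed

text \<open>The product with a fixed formal combination involves finitely many point evaluations, so
  the pointwise limit alone determines its limit.\<close>

lemma inner_limit:
  assumes "represents d f" "e \<in> hspace pre"
  shows "(\<lambda>n. hinner pre (d n) e) \<longlonglongrightarrow> (\<Sum>x\<in>supp e. hinner F (f x) (e x))"
proof -
  have "(\<lambda>n. \<Sum>x\<in>supp e. hinner F (comb (d n) x) (e x)) \<longlonglongrightarrow> (\<Sum>x\<in>supp e. hinner F (f x) (e x))"
    using assms(2) preD[OF assms(2)]
    by (intro tendsto_sum F.hconv_inner F.hconv_const representsD(4)[OF assms(1)]) auto
  then show ?thesis by (simp add: pre_def)
qed

text \<open>This makes the inner product of pointwise limits well defined.\<close>

lemma represents_zero:
  assumes d: "represents d 0" shows "(\<lambda>n. hnorm pre (d n)) \<longlonglongrightarrow> 0"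
proof (rule LIMSEQ_I)
  note mem = representsD(2)[OF d]
  fix e :: real assume "e > 0"
  then have e: "e / 2 > 0" by simp
  then obtain N where N: "\<And>m n. \<lbrakk>m \<ge> N; n \<ge> N\<rbrakk> \<Longrightarrow> hnorm pre (d m - d n) < e / 2"
    using representsD(1)[OF d] unfolding hcauchy_def by metis
  show "\<exists>N. \<forall>m\<ge>N. norm (hnorm pre (d m) - 0) < e"
  proof (intro exI[of _ N] allI impI)
    fix m assume m: "N \<le> m"
    \<comment> \<open>Expanding the norm of \<open>d n - d m\<close> bounds the squared norm of
      \<open>d m\<close> by a small Cauchy term plus twice the real part of a mixed product. For
      fixed \<open>m\<close> the latter tends to 0 in \<open>n\<close> by
      \<open>inner_limit\<close>, since the pointwise limit is 0.\<close>
    have "(hnorm pre (d m))\<^sup>2 \<le> (e / 2)\<^sup>2 + 2 * Re (\<Sum>x\<in>supp (d m). hinner F (0 x) (d m x))"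
    proof (rule LIMSEQ_le_const)
      show "(\<lambda>n. (e / 2)\<^sup>2 + 2 * Re (hinner pre (d n) (d m)))
          \<longlonglongrightarrow> (e / 2)\<^sup>2 + 2 * Re (\<Sum>x\<in>supp (d m). hinner F (0 x) (d m x))"
        by (intro tendsto_intros tendsto_Re inner_limit[OF d mem])
      have "(hnorm pre (d m))\<^sup>2 \<le> (e / 2)\<^sup>2 + 2 * Re (hinner pre (d n) (d m))" if "n \<ge> N" for n
      proof -
        have "(hnorm pre (d n - d m))\<^sup>2 \<le> (e / 2)\<^sup>2"
          using N[OF that m] mem by (intro power_mono) auto
        moreover have "0 \<le> (hnorm pre (d n))\<^sup>2" by simp
        ultimately show ?thesis using pre.norm_diff_sq[OF mem mem, of n m] by linarith
      qed
      then show "\<exists>N. \<forall>n\<ge>N. (hnorm pre (d m))\<^sup>2 \<le> (e / 2)\<^sup>2 + 2 * Re (hinner pre (d n) (d m))"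
        by blast
    qed
    also have "(\<Sum>x\<in>supp (d m). hinner F (0 x) (d m x)) = 0"
      using preD[OF mem[of m]] by (intro sum.neutral) (auto simp: subset_iff)
    finally have "(hnorm pre (d m))\<^sup>2 \<le> (e / 2)\<^sup>2" by simp
    then have "hnorm pre (d m) \<le> e / 2" using less_imp_le[OF e] by (rule power2_le_imp_le)
    then show "norm (hnorm pre (d m) - 0) < e" using e mem by simp
  qed
qed

section \<open>The inner product on pointwise limits, and its completeness\<close>

definition ip :: "('x \<Rightarrow> 'f) \<Rightarrow> ('x \<Rightarrow> 'f) \<Rightarrow> complex" where
  "ip f g = lim (\<lambda>n. hinner pre ((SOME d. represents d f) n) ((SOME d. represents d g) n))"

text \<open>The limit does not depend on the chosen sequences: two sequences representing the same
  function differ by one that represents 0, hence tends to 0 in norm, while Cauchy sequences are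
  bounded.\<close>

lemma ip_limit:
  assumes d: "represents d f" and e: "represents e g"
  shows "(\<lambda>n. hinner pre (d n) (e n)) \<longlonglongrightarrow> ip f g"
proof -
  define d' e' where de': "d' = (SOME d. represents d f)" "e' = (SOME d. represents d g)"
  have d': "represents d' f" and e': "represents e' g"
    unfolding de' by (rule someI[of _ d], rule d) (rule someI[of _ e], rule e)
  note mem = representsD(2)[OF d] representsD(2)[OF e] representsD(2)[OF d'] representsD(2)[OF e']
  have lim': "(\<lambda>n. hinner pre (d' n) (e' n)) \<longlonglongrightarrow> ip f g"
    using pre.hcauchy_inner_convergent[OF representsD(1)[OF d'] representsD(1)[OF e']]
    unfolding ip_def de' by (simp add: convergent_LIMSEQ_iff)
  obtain M1 where M1: "M1 > 0" "\<And>n. hnorm pre (d' n) \<le> M1"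
    by (rule pre.hcauchy_bounded[OF representsD(1)[OF d']]) blast
  obtain M2 where M2: "M2 > 0" "\<And>n. hnorm pre (e n) \<le> M2"
    by (rule pre.hcauchy_bounded[OF representsD(1)[OF e]]) blast
  have "represents (\<lambda>n. d n - d' n) 0" "represents (\<lambda>n. e n - e' n) 0"
    using represents_diff[OF d d'] represents_diff[OF e e'] by simp_all
  then have "(\<lambda>n. hnorm pre (d n - d' n)) \<longlonglongrightarrow> 0" "(\<lambda>n. hnorm pre (e n - e' n)) \<longlonglongrightarrow> 0"
    by (simp_all add: represents_zero)
  then have "(\<lambda>n. hnorm pre (d n - d' n) * M2 + M1 * hnorm pre (e n - e' n)) \<longlonglongrightarrow> 0 * M2 + M1 * 0"
    by (intro tendsto_intros)
  then have lim: "(\<lambda>n. hnorm pre (d n - d' n) * M2 + M1 * hnorm pre (e n - e' n)) \<longlonglongrightarrow> 0" by simp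
  have bound: "cmod (hinner pre (d' n) (e' n) - hinner pre (d n) (e n))
      \<le> hnorm pre (d n - d' n) * M2 + M1 * hnorm pre (e n - e' n)" for n
  proof -
    have "hinner pre (d' n) (e' n) - hinner pre (d n) (e n)
        = - (hinner pre (d n - d' n) (e n) + hinner pre (d' n) (e n - e' n))"
      using mem by (simp add: pre.diff_left pre.diff_right)
    then have "cmod (hinner pre (d' n) (e' n) - hinner pre (d n) (e n))
        \<le> cmod (hinner pre (d n - d' n) (e n)) + cmod (hinner pre (d' n) (e n - e' n))"
      by (simp only: norm_minus_cancel) (rule norm_triangle_ineq)
    also have "\<dots> \<le> hnorm pre (d n - d' n) * hnorm pre (e n) + hnorm pre (d' n) * hnorm pre (e n - e' n)"
      using mem by (intro add_mono pre.cauchy_schwarz) auto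
    also have "\<dots> \<le> hnorm pre (d n - d' n) * M2 + M1 * hnorm pre (e n - e' n)"
      using mem M1 M2 by (intro add_mono mult_mono) auto
    finally show ?thesis .
  qed
  have "(\<lambda>n. hinner pre (d' n) (e' n) - hinner pre (d n) (e n)) \<longlonglongrightarrow> 0"
    by (rule Lim_null_comparison[OF always_eventually[OF allI[OF bound]] lim])
  from Lim_transform2[OF lim' this] show ?thesis .
qed

definition space :: "('x \<Rightarrow> 'f) hilb" where
  "space = \<lparr>hspace = {f. \<exists>d. represents d f}, hinner = ip\<rparr>"

lemma space_iff: "f \<in> hspace space \<longleftrightarrow> (\<exists>d. represents d f)"
  by (simp add: space_def)

lemma represents_mem: "represents d f \<Longrightarrow> f \<in> hspace space"
  by (auto simp: space_iff)

lemma inner_space_limit: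
  "\<lbrakk>represents d f; represents e g\<rbrakk> \<Longrightarrow> (\<lambda>n. hinner pre (d n) (e n)) \<longlonglongrightarrow> hinner space f g"
  using ip_limit by (simp add: space_def)

sublocale space: semi_hilb space
proof (unfold_locales, goal_cases)
  case 1
  show ?case
  proof (rule complex_vector.subspaceI)
    show "0 \<in> hspace space"
      using represents_mem[OF represents_scale[OF represents_const[OF pre.zero_mem], of 0]] by simp
    show "f + g \<in> hspace space" if "f \<in> hspace space" "g \<in> hspace space" for f g
      using that represents_add unfolding space_iff by blast
    show "a *\<^sub>C f \<in> hspace space" if "f \<in> hspace space" for a f
      using that represents_scale[where a = a] unfolding space_iff by blast
  qed
next
  case (2 u v w)
  then obtain a b c where r: "represents a u" "represents b v" "represents c w"
    unfolding space_iff by blast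
  note mem = r[THEN representsD(2)]
  have "(\<lambda>n. hinner pre (a n + b n) (c n)) \<longlonglongrightarrow> hinner space u w + hinner space v w"
    using tendsto_add[OF inner_space_limit[OF r(1,3)] inner_space_limit[OF r(2,3)]] mem
    by (simp add: pre.add_left)
  then show ?case using inner_space_limit[OF represents_add[OF r(1,2)] r(3)] LIMSEQ_unique by blast
next
  case (3 v w a)
  then obtain b c where r: "represents b v" "represents c w"
    unfolding space_iff by blast
  note mem = r[THEN representsD(2)]
  have "(\<lambda>n. hinner pre (a *\<^sub>C b n) (c n)) \<longlonglongrightarrow> a * hinner space v w"
    using tendsto_mult_left[OF inner_space_limit[OF r(1,2)], of a] mem by (simp add: pre.scale_left)
  then show ?case using inner_space_limit[OF represents_scale[OF r(1)] r(2)] LIMSEQ_unique by blast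
next
  case (4 v w)
  then obtain b c where r: "represents b v" "represents c w"
    unfolding space_iff by blast
  note mem = r[THEN representsD(2)]
  have "(\<lambda>n. hinner pre (c n) (b n)) \<longlonglongrightarrow> cnj (hinner space v w)"
    using tendsto_cnj[OF inner_space_limit[OF r]] by (simp add: pre.herm[OF mem, symmetric])
  then show ?case using inner_space_limit[OF r(2,1)] LIMSEQ_unique by blast
next
  case (5 v)
  then obtain b where r: "represents b v" unfolding space_iff by blast
  show ?case
    using tendsto_Re[OF inner_space_limit[OF r r]] pre.nonneg[OF representsD(2)[OF r]]
    by (auto intro!: LIMSEQ_le_const)
qed

lemma norm_space_limit:
  assumes "represents d f" shows "(\<lambda>n. hnorm pre (d n)) \<longlonglongrightarrow> hnorm space f"
  unfolding hnorm_def by (intro tendsto_real_sqrt tendsto_Re inner_space_limit assms)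

lemma space_functions_on: "f \<in> hspace space \<Longrightarrow> f \<in> functions_on X F"
  by (auto simp: space_iff represents_def)

lemma eval_bound:
  assumes x: "x \<in> X"
  obtains C where "C \<ge> 0" "\<And>f. f \<in> hspace space \<Longrightarrow> hnorm F (f x) \<le> C * hnorm space f"
proof -
  obtain C where C: "C \<ge> 0" "\<And>d. d \<in> hspace pre \<Longrightarrow> hnorm F (comb d x) \<le> C * hnorm pre d"
    using comb_bound[OF x] by blast
  have "hnorm F (f x) \<le> C * hnorm space f" if f: "f \<in> hspace space" for f
  proof -
    obtain d where d: "represents d f" using f unfolding space_iff by blast
    show ?thesis
    proof (rule LIMSEQ_le)
      show "(\<lambda>n. hnorm F (comb (d n) x)) \<longlonglongrightarrow> hnorm F (f x)"
        by (rule F.hconv_norm[OF representsD(4)[OF d x]])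
      show "(\<lambda>n. C * hnorm pre (d n)) \<longlonglongrightarrow> C * hnorm space f"
        by (intro tendsto_intros norm_space_limit d)
    qed (use C representsD(2)[OF d] in blast)
  qed
  with C(1) that show ?thesis by blast
qed

text \<open>By the evaluation bounds a function of norm zero vanishes everywhere. Passing from
  formal combinations to functions has thus divided out the null vectors.\<close>

sublocale space: pre_hilb space
proof
  fix f assume f: "f \<in> hspace space" and zero: "hinner space f f = 0"
  then have norm: "hnorm space f = 0" by (simp add: hnorm_def)
  note fo = space_functions_on[OF f]
  show "f = 0"
  proof
    fix x
    show "f x = 0 x"
    proof (cases "x \<in> X")
      case True
      obtain C where "hnorm F (f x) \<le> C * hnorm space f" using eval_bound[OF True] f by blast
      then have "hnorm F (f x) = 0"
        using norm F.norm_nonneg[OF functions_onD(1)[OF fo True]] by simp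
      then show ?thesis using F.norm_eq_0_iff[OF functions_onD(1)[OF fo True]] by simp
    qed (simp add: functions_onD(2)[OF fo])
  qed
qed

lemma comb_space: "d \<in> hspace pre \<Longrightarrow> comb d \<in> hspace space"
  by (rule represents_mem[OF represents_const])

lemma norm_comb: "d \<in> hspace pre \<Longrightarrow> hnorm space (comb d) = hnorm pre d"
  using norm_space_limit[OF represents_const] LIMSEQ_unique tendsto_const by blast

lemma represents_hconv:
  assumes d: "represents d f" shows "hconv space (\<lambda>n. comb (d n)) f"
proof -
  note mem = representsD(2)[OF d]
  have "(\<lambda>n. hnorm space (comb (d n) - f)) \<longlonglongrightarrow> 0"
  proof (rule LIMSEQ_I)
    fix e :: real assume "e > 0"
    then have e: "e / 2 > 0" by simp
    then obtain N where N: "\<And>m n. \<lbrakk>m \<ge> N; n \<ge> N\<rbrakk> \<Longrightarrow> hnorm pre (d m - d n) < e / 2"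
      using representsD(1)[OF d] unfolding hcauchy_def by metis
    show "\<exists>N. \<forall>m\<ge>N. norm (hnorm space (comb (d m) - f) - 0) < e"
    proof (intro exI[of _ N] allI impI)
      fix m assume m: "N \<le> m"
      have "hnorm space (comb (d m) - f) \<le> e / 2"
      proof (rule LIMSEQ_le_const2)
        \<comment> \<open>For fixed \<open>m\<close> the sequence \<open>d m - d n\<close> in
          \<open>n\<close> represents \<open>comb (d m) - f\<close>, so its norms converge to the
          norm wanted.\<close>
        show "(\<lambda>n. hnorm pre (d m - d n)) \<longlonglongrightarrow> hnorm space (comb (d m) - f)"
          by (intro norm_space_limit represents_diff represents_const mem d)
        show "\<exists>N. \<forall>n\<ge>N. hnorm pre (d m - d n) \<le> e / 2" using N[OF m] less_imp_le by blast
      qed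
      then show "norm (hnorm space (comb (d m) - f) - 0) < e"
        using e comb_space[OF mem] represents_mem[OF d] by simp
    qed
  qed
  then show ?thesis using mem d by (simp add: hconv_def comb_space represents_mem)
qed

text \<open>Each \<open>f n\<close> is replaced by a combination at distance less than
  \<open>inverse (real (Suc n))\<close>. As \<open>comb\<close> preserves norms, the formal
  combinations are Cauchy, and the function they represent is the limit of \<open>f\<close>
  too.\<close>

sublocale space: hilb space
proof
  fix f assume f: "hcauchy space f"
  then have f_mem: "f n \<in> hspace space" for n by (simp add: hcauchy_def)
  have "\<exists>d\<in>hspace pre. hnorm space (f n - comb d) < inverse (real (Suc n))" for n
  proof -
    obtain d where d: "represents d (f n)" using f_mem space_iff by blast
    have "(\<lambda>k. hnorm space (comb (d k) - f n)) \<longlonglongrightarrow> 0"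
      using represents_hconv[OF d] by (simp add: hconv_def)
    then have "\<forall>\<^sub>F k in sequentially. hnorm space (comb (d k) - f n) < inverse (real (Suc n))"
      by (rule order_tendstoD) simp
    then obtain k where "hnorm space (comb (d k) - f n) < inverse (real (Suc n))"
      by (meson eventually_happens' sequentially_bot)
    then show ?thesis
      using representsD(2)[OF d, of k] f_mem comb_space space.norm_minus_commute
      by (intro bexI[of _ "d k"]) auto
  qed
  then obtain d where d: "\<And>n. d n \<in> hspace pre"
    "\<And>n. hnorm space (f n - comb (d n)) < inverse (real (Suc n))" by metis
  have lim0: "(\<lambda>n. hnorm space (f n - comb (d n))) \<longlonglongrightarrow> 0"
  proof (rule Lim_null_comparison[OF _ LIMSEQ_inverse_real_of_nat], intro always_eventually allI)
    show "norm (hnorm space (f n - comb (d n))) \<le> inverse (real (Suc n))" for n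
      using d[of n] f_mem[of n] comb_space[of "d n"] less_imp_le by simp
  qed
  then have "hconv space (\<lambda>n. f n - comb (d n)) 0"
    using f_mem d comb_space by (simp add: hconv_def)
  then have "hcauchy space (\<lambda>n. f n - (f n - comb (d n)))"
    by (intro space.hcauchy_diff f space.hconv_cauchy)
  then have "hcauchy space (\<lambda>n. comb (d n))" by simp
  then have "hcauchy pre d"
    using d(1) by (simp add: hcauchy_def comb_diff[symmetric] norm_comb)
  then obtain g where g: "represents d g" using represents_exists by blast
  have "hconv space (\<lambda>n. (f n - comb (d n)) + comb (d n)) (0 + g)"
    by (intro space.hconv_add represents_hconv g) fact
  then show "\<exists>g. hconv space f g" by auto
qed

lemma reproducing:
  assumes f: "f \<in> hspace space" and y: "y \<in> X" and v: "v \<in> hspace F"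
  shows "hinner F (f y) v = hinner space f (comb (delta y v))"
proof -
  obtain d where d: "represents d f" using f unfolding space_iff by blast
  have "(\<lambda>n. hinner pre (d n) (delta y v)) \<longlonglongrightarrow> hinner space f (comb (delta y v))"
    by (intro inner_space_limit[OF d] represents_const delta_mem y v)
  moreover have "(\<lambda>n. hinner F (comb (d n) y) v) \<longlonglongrightarrow> hinner F (f y) v"
    by (intro F.hconv_inner F.hconv_const v representsD(4)[OF d y])
  ultimately show ?thesis
    using representsD(2)[OF d] y v by (simp add: inner_delta LIMSEQ_unique)
qed

text \<open>By \<open>reproducing\<close>, the adjoint of evaluation at \<open>y\<close> sends
  \<open>v\<close> to \<open>comb (delta y v)\<close>, whose value at \<open>x\<close> is
  \<open>K x y v\<close>.\<close>

lemma is_rkhs_space: "is_rkhs X F K space"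
  unfolding is_rkhs_def
proof (intro conjI ballI)
  show "hilbert space" unfolding hilbert_iff by (rule space.hilb_axioms)
  show "hspace space \<subseteq> functions_on X F" using space_functions_on by blast
  show "continuous_map (htop space) (htop F) (\<lambda>f. f x)" if x: "x \<in> X" for x
  proof -
    obtain C where "C \<ge> 0" "\<And>f. f \<in> hspace space \<Longrightarrow> hnorm F (f x) \<le> C * hnorm space f"
      using eval_bound[OF x] by blast
    then show ?thesis
      using x functions_onD(1)[OF space_functions_on x]
      by (intro bounded_linear_continuous_map[OF space.pre_hilb_axioms F.pre_hilb_axioms])
        (auto simp: linear_between_def)
  qed
  show "K x y v = hadjoint space F (\<lambda>f. f y) v x"
    if x: "x \<in> X" and y: "y \<in> X" and v: "v \<in> hspace F" for x y v
    using space.hadjoint_unique[of "comb (delta y v)" F "\<lambda>f. f y" v] reproducing x y v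
    by (simp add: comb_space comb_delta)
qed

lemma is_rkhs_rkhs: "is_rkhs X F K (rkhs X F K)"
  unfolding rkhs_def using is_rkhs_space by (rule someI)

end

section \<open>Properties of reproducing kernel Hilbert spaces\<close>

text \<open>\<open>H\<close> is arbitrary subject to \<open>is_rkhs\<close>, because the space
  chosen by \<open>rkhs\<close> is known only through this predicate.\<close>

locale rkhs_space = F: hilb F for F :: "('f::complex_vector) hilb" +
  fixes X :: "'x set" and K :: "'x \<Rightarrow> 'x \<Rightarrow> 'f \<Rightarrow> 'f" and H :: "('x \<Rightarrow> 'f) hilb"
  assumes rkhs: "is_rkhs X F K H"
begin

sublocale H: hilb H
  using rkhs by (simp add: is_rkhs_def hilbert_iff)

lemma functions_on: "f \<in> hspace H \<Longrightarrow> f \<in> functions_on X F"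
  using rkhs by (auto simp: is_rkhs_def)

lemma eval_mem [simp]: "\<lbrakk>f \<in> hspace H; x \<in> X\<rbrakk> \<Longrightarrow> f x \<in> hspace F"
  by (rule functions_onD(1)[OF functions_on])

lemma eval_off: "\<lbrakk>f \<in> hspace H; x \<notin> X\<rbrakk> \<Longrightarrow> f x = 0"
  by (rule functions_onD(2)[OF functions_on])

lemma eval_linear: "x \<in> X \<Longrightarrow> linear_between (hspace H) (hspace F) (\<lambda>f. f x)"
  by (auto simp: linear_between_def)

lemma eval_bounded:
  assumes "x \<in> X"
  obtains C where "C \<ge> 0" "\<And>f. f \<in> hspace H \<Longrightarrow> hnorm F (f x) \<le> C * hnorm H f"
  using continuous_linear_bounded[OF H.pre_hilb_axioms F.pre_hilb_axioms eval_linear[OF assms]] rkhs assms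
  by (auto simp: is_rkhs_def)

lemma hconv_eval: "\<lbrakk>hconv H f g; x \<in> X\<rbrakk> \<Longrightarrow> hconv F (\<lambda>n. f n x) (g x)"
  using eval_bounded[of x] hconv_map[OF H.semi_hilb_axioms F.semi_hilb_axioms eval_linear] by metis

text \<open>The kernel function \<open>K(_, y) v\<close>, written as an adjoint so that the
  reproducing property is the defining relation; \<open>kfun_apply\<close> recovers its
  values.\<close>

definition kfun :: "'x \<Rightarrow> 'f \<Rightarrow> 'x \<Rightarrow> 'f" where
  "kfun y v = hadjoint H F (\<lambda>f. f y) v"

lemma kfun_mem [simp]: "\<lbrakk>y \<in> X; v \<in> hspace F\<rbrakk> \<Longrightarrow> kfun y v \<in> hspace H"
  unfolding kfun_def
  using eval_bounded[of y] H.hadjoint_props(1)[OF F.semi_hilb_axioms eval_linear] by metis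

lemma reproducing:
  "\<lbrakk>y \<in> X; v \<in> hspace F; f \<in> hspace H\<rbrakk> \<Longrightarrow> hinner H f (kfun y v) = hinner F (f y) v"
  unfolding kfun_def
  using eval_bounded[of y] H.hadjoint_props(2)[OF F.semi_hilb_axioms eval_linear] by metis

lemma kfun_apply: "\<lbrakk>x \<in> X; y \<in> X; v \<in> hspace F\<rbrakk> \<Longrightarrow> kfun y v x = K x y v"
  using rkhs by (simp add: is_rkhs_def kfun_def)

lemma ext_on: "\<lbrakk>f \<in> functions_on X F; g \<in> functions_on X F; \<And>x. x \<in> X \<Longrightarrow> f x = g x\<rbrakk> \<Longrightarrow> f = g"
  by (rule ext) (metis functions_onD(2))

definition kfuns :: "('x \<Rightarrow> 'f) set" where
  "kfuns = {kfun y v |y v. y \<in> X \<and> v \<in> hspace F}"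

lemma kfuns_subset: "kfuns \<subseteq> hspace H"
  by (auto simp: kfuns_def)

text \<open>Orthogonality of \<open>f\<close> to \<open>kfun x (f x)\<close> says that
  \<open>hinner F (f x) (f x) = 0\<close>.\<close>

lemma closed_span_kfuns: "closed_span H kfuns = hspace H"
proof (rule H.closed_span_eqI[OF kfuns_subset])
  fix f assume f: "f \<in> hspace H" and orth: "\<And>a. a \<in> kfuns \<Longrightarrow> hinner H f a = 0"
  show "f = 0"
  proof (rule ext_on)
    show "f x = 0 x" if x: "x \<in> X" for x
    proof -
      have "hinner F (f x) (f x) = 0"
        using orth[of "kfun x (f x)"] x eval_mem[OF f x] reproducing[OF x eval_mem[OF f x] f]
        unfolding kfuns_def by fastforce
      then show ?thesis using F.definite x f by simp
    qed
  qed (use f functions_on in \<open>auto simp: functions_on_def\<close>)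
qed

end

text \<open>Boundedness on \<open>A\<close> makes the images Cauchy; their limit is the composite with \<open>f\<close> because
  convergence in a reproducing kernel Hilbert space is pointwise.\<close>

lemma hconv_composition:
  fixes \<sigma> :: "'y \<Rightarrow> 'x" and F :: "('f::complex_vector) hilb"
  assumes "rkhs_space F X K H" "rkhs_space F Y L H'" and \<sigma>: "\<And>y. y \<in> Y \<Longrightarrow> \<sigma> y \<in> X"
    and A: "complex_vector.subspace A" "A \<subseteq> hspace H"
    and T_mem: "\<And>a. a \<in> A \<Longrightarrow> restrict0 Y (\<lambda>y. a (\<sigma> y)) \<in> hspace H'"
    and bound: "\<And>a. a \<in> A \<Longrightarrow> hnorm H' (restrict0 Y (\<lambda>y. a (\<sigma> y))) \<le> C * hnorm H a"
    and a: "\<And>n. a n \<in> A" and conv: "hconv H a f"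
  shows "hconv H' (\<lambda>n. restrict0 Y (\<lambda>y. a n (\<sigma> y))) (restrict0 Y (\<lambda>y. f (\<sigma> y)))"
proof -
  interpret H: rkhs_space F X K H by fact
  interpret H': rkhs_space F Y L H' by fact
  let ?T = "\<lambda>f. restrict0 Y (\<lambda>y. f (\<sigma> y))"
  have T_diff: "?T f - ?T g = ?T (f - g)" for f g :: "'x \<Rightarrow> 'f"
    by (auto simp: restrict0_def fun_eq_iff)
  have "hcauchy H' (\<lambda>n. ?T (a n))"
    unfolding hcauchy_def
  proof (intro conjI allI impI T_mem a)
    fix e :: real assume e: "e > 0"
    then have "e / (\<bar>C\<bar> + 1) > 0" by simp
    then obtain N where N: "\<And>m n. \<lbrakk>m \<ge> N; n \<ge> N\<rbrakk> \<Longrightarrow> hnorm H (a m - a n) < e / (\<bar>C\<bar> + 1)"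
      using H.H.hconv_cauchy[OF conv] unfolding hcauchy_def by metis
    show "\<exists>N. \<forall>m\<ge>N. \<forall>n\<ge>N. hnorm H' (?T (a m) - ?T (a n)) < e"
    proof (intro exI[of _ N] allI impI)
      fix m n assume mn: "N \<le> m" "N \<le> n"
      have diff: "a m - a n \<in> A" using a complex_vector.subspace_diff[OF A(1)] by blast
      then have "hnorm H' (?T (a m) - ?T (a n)) \<le> C * hnorm H (a m - a n)"
        unfolding T_diff by (rule bound)
      also have "\<dots> \<le> (\<bar>C\<bar> + 1) * hnorm H (a m - a n)"
        using diff A(2) by (intro mult_right_mono H.H.norm_nonneg) auto
      also have "\<dots> < e"
        using N[OF mn] pos_less_divide_eq[of "\<bar>C\<bar> + 1" "hnorm H (a m - a n)" e]
        by (simp add: mult.commute)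
      finally show "hnorm H' (?T (a m) - ?T (a n)) < e" .
    qed
  qed
  then obtain g where g: "hconv H' (\<lambda>n. ?T (a n)) g" using H'.H.complete by blast
  have "g = ?T f"
  proof (rule H'.ext_on)
    show "g \<in> functions_on Y F" using g by (intro H'.functions_on) (simp add: hconv_def)
    show "?T f \<in> functions_on Y F"
      using conv \<sigma> by (auto simp: functions_on_def restrict0_def hconv_def)
    show "g y = ?T f y" if y: "y \<in> Y" for y
    proof -
      have "hconv F (\<lambda>n. a n (\<sigma> y)) (g y)"
        using H'.hconv_eval[OF g y] y by (simp add: restrict0_def)
      moreover have "hconv F (\<lambda>n. a n (\<sigma> y)) (f (\<sigma> y))"
        by (rule H.hconv_eval[OF conv \<sigma>[OF y]])
      ultimately show ?thesis using H.F.hconv_unique y by (simp add: restrict0_def)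
    qed
  qed
  with g show ?thesis by simp
qed

text \<open>Extension by density, with the additional information that the extended operator is
  still composition with \<open>\<sigma>\<close>.\<close>

lemma composition_bounded:
  fixes \<sigma> :: "'y \<Rightarrow> 'x" and F :: "('f::complex_vector) hilb"
  assumes "rkhs_space F X K H" "rkhs_space F Y L H'" and \<sigma>: "\<And>y. y \<in> Y \<Longrightarrow> \<sigma> y \<in> X"
    and A: "complex_vector.subspace A" "A \<subseteq> hspace H"
    and T_mem: "\<And>a. a \<in> A \<Longrightarrow> restrict0 Y (\<lambda>y. a (\<sigma> y)) \<in> hspace H'"
    and bound: "\<And>a. a \<in> A \<Longrightarrow> hnorm H' (restrict0 Y (\<lambda>y. a (\<sigma> y))) \<le> C * hnorm H a"
    and f: "f \<in> htop H closure_of A"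
  shows "restrict0 Y (\<lambda>y. f (\<sigma> y)) \<in> hspace H'"
    and "hnorm H' (restrict0 Y (\<lambda>y. f (\<sigma> y))) \<le> C * hnorm H f"
proof -
  interpret H: rkhs_space F X K H by fact
  interpret H': rkhs_space F Y L H' by fact
  obtain a where a: "\<And>n. a n \<in> A" "hconv H a f" using f H.H.in_closure_of_iff[OF A(2)] by blast
  note conv = hconv_composition[OF assms(1,2) \<sigma> A T_mem bound a]
  show "restrict0 Y (\<lambda>y. f (\<sigma> y)) \<in> hspace H'" using conv by (simp add: hconv_def)
  show "hnorm H' (restrict0 Y (\<lambda>y. f (\<sigma> y))) \<le> C * hnorm H f"
  proof (rule LIMSEQ_le[OF H'.H.hconv_norm[OF conv]])
    show "(\<lambda>n. C * hnorm H (a n)) \<longlonglongrightarrow> C * hnorm H f"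
      by (intro tendsto_intros H.H.hconv_norm a)
    show "\<exists>N. \<forall>n\<ge>N. hnorm H' (restrict0 Y (\<lambda>y. a n (\<sigma> y))) \<le> C * hnorm H (a n)"
      using bound[OF a(1)] by blast
  qed
qed

section \<open>Reflection positive representations\<close>

text \<open>If \<open>b 0\<close> exceeded \<open>c\<close>, the ratio \<open>r = b 0 / c\<close>
  would exceed 1, and each step would roughly square \<open>b n / c\<close>, against the bound
  \<open>M\<close>.\<close>

lemma quadratic_growth_bound:
  fixes b :: "nat \<Rightarrow> real"
  assumes b: "\<And>n. 0 \<le> b n" and step: "\<And>n. (b n)\<^sup>2 \<le> b (Suc n) * c" and bdd: "\<And>n. b n \<le> M"
    and c: "0 \<le> c"
  shows "b 0 \<le> c"
proof (rule ccontr)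
  assume "\<not> b 0 \<le> c"
  then have gt: "c < b 0" by simp
  have "c \<noteq> 0" using step[of 0] gt by auto
  with c have c: "c > 0" by simp
  define r where "r = b 0 / c"
  have r: "r > 1" using gt c by (simp add: r_def)
  have grow: "c * r ^ Suc n \<le> b n" for n
  proof (induction n)
    case 0
    then show ?case using c by (simp add: r_def)
  next
    case (Suc n)
    \<comment> \<open>Squaring doubles the exponent; keeping one more power of \<open>r\<close> per
      step is enough for unboundedness.\<close>
    have "r ^ Suc (Suc n) \<le> r ^ (Suc n * 2)" using r by (intro power_increasing) auto
    then have "c * r ^ Suc (Suc n) * c \<le> (c * r ^ Suc n)\<^sup>2"
      using c by (simp add: power_mult_distrib power_mult[symmetric] power2_eq_square[of c] del: power_Suc)
    also have "\<dots> \<le> (b n)\<^sup>2" using Suc c r by (intro power_mono) auto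
    also have "\<dots> \<le> b (Suc n) * c" by (rule step)
    finally show ?case using c by (simp only: mult_le_cancel_right_pos)
  qed
  obtain n where "M / c < r ^ n" using real_arch_pow[OF r] by blast
  also have "\<dots> \<le> r ^ Suc n" using r by (intro power_increasing) auto
  finally have "M < c * r ^ Suc n" using c by (simp only: pos_divide_less_eq mult.commute)
  with grow[of n] bdd[of n] show False by linarith
qed

locale sym_semigroup =
  fixes G :: "('g, 'm) monoid_scheme" (structure) and \<tau> :: "'g \<Rightarrow> 'g" and S :: "'g set"
  assumes sym: "symmetric_group G \<tau>" and semi: "sharp_subsemigroup G \<tau> S"
begin

sublocale group G
  using sym by (simp add: symmetric_group_def)

lemma \<tau>_closed [simp]: "g \<in> carrier G \<Longrightarrow> \<tau> g \<in> carrier G"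
  using sym by (auto simp: symmetric_group_def iso_def hom_def)

lemma \<tau>_mult: "\<lbrakk>g \<in> carrier G; h \<in> carrier G\<rbrakk> \<Longrightarrow> \<tau> (g \<otimes> h) = \<tau> g \<otimes> \<tau> h"
  using sym by (auto simp: symmetric_group_def iso_def hom_def)

lemma \<tau>_\<tau> [simp]: "g \<in> carrier G \<Longrightarrow> \<tau> (\<tau> g) = g"
  using sym by (simp add: symmetric_group_def)

lemma \<tau>_one [simp]: "\<tau> \<one> = \<one>"
  using \<tau>_mult[of \<one> \<one>] by (simp add: r_cancel_one)

lemma \<tau>_inv: "g \<in> carrier G \<Longrightarrow> \<tau> (inv g) = inv (\<tau> g)"
  using \<tau>_mult[of "inv g" g] by (intro inv_equality[symmetric]) simp_all

lemma S_subset: "s \<in> S \<Longrightarrow> s \<in> carrier G"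
  using semi by (auto simp: sharp_subsemigroup_def)

lemma S_mult [simp]: "\<lbrakk>s \<in> S; t \<in> S\<rbrakk> \<Longrightarrow> s \<otimes> t \<in> S"
  using semi by (auto simp: sharp_subsemigroup_def)

lemma S_sharp [simp]: "s \<in> S \<Longrightarrow> sharp G \<tau> s \<in> S"
  using semi by (auto simp: sharp_subsemigroup_def)

lemma sharp_closed [simp]: "g \<in> carrier G \<Longrightarrow> sharp G \<tau> g \<in> carrier G"
  by (simp add: sharp_def)

lemma sharp_sharp [simp]: "g \<in> carrier G \<Longrightarrow> sharp G \<tau> (sharp G \<tau> g) = g"
  by (simp add: sharp_def \<tau>_inv)

end

section \<open>Unitary representations of the semidirect product\<close>

locale tau_rep = sym_semigroup G \<tau> S + E: hilb E
  for G :: "('g, 'm) monoid_scheme" (structure) and \<tau> S and E :: "('e::complex_vector) hilb" +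
  fixes \<pi> :: "'g \<times> bool \<Rightarrow> 'e \<Rightarrow> 'e"
  assumes rep: "unitary_rep (semidirect_tau G \<tau>) E \<pi>"
begin

lemma rep_unitary: "g \<in> carrier G \<Longrightarrow> unitary_map E E (\<pi> (g, b))"
  using rep by (simp add: unitary_rep_def semidirect_tau_def)

lemma rep_linear: "g \<in> carrier G \<Longrightarrow> linear_between (hspace E) (hspace E) (\<pi> (g, b))"
  using rep_unitary by (simp add: unitary_map_def)

lemma rep_mem [simp]: "\<lbrakk>g \<in> carrier G; v \<in> hspace E\<rbrakk> \<Longrightarrow> \<pi> (g, b) v \<in> hspace E"
  using rep_linear linear_betweenD(1) by blast

lemma rep_inner:
  "\<lbrakk>g \<in> carrier G; v \<in> hspace E; w \<in> hspace E\<rbrakk>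
    \<Longrightarrow> hinner E (\<pi> (g, b) v) (\<pi> (g, b) w) = hinner E v w"
  using rep_unitary by (simp add: unitary_map_def)

lemma rep_norm: "\<lbrakk>g \<in> carrier G; v \<in> hspace E\<rbrakk> \<Longrightarrow> hnorm E (\<pi> (g, b) v) = hnorm E v"
  by (simp add: hnorm_def rep_inner)

lemma rep_comp:
  "\<lbrakk>g \<in> carrier G; h \<in> carrier G; v \<in> hspace E\<rbrakk>
    \<Longrightarrow> \<pi> (g, a) (\<pi> (h, b) v) = \<pi> (g \<otimes> (if a then \<tau> h else h), a \<noteq> b) v"
  using rep unfolding unitary_rep_def semidirect_tau_def by simp

text \<open>\<open>unitary_rep\<close> has no axiom for the unit; the operator of the unit is
  idempotent and injective, hence the identity.\<close>

lemma rep_one: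
  assumes v: "v \<in> hspace E" shows "\<pi> (\<one>, False) v = v"
proof -
  have "\<pi> (\<one>, False) (\<pi> (\<one>, False) v) = \<pi> (\<one>, False) v" using v by (simp add: rep_comp)
  moreover have "inj_on (\<pi> (\<one>, False)) (hspace E)"
    using rep_unitary[of \<one> False] by (simp add: unitary_map_def bij_betw_def)
  ultimately show ?thesis using v by (auto dest!: inj_onD)
qed

abbreviation "\<theta> \<equiv> theta G \<pi>"

lemma theta_linear: "linear_between (hspace E) (hspace E) \<theta>"
  by (simp add: theta_def rep_linear)

lemma theta_mem [simp]: "v \<in> hspace E \<Longrightarrow> \<theta> v \<in> hspace E"
  by (simp add: theta_def)

lemma theta_norm: "v \<in> hspace E \<Longrightarrow> hnorm E (\<theta> v) = hnorm E v"
  by (simp add: theta_def rep_norm)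

lemma theta_theta: "v \<in> hspace E \<Longrightarrow> \<theta> (\<theta> v) = v"
  by (simp add: theta_def rep_comp rep_one)

lemma theta_inner: "\<lbrakk>v \<in> hspace E; w \<in> hspace E\<rbrakk> \<Longrightarrow> hinner E (\<theta> v) w = hinner E v (\<theta> w)"
  using rep_inner[of \<one> v "\<theta> w" True] by (simp add: theta_def[symmetric] theta_theta)

lemma rep_inner_inv:
  assumes "g \<in> carrier G" "v \<in> hspace E" "w \<in> hspace E"
  shows "hinner E (\<pi> (g, False) v) w = hinner E v (\<pi> (inv g, False) w)"
  using rep_inner[of g v "\<pi> (inv g, False) w" False] assms by (simp add: rep_comp rep_one)

lemma theta_rep: "\<lbrakk>g \<in> carrier G; v \<in> hspace E\<rbrakk> \<Longrightarrow> \<theta> (\<pi> (\<tau> g, False) v) = \<pi> (g, False) (\<theta> v)"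
  by (simp add: theta_def rep_comp)

text \<open>This is the origin of \<open>sharp\<close>: unitarity moves \<open>g\<close> to the left
  as its inverse, and passing that inverse through \<theta> applies \<open>\<tau>\<close> to it. So
  in the form twisted by \<theta> the adjoint of \<open>g\<close> acts as
  \<open>sharp G \<tau> g\<close>.\<close>

lemma theta_adjoint:
  assumes g: "g \<in> carrier G" and v: "v \<in> hspace E" and w: "w \<in> hspace E"
  shows "hinner E (\<theta> v) (\<pi> (g, False) w) = hinner E (\<theta> (\<pi> (sharp G \<tau> g, False) v)) w"
proof -
  have "\<theta> (\<pi> (sharp G \<tau> g, False) v) = \<pi> (inv g, False) (\<theta> v)"
    using theta_rep[of "inv g" v] g v by (simp add: sharp_def \<tau>_inv)
  then show ?thesis using rep_inner_inv[of "inv g" "\<theta> v" w] g v w by simp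
qed

lemma generators_subset:
  "F \<subseteq> hspace E \<Longrightarrow> {\<pi> (s, False) v |s v. s \<in> S \<and> v \<in> F} \<subseteq> hspace E"
  by (auto simp: S_subset)

lemma Eplus_subset: "Eplus S E \<pi> F \<subseteq> hspace E"
  unfolding Eplus_def by (rule E.closed_span_subset)

lemma Eplus_closed: "F \<subseteq> hspace E \<Longrightarrow> closed_subspace E (Eplus S E \<pi> F)"
  unfolding Eplus_def by (intro E.closed_subspace_closed_span generators_subset)

lemma Eplus_generator: "\<lbrakk>F \<subseteq> hspace E; s \<in> S; v \<in> F\<rbrakk> \<Longrightarrow> \<pi> (s, False) v \<in> Eplus S E \<pi> F"
  unfolding Eplus_def using E.subset_closed_span[OF generators_subset[of F]] by blast

text \<open>Closure of \<open>S\<close> under products gives invariance of the generators; linearity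
  carries it to the span and isometry to the closure.\<close>

lemma Eplus_invariant:
  assumes F: "F \<subseteq> hspace E" and s: "s \<in> S" and v: "v \<in> Eplus S E \<pi> F"
  shows "\<pi> (s, False) v \<in> Eplus S E \<pi> F"
proof -
  define A where "A = {\<pi> (s, False) v |s v. s \<in> S \<and> v \<in> F}"
  note sG = S_subset[OF s]
  note lin = rep_linear[OF sG, of False]
  have A: "A \<subseteq> hspace E" unfolding A_def by (rule generators_subset[OF F])
  have "complex_vector.span A \<subseteq> {v \<in> hspace E. \<pi> (s, False) v \<in> complex_vector.span A}"
  proof (rule complex_vector.span_minimal)
    show "A \<subseteq> {v \<in> hspace E. \<pi> (s, False) v \<in> complex_vector.span A}"
    proof
      fix a assume a: "a \<in> A"
      then obtain t v where t: "t \<in> S" "v \<in> F" "a = \<pi> (t, False) v" unfolding A_def by blast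
      then have "\<pi> (s, False) a = \<pi> (s \<otimes> t, False) v"
        using F sG S_subset[of t] by (auto simp: rep_comp)
      then have "\<pi> (s, False) a \<in> A" using t S_mult[OF s t(1)] unfolding A_def by blast
      then show "a \<in> {v \<in> hspace E. \<pi> (s, False) v \<in> complex_vector.span A}"
        using a A complex_vector.span_base by blast
    qed
    show "complex_vector.subspace {v \<in> hspace E. \<pi> (s, False) v \<in> complex_vector.span A}"
      by (auto simp: complex_vector.subspace_def linear_between_zero[OF lin] linear_betweenD(2,3)[OF lin]
          complex_vector.span_zero complex_vector.span_add complex_vector.span_scale)
  qed
  then have inv: "\<pi> (s, False) a \<in> complex_vector.span A" if "a \<in> complex_vector.span A" for a
    using that by blast
  obtain f where f: "\<forall>n. f n \<in> complex_vector.span A" "hconv E f v"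
    using v E.in_closed_span_iff[OF A] unfolding Eplus_def A_def[symmetric] by blast
  have "hconv E (\<lambda>n. \<pi> (s, False) (f n)) (\<pi> (s, False) v)"
    by (rule hconv_map[OF E.semi_hilb_axioms E.semi_hilb_axioms lin _ f(2), of 1])
      (simp add: rep_norm sG)
  then show ?thesis
    unfolding Eplus_def A_def[symmetric] E.in_closed_span_iff[OF A]
    using f(1) inv by (intro exI[of _ "\<lambda>n. \<pi> (s, False) (f n)"]) simp
qed

end

section \<open>Contractivity on the positive subspace, and the compression\<close>

locale rp_rep = tau_rep G \<tau> S E \<pi>
  for G :: "('g, 'm) monoid_scheme" (structure) and \<tau> S and E :: "('e::complex_vector) hilb" and \<pi> +
  fixes F :: "'e set"
  assumes F_closed: "closed_subspace E F"
    and theta_F: "v \<in> F \<Longrightarrow> theta G \<pi> v = v"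
    and theta_pos: "v \<in> Eplus S E \<pi> F \<Longrightarrow> hinner E (theta G \<pi> v) v \<in> \<real>\<^sub>\<ge>\<^sub>0"

lemma (in sym_semigroup) rp_rep_of:
  "reflection_positive_cyclic_rep G \<tau> S \<pi> E F \<Longrightarrow> rp_rep G \<tau> S E \<pi> F"
  by (auto simp: reflection_positive_cyclic_rep_def rp_rep_def rp_rep_axioms_def tau_rep_def
      tau_rep_axioms_def hilbert_iff sym_semigroup_axioms)

context rp_rep
begin

lemma F_subset: "v \<in> F \<Longrightarrow> v \<in> hspace E"
  using E.closed_subspaceD(2)[OF F_closed] by blast

lemma F_le: "F \<subseteq> hspace E"
  using F_subset by blast

text \<open>The seminormed space whose quotient by the null vectors is completed in
  \<open>hat_completion\<close>.\<close>

definition plus :: "'e hilb" where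
  "plus = \<lparr>hspace = Eplus S E \<pi> F, hinner = (\<lambda>v w. hinner E (\<theta> v) w)\<rparr>"

lemma plus_simps [simp]:
  "hspace plus = Eplus S E \<pi> F" "hinner plus v w = hinner E (\<theta> v) w"
  by (simp_all add: plus_def)

lemma Eplus_mem: "v \<in> Eplus S E \<pi> F \<Longrightarrow> v \<in> hspace E"
  using Eplus_subset by blast

sublocale plus: semi_hilb plus
proof (unfold_locales, goal_cases)
  case 1 show ?case using E.closed_subspaceD(1)[OF Eplus_closed[OF F_le]] by simp
next
  case (2 u v w) then show ?case
    by (simp add: Eplus_mem linear_betweenD(2)[OF theta_linear] E.add_left)
next
  case (3 v w a) then show ?case
    by (simp add: Eplus_mem linear_betweenD(3)[OF theta_linear] E.scale_left)
next
  case (4 v w) then show ?case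
    using theta_inner[of w v] E.herm[of "\<theta> v" w] by (simp add: Eplus_mem)
next
  case (5 v) then show ?case using theta_pos complex_nonneg_Reals_iff by auto
qed

lemma plus_norm_le:
  assumes "v \<in> Eplus S E \<pi> F" shows "hnorm plus v \<le> hnorm E v"
proof -
  have v: "v \<in> hspace E" using assms by (rule Eplus_mem)
  have "(hnorm plus v)\<^sup>2 = Re (hinner E (\<theta> v) v)" using assms by (simp add: plus.norm_sq)
  also have "\<dots> \<le> hnorm E (\<theta> v) * hnorm E v" using v by (intro E.Re_inner_le) auto
  also have "\<dots> = (hnorm E v)\<^sup>2" using v by (simp add: theta_norm power2_eq_square)
  finally show ?thesis using E.norm_nonneg[OF v] by (rule power2_le_imp_le)
qed

text \<open>Iterating Cauchy--Schwarz along \<open>w, w\<^sup>\<sharp> w, (w\<^sup>\<sharp> w)\<^sup>\<sharp> (w\<^sup>\<sharp> w), \<dots>\<close> turns the trivial bound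
  \<open>plus_norm_le\<close>, which does not depend on \<open>w\<close>, into contractivity.\<close>

lemma plus_contractive:
  assumes s: "s \<in> S" and v: "v \<in> Eplus S E \<pi> F"
  shows "hnorm plus (\<pi> (s, False) v) \<le> hnorm plus v"
proof -
  define w where "w = rec_nat s (\<lambda>_ t. sharp G \<tau> t \<otimes> t)"
  have w_Suc: "w (Suc n) = sharp G \<tau> (w n) \<otimes> w n" for n by (simp add: w_def)
  have w: "w n \<in> S" for n
  proof (induction n)
    case 0 show ?case using s by (simp add: w_def)
  qed (simp add: w_Suc)
  note wG = S_subset[OF w] and vE = Eplus_mem[OF v]
  have mem: "\<pi> (w n, False) v \<in> Eplus S E \<pi> F" for n
    by (rule Eplus_invariant[OF F_le w v])
  define b where "b n = hnorm plus (\<pi> (w n, False) v)" for n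
  have "b 0 \<le> hnorm plus v"
  proof (rule quadratic_growth_bound)
    show "0 \<le> b n" for n using mem by (simp add: b_def)
    show "b n \<le> hnorm E v" for n
      using plus_norm_le[OF mem[of n]] wG[of n] vE by (simp add: b_def rep_norm)
    show "0 \<le> hnorm plus v" using v by simp
    show "(b n)\<^sup>2 \<le> b (Suc n) * hnorm plus v" for n
    proof -
      have "(b n)\<^sup>2 = Re (hinner E (\<theta> (\<pi> (w n, False) v)) (\<pi> (w n, False) v))"
        using mem[of n] by (simp add: b_def plus.norm_sq)
      \<comment> \<open>\<open>theta_adjoint\<close> carries the second operator to the left as that
        of \<open>sharp G \<tau> (w n)\<close>, which is how \<open>w (Suc n)\<close>
        arises.\<close>
      also have "\<dots> = Re (hinner plus (\<pi> (w (Suc n), False) v) v)"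
        using wG[of n] vE by (simp add: theta_adjoint w_Suc rep_comp)
      also have "\<dots> \<le> b (Suc n) * hnorm plus v"
        unfolding b_def by (rule plus.Re_inner_le) (use mem v in simp_all)
      finally show ?thesis .
    qed
  qed
  then show ?thesis by (simp add: b_def w_def)
qed

abbreviation "P \<equiv> orth_proj E F"

lemma P_mem [simp]: "v \<in> hspace E \<Longrightarrow> P v \<in> F"
  using E.orth_proj_props(1)[OF F_closed] .

lemma P_inner: "\<lbrakk>v \<in> hspace E; w \<in> F\<rbrakk> \<Longrightarrow> hinner E (P v) w = hinner E v w"
  using E.orth_proj_props(2)[OF F_closed, of v w] F_subset[OF P_mem, of v] F_subset[of w]
  by (simp add: E.diff_left)

lemma P_eqI: "\<lbrakk>v \<in> hspace E; w \<in> F; \<And>u. u \<in> F \<Longrightarrow> hinner E v u = hinner E w u\<rbrakk> \<Longrightarrow> P v = w"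
  using F_subset by (intro E.orth_proj_unique[OF F_closed]) (simp_all add: E.diff_left)

lemma P_id: "v \<in> F \<Longrightarrow> P v = v"
  using F_subset by (intro P_eqI) auto

lemma P_linear: "linear_between (hspace E) F P"
  unfolding linear_between_def
proof (intro conjI ballI allI)
  note sub = E.closed_subspaceD(1)[OF F_closed]
  show "P (u + v) = P u + P v" if "u \<in> hspace E" "v \<in> hspace E" for u v
    using that F_subset complex_vector.subspace_add[OF sub]
    by (intro P_eqI) (simp_all add: E.add_left P_inner)
  show "P (a *\<^sub>C v) = a *\<^sub>C P v" if "v \<in> hspace E" for a v
    using that F_subset complex_vector.subspace_scale[OF sub]
    by (intro P_eqI) (simp_all add: E.scale_left P_inner)
qed auto

lemma P_norm:
  assumes v: "v \<in> hspace E" shows "hnorm E (P v) \<le> hnorm E v"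
proof -
  have Pv: "P v \<in> hspace E" using v F_subset by simp
  have "(hnorm E (P v))\<^sup>2 = Re (hinner E v (P v))" using v Pv by (simp add: E.norm_sq P_inner)
  also have "\<dots> \<le> hnorm E v * hnorm E (P v)" using v Pv by (rule E.Re_inner_le)
  finally have "hnorm E (P v) * hnorm E (P v) \<le> hnorm E v * hnorm E (P v)"
    by (simp add: power2_eq_square)
  then show ?thesis
    using E.norm_nonneg[OF Pv] E.norm_nonneg[OF v]
    by (cases "hnorm E (P v) = 0") (simp_all add: mult_le_cancel_right)
qed

text \<open>The adjoint of \<open>P\<close>, viewed as a map from \<open>E\<close> to
  \<open>F\<close>, is the inclusion of \<open>F\<close>.\<close>

lemma compression_eq: "w \<in> F \<Longrightarrow> compression E F \<pi> g w = P (\<pi> (g, False) w)"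
proof -
  assume w: "w \<in> F"
  have "hadjoint E (hsub E F) P w = w"
    using w F_subset by (intro E.hadjoint_unique) (simp_all add: P_inner)
  then show ?thesis by (simp add: compression_def Let_def)
qed

lemma compression_inner:
  "\<lbrakk>g \<in> carrier G; v \<in> F; w \<in> F\<rbrakk> \<Longrightarrow> hinner E (compression E F \<pi> g v) w = hinner E (\<pi> (g, False) v) w"
  using F_subset by (simp add: compression_eq P_inner)

lemma compression_bounded:
  assumes g: "g \<in> carrier G" shows "bounded_op (hsub E F) (compression E F \<pi> g)"
  unfolding bounded_op_def
proof
  note sub = E.closed_subspaceD(1)[OF F_closed]
  show "linear_between (hspace (hsub E F)) (hspace (hsub E F)) (compression E F \<pi> g)"
    using g F_subset complex_vector.subspace_add[OF sub] complex_vector.subspace_scale[OF sub]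
    by (auto simp: linear_between_def compression_eq linear_betweenD(2,3)[OF rep_linear]
        linear_betweenD(2,3)[OF P_linear])
  have "hnorm E (compression E F \<pi> g v) \<le> 1 * hnorm E v" if "v \<in> F" for v
    using P_norm[of "\<pi> (g, False) v"] that g F_subset by (simp add: compression_eq rep_norm)
  then show "\<exists>C. \<forall>v\<in>hspace (hsub E F).
      hnorm (hsub E F) (compression E F \<pi> g v) \<le> C * hnorm (hsub E F) v" unfolding hsub_simps by blast
qed

theorem compression_reflection_positive:
  "reflection_positive_function G \<tau> S (hsub E F) (compression E F \<pi>)"
  unfolding reflection_positive_function_def
proof (intro conjI ballI)
  show "bounded_op (hsub E F) (compression E F \<pi> g)" if "g \<in> carrier G" for g
    using that by (rule compression_bounded)
  show "pos_def_function G (carrier G) (\<lambda>g. inv g) (hsub E F) (compression E F \<pi>)"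
    unfolding pos_def_function_def pos_def_kernel_def fun_kernel_def
  proof (intro conjI ballI allI impI)
    fix n :: nat and x v assume "\<forall>j<n. x j \<in> carrier G \<and> v j \<in> hspace (hsub E F)"
    then have xv: "x j \<in> carrier G" "v j \<in> F" "v j \<in> hspace E" if "j < n" for j
      using that F_subset by auto
    define u where "u = (\<Sum>k<n. \<pi> (inv (x k), False) (v k))"
    have u: "u \<in> hspace E" unfolding u_def using xv by (intro E.sum_mem) auto
    have "hinner (hsub E F) (compression E F \<pi> (x j \<otimes> inv (x k)) (v k)) (v j)
        = hinner E (\<pi> (inv (x k), False) (v k)) (\<pi> (inv (x j), False) (v j))" if "j < n" "k < n" for j k
      using that xv rep_inner_inv[of "x j" "\<pi> (inv (x k), False) (v k)" "v j"]
      by (simp add: compression_inner rep_comp)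
    then have "(\<Sum>j<n. \<Sum>k<n. hinner (hsub E F) (compression E F \<pi> (x j \<otimes> inv (x k)) (v k)) (v j))
        = (\<Sum>j<n. \<Sum>k<n. hinner E (\<pi> (inv (x k), False) (v k)) (\<pi> (inv (x j), False) (v j)))"
      by simp
    also have "\<dots> = (\<Sum>j<n. hinner E u (\<pi> (inv (x j), False) (v j)))"
      unfolding u_def using xv by (intro sum.cong refl E.sum_left[symmetric]) auto
    also have "\<dots> = hinner E u u"
      unfolding u_def using xv u by (intro E.sum_right[symmetric]) (auto simp: u_def)
    also have "\<dots> \<in> \<real>\<^sub>\<ge>\<^sub>0"
      using u by (simp add: E.inner_self del: of_real_power)
    finally show "(\<Sum>j<n. \<Sum>k<n. hinner (hsub E F) (compression E F \<pi> (x j \<otimes> inv (x k)) (v k)) (v j)) \<in> \<real>\<^sub>\<ge>\<^sub>0" .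
  qed (simp add: compression_bounded)
  show "compression E F \<pi> (\<tau> g) v = compression E F \<pi> g v"
    if g: "g \<in> carrier G" and "v \<in> hspace (hsub E F)" for g v
  proof -
    have v: "v \<in> F" "v \<in> hspace E" using that F_subset by auto
    have "P (\<pi> (\<tau> g, False) v) = P (\<pi> (g, False) v)"
    proof (rule P_eqI)
      fix u assume u: "u \<in> F"
      \<comment> \<open>Since \<theta> fixes \<open>u\<close>, it can be inserted there and moved to
        the left. Passing the operator of \<open>\<tau> g\<close> turns the latter into that of
        \<open>g\<close>, and then \<theta> is absorbed by \<open>v\<close>.\<close>
      have "hinner E (\<pi> (\<tau> g, False) v) u = hinner E (\<theta> (\<pi> (\<tau> g, False) v)) u"
        using u v g F_subset[OF u] theta_inner[of "\<pi> (\<tau> g, False) v" u] by (simp add: theta_F)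
      also have "\<dots> = hinner E (P (\<pi> (g, False) v)) u"
        using u v g by (simp add: theta_rep theta_F P_inner)
      finally show "hinner E (\<pi> (\<tau> g, False) v) u = hinner E (P (\<pi> (g, False) v)) u" .
    qed (use v g in auto)
    then show ?thesis using v by (simp add: compression_eq)
  qed
  show "pos_def_function G S (sharp G \<tau>) (hsub E F) (compression E F \<pi>)"
    unfolding pos_def_function_def pos_def_kernel_def fun_kernel_def
  proof (intro conjI ballI allI impI)
    fix n :: nat and x v assume "\<forall>j<n. x j \<in> S \<and> v j \<in> hspace (hsub E F)"
    then have xv: "x j \<in> S" "x j \<in> carrier G" "v j \<in> F" "v j \<in> hspace E" if "j < n" for j
      using that F_subset S_subset by auto
    let ?s = "sharp G \<tau>"
    define u where "u = (\<Sum>k<n. \<pi> (?s (x k), False) (v k))"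
    have gen: "\<pi> (?s (x k), False) (v k) \<in> hspace plus" if "k < n" for k
      using xv[OF that] Eplus_generator[OF F_le] by simp
    then have u: "u \<in> hspace plus" unfolding u_def by (intro plus.sum_mem) auto
    have "hinner (hsub E F) (compression E F \<pi> (x j \<otimes> ?s (x k)) (v k)) (v j)
        = hinner plus (\<pi> (?s (x k), False) (v k)) (\<pi> (?s (x j), False) (v j))" if "j < n" "k < n" for j k
    proof -
      note [simp] = xv[OF that(1)] xv[OF that(2)]
      \<comment> \<open>\<open>theta_adjoint\<close> moves \<open>?s (x j)\<close> to the left as
        its own sharp, which is \<open>x j\<close>. The remaining \<theta> is then moved to
        \<open>v j\<close>, which it fixes.\<close>
      have "hinner plus (\<pi> (?s (x k), False) (v k)) (\<pi> (?s (x j), False) (v j))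
          = hinner E (\<theta> (\<pi> (x j, False) (\<pi> (?s (x k), False) (v k)))) (v j)"
        by (simp add: theta_adjoint)
      also have "\<dots> = hinner E (\<pi> (x j \<otimes> ?s (x k), False) (v k)) (v j)"
        by (simp add: theta_inner theta_F rep_comp)
      finally show ?thesis by (simp add: compression_inner)
    qed
    then have "(\<Sum>j<n. \<Sum>k<n. hinner (hsub E F) (compression E F \<pi> (x j \<otimes> ?s (x k)) (v k)) (v j))
        = (\<Sum>j<n. \<Sum>k<n. hinner plus (\<pi> (?s (x k), False) (v k)) (\<pi> (?s (x j), False) (v j)))"
      by simp
    also have "\<dots> = (\<Sum>j<n. hinner plus u (\<pi> (?s (x j), False) (v j)))"
      unfolding u_def using gen by (intro sum.cong refl plus.sum_left[symmetric]) auto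
    also have "\<dots> = hinner plus u u"
      unfolding u_def using gen u by (intro plus.sum_right[symmetric]) (auto simp: u_def)
    also have "\<dots> \<in> \<real>\<^sub>\<ge>\<^sub>0"
      using u theta_pos by simp
    finally show "(\<Sum>j<n. \<Sum>k<n. hinner (hsub E F) (compression E F \<pi> (x j \<otimes> ?s (x k)) (v k)) (v j)) \<in> \<real>\<^sub>\<ge>\<^sub>0" .
  qed (simp add: compression_bounded S_subset)
qed

lemma compression_one: "v \<in> F \<Longrightarrow> compression E F \<pi> \<one> v = v"
  using F_subset by (simp add: compression_eq rep_one P_id)

end

section \<open>Kernel-preserving bijections\<close>

lemma restrict0_apply [simp]: "restrict0 Y f y = (if y \<in> Y then f y else 0)"
  by (simp add: restrict0_def)

lemma restrict0_add:
  fixes f g :: "'x \<Rightarrow> 'f::complex_vector"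
  shows "restrict0 Y (\<lambda>y. (f + g) (\<sigma> y)) = restrict0 Y (\<lambda>y. f (\<sigma> y)) + restrict0 Y (\<lambda>y. g (\<sigma> y))"
  by (simp add: fun_eq_iff)

lemma restrict0_scale:
  fixes f :: "'x \<Rightarrow> 'f::complex_vector"
  shows "restrict0 Y (\<lambda>y. (a *\<^sub>C f) (\<sigma> y)) = a *\<^sub>C restrict0 Y (\<lambda>y. f (\<sigma> y))"
  by (simp add: fun_eq_iff)

lemma linear_between_restrict0:
  fixes V :: "('x \<Rightarrow> 'f::complex_vector) set"
  assumes "\<And>f. f \<in> V \<Longrightarrow> restrict0 Y (\<lambda>y. f (\<sigma> y)) \<in> W"
  shows "linear_between V W (\<lambda>f. restrict0 Y (\<lambda>y. f (\<sigma> y)))"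
  using assms unfolding linear_between_def restrict0_add restrict0_scale by blast

context rkhs_space
begin

lemma kfun_eqI:
  "\<lbrakk>y \<in> X; v \<in> hspace F; f \<in> functions_on X F; \<And>x. x \<in> X \<Longrightarrow> f x = K x y v\<rbrakk> \<Longrightarrow> f = kfun y v"
  by (intro ext_on) (simp_all add: functions_on kfun_apply)

lemma kfun_inner:
  "\<lbrakk>x \<in> X; y \<in> X; v \<in> hspace F; w \<in> hspace F\<rbrakk> \<Longrightarrow> hinner H (kfun y v) (kfun x w) = hinner F (K x y v) w"
  by (simp add: reproducing kfun_apply)

text \<open>Invariance of the kernel turns \<open>K (\<sigma> x) (\<sigma> y') v\<close> into
  \<open>K x y' v\<close>, and \<open>\<sigma> y' = y\<close>.\<close>

lemma composition_kfun:
  assumes \<sigma>: "\<And>x. x \<in> X \<Longrightarrow> \<sigma> x \<in> X" and \<sigma>': "y' \<in> X" "\<sigma> y' = y"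
    and inv: "\<And>x y v. \<lbrakk>x \<in> X; y \<in> X; v \<in> hspace F\<rbrakk> \<Longrightarrow> K (\<sigma> x) (\<sigma> y) v = K x y v"
    and v: "v \<in> hspace F"
  shows "restrict0 X (\<lambda>x. kfun y v (\<sigma> x)) = kfun y' v"
proof -
  have y: "y \<in> X" using \<sigma> \<sigma>' by blast
  show ?thesis
  proof (rule kfun_eqI[OF \<sigma>'(1) v])
    show "restrict0 X (\<lambda>x. kfun y v (\<sigma> x)) \<in> functions_on X F"
      using \<sigma> y v by (intro functions_onI) auto
    show "restrict0 X (\<lambda>x. kfun y v (\<sigma> x)) x = K x y' v" if "x \<in> X" for x
      using that \<sigma>[OF that] y v inv[OF that \<sigma>'(1) v] \<sigma>'(2) by (simp add: kfun_apply)
  qed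
qed

text \<open>Kernel functions go to kernel functions with the same Gram matrix, so the composition is
  isometric on their span. Only the inequality is carried to the closure, by
  \<open>composition_bounded\<close> with constant 1.\<close>

lemma composition_contractive:
  assumes \<sigma>: "\<And>x. x \<in> X \<Longrightarrow> \<sigma> x \<in> X" and \<sigma>': "\<And>x. x \<in> X \<Longrightarrow> \<sigma>' x \<in> X" "\<And>x. x \<in> X \<Longrightarrow> \<sigma> (\<sigma>' x) = x"
    and inv: "\<And>x y v. \<lbrakk>x \<in> X; y \<in> X; v \<in> hspace F\<rbrakk> \<Longrightarrow> K (\<sigma> x) (\<sigma> y) v = K x y v"
    and f: "f \<in> hspace H"
  shows "restrict0 X (\<lambda>x. f (\<sigma> x)) \<in> hspace H"
    and "hnorm H (restrict0 X (\<lambda>x. f (\<sigma> x))) \<le> 1 * hnorm H f"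
proof -
  define T where "T = (\<lambda>f :: _ \<Rightarrow> 'f. restrict0 X (\<lambda>x. f (\<sigma> x)))"
  have T_kfun: "T (kfun y v) = kfun (\<sigma>' y) v" if "y \<in> X" "v \<in> hspace F" for y v
    unfolding T_def using that \<sigma> \<sigma>' inv by (intro composition_kfun) auto
  have T0: "T 0 = 0" and T_add: "T (f + g) = T f + T g" and T_scale: "T (a *\<^sub>C f) = a *\<^sub>C T f" for f g a
    by (simp_all add: T_def fun_eq_iff)
  let ?S = "complex_vector.span kfuns"
  have "?S \<subseteq> {f. T f \<in> hspace H}"
  proof (rule complex_vector.span_minimal)
    show "kfuns \<subseteq> {f. T f \<in> hspace H}" using \<sigma>' by (auto simp: kfuns_def T_kfun)
    show "complex_vector.subspace {f. T f \<in> hspace H}"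
      by (simp add: complex_vector.subspace_def T0 T_add T_scale)
  qed
  then have mem: "T g \<in> hspace H" if "g \<in> ?S" for g using that by blast
  have lin: "linear_between ?S (hspace H) T"
    using mem by (auto simp: linear_between_def T_add T_scale)
  have inner: "hinner H (T g) (T h) = hinner H g h" if "g \<in> ?S" "h \<in> ?S" for g h
  proof (rule inner_eq_on_span[OF H.semi_hilb_axioms H.semi_hilb_axioms kfuns_subset _ lin _ that,
        of "\<lambda>f. f"])
    show "hinner H (T a) (T b) = hinner H a b" if ab: "a \<in> kfuns" "b \<in> kfuns" for a b
    proof -
      obtain y v z w where yz: "a = kfun y v" "y \<in> X" "v \<in> hspace F" "b = kfun z w" "z \<in> X" "w \<in> hspace F"
        using ab unfolding kfuns_def by blast
      then have "K (\<sigma>' z) (\<sigma>' y) v = K z y v" using inv[of "\<sigma>' z" "\<sigma>' y" v] \<sigma>' by simp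
      then show ?thesis using yz \<sigma>' by (simp add: T_kfun kfun_inner)
    qed
  qed (simp add: linear_between_def)
  have fcl: "f \<in> htop H closure_of ?S"
    using f closed_span_kfuns by (simp add: closed_span_def)
  note A = complex_vector.subspace_span H.span_subset[OF kfuns_subset]
  have bound: "hnorm H (T g) \<le> 1 * hnorm H g" if "g \<in> ?S" for g
    using inner[OF that that] by (simp add: hnorm_def)
  show "restrict0 X (\<lambda>x. f (\<sigma> x)) \<in> hspace H"
    "hnorm H (restrict0 X (\<lambda>x. f (\<sigma> x))) \<le> 1 * hnorm H f"
    using composition_bounded[OF rkhs_space_axioms rkhs_space_axioms \<sigma> A mem[unfolded T_def]
        bound[unfolded T_def] fcl] by auto
qed

text \<open>Composition with \<open>\<sigma>\<close> and composition with \<open>\<sigma>'\<close>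
  are mutually inverse contractions, hence both isometric.\<close>

lemma composition_unitary:
  assumes \<sigma>: "\<And>x. x \<in> X \<Longrightarrow> \<sigma> x \<in> X" and \<sigma>': "\<And>x. x \<in> X \<Longrightarrow> \<sigma>' x \<in> X"
    and \<sigma>\<sigma>': "\<And>x. x \<in> X \<Longrightarrow> \<sigma> (\<sigma>' x) = x" and \<sigma>'\<sigma>: "\<And>x. x \<in> X \<Longrightarrow> \<sigma>' (\<sigma> x) = x"
    and inv: "\<And>x y v. \<lbrakk>x \<in> X; y \<in> X; v \<in> hspace F\<rbrakk> \<Longrightarrow> K (\<sigma> x) (\<sigma> y) v = K x y v"
  shows "unitary_map H H (\<lambda>f. restrict0 X (\<lambda>x. f (\<sigma> x)))"
proof -
  define T T' where "T = (\<lambda>f :: _ \<Rightarrow> 'f. restrict0 X (\<lambda>x. f (\<sigma> x)))"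
    and "T' = (\<lambda>f :: _ \<Rightarrow> 'f. restrict0 X (\<lambda>x. f (\<sigma>' x)))"
  have inv': "K (\<sigma>' x) (\<sigma>' y) v = K x y v" if "x \<in> X" "y \<in> X" "v \<in> hspace F" for x y v
    using inv[of "\<sigma>' x" "\<sigma>' y" v] that \<sigma>' \<sigma>\<sigma>' by simp
  have T: "T f \<in> hspace H" "hnorm H (T f) \<le> hnorm H f" if "f \<in> hspace H" for f
    using composition_contractive[of \<sigma> \<sigma>', OF \<sigma> \<sigma>' \<sigma>\<sigma>' inv that] by (auto simp: T_def)
  have T': "T' f \<in> hspace H" "hnorm H (T' f) \<le> hnorm H f" if "f \<in> hspace H" for f
    using composition_contractive[of \<sigma>' \<sigma>, OF \<sigma>' \<sigma> \<sigma>'\<sigma> inv' that] by (auto simp: T'_def)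
  have TT': "T (T' f) = f" and T'T: "T' (T f) = f" if "f \<in> hspace H" for f
    using that by (auto simp: T_def T'_def fun_eq_iff eval_off \<sigma> \<sigma>' \<sigma>\<sigma>' \<sigma>'\<sigma>)
  have lin: "linear_between (hspace H) (hspace H) T"
    unfolding T_def by (rule linear_between_restrict0) (use T in \<open>simp add: T_def\<close>)
  have norm: "hnorm H (T f) = hnorm H f" if "f \<in> hspace H" for f
    using T[OF that] T'(2)[OF T(1)[OF that]] T'T[OF that] by simp
  have "bij_betw T (hspace H) (hspace H)"
    by (rule bij_betwI[of _ _ _ T']) (auto simp: T T' TT' T'T)
  then show ?thesis
    unfolding unitary_map_def T_def[symmetric]
    using lin isometry_inner[OF H.semi_hilb_axioms H.semi_hilb_axioms lin norm] by blast
qed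

end

section \<open>Bounded operators and dense subsets\<close>

text \<open>This later identifies the operator chosen in \<open>hat_action\<close> from its values
  on classes.\<close>

lemma bounded_linear_eq_on_closure:
  assumes "hilb H" "hilb K"
    and T: "linear_between (hspace H) (hspace K) T" "\<And>v. v \<in> hspace H \<Longrightarrow> hnorm K (T v) \<le> C * hnorm H v"
    and U: "linear_between (hspace H) (hspace K) U" "\<And>v. v \<in> hspace H \<Longrightarrow> hnorm K (U v) \<le> D * hnorm H v"
    and A: "A \<subseteq> hspace H" and eq: "\<And>a. a \<in> A \<Longrightarrow> T a = U a" and x: "x \<in> htop H closure_of A"
  shows "T x = U x"
proof -
  interpret H: hilb H by fact
  interpret K: hilb K by fact
  obtain f where f: "\<forall>n. f n \<in> A" "hconv H f x" using x H.in_closure_of_iff[OF A] by blast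
  have "hconv K (\<lambda>n. T (f n)) (T x)" "hconv K (\<lambda>n. U (f n)) (U x)"
    by (rule hconv_map[OF H.semi_hilb_axioms K.semi_hilb_axioms T f(2)],
        assumption, rule hconv_map[OF H.semi_hilb_axioms K.semi_hilb_axioms U f(2)])
  moreover have "(\<lambda>n. T (f n)) = (\<lambda>n. U (f n))" using f(1) eq by simp
  ultimately show ?thesis using K.hconv_unique by simp
qed

lemma unitary_map_norm: "\<lbrakk>unitary_map H K U; v \<in> hspace H\<rbrakk> \<Longrightarrow> hnorm K (U v) = hnorm H v"
  by (simp add: unitary_map_def hnorm_def)

lemma unitary_map_inv_linear:
  assumes "semi_hilb H" and U: "unitary_map H K U"
  shows "linear_between (hspace K) (hspace H) (inv_into (hspace H) U)"
proof -
  interpret H: semi_hilb H by fact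
  have lin: "linear_between (hspace H) (hspace K) U" and bij: "bij_betw U (hspace H) (hspace K)"
    using U by (auto simp: unitary_map_def)
  have inv: "inv_into (hspace H) U y \<in> hspace H" "U (inv_into (hspace H) U y) = y" if "y \<in> hspace K" for y
    using bij that by (auto simp: bij_betw_def inv_into_into f_inv_into_f)
  have eqI: "inv_into (hspace H) U y = x" if "x \<in> hspace H" "U x = y" for x y
    using bij that by (auto simp: bij_betw_def inv_into_f_f)
  show ?thesis
    unfolding linear_between_def using inv
    by (auto intro!: eqI simp: linear_betweenD(2,3)[OF lin])
qed

section \<open>The representation of a reflection positive function\<close>

locale rp_function = sym_semigroup G \<tau> S + F: hilb F
  for G :: "('g, 'm) monoid_scheme" (structure) and \<tau> S and F :: "('f::complex_vector) hilb" +
  fixes \<phi> :: "'g \<Rightarrow> 'f \<Rightarrow> 'f"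
  assumes rpf: "reflection_positive_function G \<tau> S F \<phi>"
    and \<phi>_one: "v \<in> hspace F \<Longrightarrow> \<phi> \<one> v = v"
begin

lemma \<phi>_\<tau>: "\<lbrakk>g \<in> carrier G; v \<in> hspace F\<rbrakk> \<Longrightarrow> \<phi> (\<tau> g) v = \<phi> g v"
  using rpf by (simp add: reflection_positive_function_def)

abbreviation "E \<equiv> fun_rkhs G (carrier G) (\<lambda>g. inv g) F \<phi>"
abbreviation "HS \<equiv> fun_rkhs G S (sharp G \<tau>) F \<phi>"
abbreviation "KG \<equiv> fun_kernel G (\<lambda>g. inv g) \<phi>"
abbreviation "KS \<equiv> fun_kernel G (sharp G \<tau>) \<phi>"

sublocale E: rkhs_space F "carrier G" KG E
proof -
  interpret pd_kernel F "carrier G" KG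
    using rpf by unfold_locales (simp add: reflection_positive_function_def pos_def_function_def)
  show "rkhs_space F (carrier G) KG E"
    by unfold_locales (simp add: fun_rkhs_def is_rkhs_rkhs)
qed

sublocale HS: rkhs_space F S KS HS
proof -
  interpret pd_kernel F S KS
    using rpf by unfold_locales (simp add: reflection_positive_function_def pos_def_function_def)
  show "rkhs_space F S KS HS"
    by unfold_locales (simp add: fun_rkhs_def is_rkhs_rkhs)
qed

abbreviation "\<pi> \<equiv> (pi_phi G \<tau> :: 'g \<times> bool \<Rightarrow> ('g \<Rightarrow> 'f) \<Rightarrow> 'g \<Rightarrow> 'f)"

text \<open>The transformation of points with which \<open>pi_phi\<close> composes: \<tau> acts on
  the function first and translation second, so the point is translated before \<tau> is applied.
  Composition of functions reverses order, and \<open>act\<close> is accordingly a right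
  action.\<close>

definition act :: "'g \<times> bool \<Rightarrow> 'g \<Rightarrow> 'g" where
  "act = (\<lambda>(g, b) x. if b then \<tau> (x \<otimes> g) else x \<otimes> g)"

definition act_inv :: "'g \<times> bool \<Rightarrow> 'g \<Rightarrow> 'g" where
  "act_inv = (\<lambda>(g, b) x. (if b then \<tau> x else x) \<otimes> inv g)"

lemma pi_phi_eq: "g \<in> carrier G \<Longrightarrow> \<pi> (g, b) f = restrict0 (carrier G) (\<lambda>x. f (act (g, b) x))"
  by (auto simp: pi_phi_def right_transl_def tau_action_def act_def fun_eq_iff)

lemma act_closed [simp]: "\<lbrakk>g \<in> carrier G; x \<in> carrier G\<rbrakk> \<Longrightarrow> act (g, b) x \<in> carrier G"
  by (simp add: act_def)

lemma act_inv_closed [simp]: "\<lbrakk>g \<in> carrier G; x \<in> carrier G\<rbrakk> \<Longrightarrow> act_inv (g, b) x \<in> carrier G"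
  by (simp add: act_inv_def)

lemma act_act_inv: "\<lbrakk>g \<in> carrier G; x \<in> carrier G\<rbrakk> \<Longrightarrow> act (g, b) (act_inv (g, b) x) = x"
  by (simp add: act_def act_inv_def m_assoc)

lemma act_inv_act: "\<lbrakk>g \<in> carrier G; x \<in> carrier G\<rbrakk> \<Longrightarrow> act_inv (g, b) (act (g, b) x) = x"
  by (simp add: act_def act_inv_def m_assoc)

text \<open>The translations cancel in \<open>(x \<otimes> g) \<otimes> inv (y \<otimes> g)\<close>,
  and invariance of \<phi> under \<tau> absorbs the rest.\<close>

lemma KG_act:
  assumes g: "g \<in> carrier G" and x: "x \<in> carrier G" and y: "y \<in> carrier G" and v: "v \<in> hspace F"
  shows "KG (act (g, b) x) (act (g, b) y) v = KG x y v"
proof -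
  have "g \<otimes> (inv g \<otimes> inv y) = inv y"
    using g y m_assoc[of g "inv g" "inv y"] by simp
  then have eq: "(x \<otimes> g) \<otimes> inv (y \<otimes> g) = x \<otimes> inv y"
    using g x y by (simp add: inv_mult_group m_assoc)
  have "\<tau> (x \<otimes> g) \<otimes> inv (\<tau> (y \<otimes> g)) = \<tau> (x \<otimes> inv y)"
    using g x y \<tau>_mult[of "x \<otimes> g" "inv (y \<otimes> g)"] by (simp add: \<tau>_inv eq)
  with eq show ?thesis using x y v by (simp add: fun_kernel_def act_def \<phi>_\<tau>)
qed

lemma pi_phi_unitary:
  assumes g: "g \<in> carrier G" shows "unitary_map E E (\<pi> (g, b))"
proof -
  have "\<pi> (g, b) = (\<lambda>f. restrict0 (carrier G) (\<lambda>x. f (act (g, b) x)))"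
    using g by (simp add: pi_phi_eq fun_eq_iff del: restrict0_apply)
  then show ?thesis
    using E.composition_unitary[of "act (g, b)" "act_inv (g, b)"] g
    by (simp add: act_act_inv act_inv_act KG_act)
qed

lemma pi_phi_kfun:
  "\<lbrakk>g \<in> carrier G; y \<in> carrier G; v \<in> hspace F\<rbrakk> \<Longrightarrow> \<pi> (g, b) (E.kfun y v) = E.kfun (act_inv (g, b) y) v"
  unfolding pi_phi_eq by (rule E.composition_kfun) (simp_all add: act_act_inv KG_act)

sublocale tau_rep G \<tau> S E \<pi>
proof
  show "unitary_rep (semidirect_tau G \<tau>) E \<pi>"
    unfolding unitary_rep_def
  proof (intro conjI ballI)
    show "unitary_map E E (\<pi> x)" if "x \<in> carrier (semidirect_tau G \<tau>)" for x
      using that pi_phi_unitary by (cases x) (simp add: semidirect_tau_def)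
    show "\<pi> (x \<otimes>\<^bsub>semidirect_tau G \<tau>\<^esub> y) f = \<pi> x (\<pi> y f)"
      if xy: "x \<in> carrier (semidirect_tau G \<tau>)" "y \<in> carrier (semidirect_tau G \<tau>)" for x y f
    proof -
      obtain g a h b where *: "x = (g, a)" "y = (h, b)" "g \<in> carrier G" "h \<in> carrier G"
        using xy by (cases x; cases y) (auto simp: semidirect_tau_def)
      have "act (g \<otimes> (if a then \<tau> h else h), a \<noteq> b) t = act (h, b) (act (g, a) t)" if "t \<in> carrier G" for t
        using * that by (auto simp: act_def \<tau>_mult m_assoc)
      then show ?thesis
        using * by (auto simp: semidirect_tau_def pi_phi_eq fun_eq_iff)
    qed
  qed
qed

section \<open>The embedded copy of the coefficient space\<close>

abbreviation "\<iota> \<equiv> hadjoint E F (\<lambda>f. f \<one>)"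
abbreviation "F' \<equiv> \<iota> ` hspace F"

lemma \<iota>_eq: "\<iota> v = E.kfun \<one> v"
  by (simp add: E.kfun_def)

lemma F'_subset: "F' \<subseteq> hspace E"
  by (auto simp: \<iota>_eq)

lemma \<iota>_linear: "linear_between (hspace F) (hspace E) \<iota>"
  unfolding linear_between_def \<iota>_eq
proof (intro conjI ballI allI)
  have lin: "linear_between (hspace F) (hspace F) (\<phi> g)" if "g \<in> carrier G" for g
    using rpf that by (simp add: reflection_positive_function_def bounded_op_def)
  show "E.kfun \<one> (u + v) = E.kfun \<one> u + E.kfun \<one> v" if "u \<in> hspace F" "v \<in> hspace F" for u v
    using that linear_betweenD(2)[OF lin]
    by (intro E.kfun_eqI[symmetric] E.functions_on) (simp_all add: E.kfun_apply fun_kernel_def)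
  show "E.kfun \<one> (a *\<^sub>C v) = a *\<^sub>C E.kfun \<one> v" if "v \<in> hspace F" for a v
    using that linear_betweenD(3)[OF lin]
    by (intro E.kfun_eqI[symmetric] E.functions_on) (simp_all add: E.kfun_apply fun_kernel_def)
qed auto

text \<open>The left side is the kernel at the unit, \<open>hinner F (\<phi> \<one> v) w\<close>;
  here the normalization of \<phi> enters.\<close>

lemma \<iota>_inner: "\<lbrakk>v \<in> hspace F; w \<in> hspace F\<rbrakk> \<Longrightarrow> hinner E (\<iota> v) (\<iota> w) = hinner F v w"
  by (simp add: \<iota>_eq E.kfun_inner fun_kernel_def \<phi>_one)

lemma \<iota>_norm: "v \<in> hspace F \<Longrightarrow> hnorm E (\<iota> v) = hnorm F v"
  by (simp add: hnorm_def \<iota>_inner)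

lemma \<iota>_diff: "\<lbrakk>v \<in> hspace F; w \<in> hspace F\<rbrakk> \<Longrightarrow> \<iota> v - \<iota> w = \<iota> (v - w)"
  using linear_between_diff[OF \<iota>_linear F.subspace] by simp

lemma \<iota>_unitary: "unitary_map F (hsub E F') \<iota>"
  unfolding unitary_map_def
proof (intro conjI ballI)
  show "linear_between (hspace F) (hspace (hsub E F')) \<iota>"
    using \<iota>_linear by (simp add: linear_between_def)
  have "inj_on \<iota> (hspace F)"
  proof (rule inj_onI)
    fix v w assume vw: "v \<in> hspace F" "w \<in> hspace F" "\<iota> v = \<iota> w"
    then have "hnorm F (v - w) = 0" using \<iota>_norm[of "v - w"] by (simp add: \<iota>_diff[symmetric])
    then show "v = w" using F.norm_eq_0_iff[of "v - w"] vw by simp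
  qed
  then show "bij_betw \<iota> (hspace F) (hspace (hsub E F'))" by (simp add: bij_betw_def)
qed (simp add: \<iota>_inner)

text \<open>The isometric image of a complete space contains its limits: a convergent sequence of
  images comes from a Cauchy sequence in \<open>F\<close>.\<close>

lemma F'_closed: "closed_subspace E F'"
  unfolding closed_subspace_def
proof
  show "complex_vector.subspace F'"
  proof (rule complex_vector.subspaceI)
    show "0 \<in> F'" using linear_between_zero[OF \<iota>_linear] F.zero_mem by (metis image_eqI)
  qed (use F.add_mem F.scale_mem in \<open>auto simp flip: linear_betweenD(2,3)[OF \<iota>_linear]\<close>)
  show "closedin (htop E) F'"
    unfolding E.H.closedin_iff
  proof (intro conjI allI impI F'_subset)
    fix f x assume f: "\<forall>n. f n \<in> F'" and conv: "hconv E f x"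
    then have "\<forall>n. \<exists>v. v \<in> hspace F \<and> f n = \<iota> v" by blast
    then obtain v where v: "\<forall>n. v n \<in> hspace F \<and> f n = \<iota> (v n)" by (rule choice[THEN exE])
    then have f_eq: "f = (\<lambda>n. \<iota> (v n))" by blast
    have "hcauchy F v"
      using E.H.hconv_cauchy[OF conv] v by (simp add: hcauchy_def f_eq \<iota>_diff \<iota>_norm)
    then obtain w where w: "hconv F v w" using F.complete by blast
    have "hconv E (\<lambda>n. \<iota> (v n)) (\<iota> w)"
      by (rule hconv_map[OF F.semi_hilb_axioms E.H.semi_hilb_axioms \<iota>_linear _ w, of 1]) (simp add: \<iota>_norm)
    then have "x = \<iota> w" using conv E.H.hconv_unique by (simp add: f_eq)
    then show "x \<in> F'" using w by (simp add: hconv_def)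
  qed
qed

lemma pi_phi_\<iota>: "\<lbrakk>g \<in> carrier G; v \<in> hspace F\<rbrakk> \<Longrightarrow> \<pi> (g, False) (\<iota> v) = E.kfun (inv g) v"
  by (simp add: \<iota>_eq pi_phi_kfun act_inv_def)

lemma theta_kfun:
  "\<lbrakk>y \<in> carrier G; v \<in> hspace F\<rbrakk> \<Longrightarrow> \<theta> (E.kfun y v) = E.kfun (\<tau> y) v"
  by (simp add: theta_def pi_phi_kfun act_inv_def)

text \<open>The orbit of \<open>F'\<close> consists exactly of the kernel functions, so cyclicity is
  their totality.\<close>

lemma cyclic: "closed_span E {\<pi> (g, False) v |g v. g \<in> carrier G \<and> v \<in> F'} = hspace E"
proof -
  have "E.kfuns \<subseteq> {\<pi> (g, False) v |g v. g \<in> carrier G \<and> v \<in> F'}"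
  proof
    fix a assume "a \<in> E.kfuns"
    then obtain y v where yv: "y \<in> carrier G" "v \<in> hspace F" "a = E.kfun y v"
      unfolding E.kfuns_def by blast
    then have "a = \<pi> (inv y, False) (\<iota> v)" by (simp add: pi_phi_\<iota>)
    then show "a \<in> {\<pi> (g, False) v |g v. g \<in> carrier G \<and> v \<in> F'}" using yv by blast
  qed
  moreover have "{\<pi> (g, False) v |g v. g \<in> carrier G \<and> v \<in> F'} \<subseteq> E.kfuns"
  proof
    fix a assume "a \<in> {\<pi> (g, False) v |g v. g \<in> carrier G \<and> v \<in> F'}"
    then obtain g v where gv: "g \<in> carrier G" "v \<in> hspace F" "a = \<pi> (g, False) (\<iota> v)" by blast
    then have "a = E.kfun (inv g) v" by (simp add: pi_phi_\<iota>)
    then show "a \<in> E.kfuns" unfolding E.kfuns_def using gv(2) inv_closed[OF gv(1)] by blast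
  qed
  ultimately have eq: "E.kfuns = {\<pi> (g, False) v |g v. g \<in> carrier G \<and> v \<in> F'}" by (rule equalityI)
  show ?thesis unfolding eq[symmetric] by (rule E.closed_span_kfuns)
qed

section \<open>Restriction to the subsemigroup\<close>

abbreviation "Ep \<equiv> Eplus S E \<pi> F'"

definition gens :: "('g \<Rightarrow> 'f) set" where
  "gens = {\<pi> (s, False) v |s v. s \<in> S \<and> v \<in> F'}"

lemma gens_eq: "gens = {E.kfun (inv s) v |s v. s \<in> S \<and> v \<in> hspace F}"
  unfolding gens_def by (force simp: pi_phi_\<iota> S_subset)

lemma gens_subset: "gens \<subseteq> hspace E"
  unfolding gens_def by (rule generators_subset[OF F'_subset])

lemma Ep_eq: "Ep = htop E closure_of (complex_vector.span gens)"
  by (simp add: Eplus_def closed_span_def gens_def)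

abbreviation "R \<equiv> restrict0 S :: ('g \<Rightarrow> 'f) \<Rightarrow> 'g \<Rightarrow> 'f"

lemma R_add: "R (f + g) = R f + R g"
  by (simp add: fun_eq_iff)

lemma R_scale: "R (a *\<^sub>C f) = a *\<^sub>C R f"
  by (simp add: fun_eq_iff)

lemma R_linear_between: "(\<And>f. f \<in> V \<Longrightarrow> R f \<in> W) \<Longrightarrow> linear_between V W R"
  unfolding linear_between_def by (simp add: R_add R_scale image_subset_iff)

text \<open>Inversion and \<open>sharp\<close> are both involutions, so both sides have the value
  \<open>\<phi> (t \<otimes> s) v\<close> at \<open>t\<close>.\<close>

lemma R_kfun:
  assumes s: "s \<in> S" and v: "v \<in> hspace F"
  shows "R (E.kfun (inv s) v) = HS.kfun (sharp G \<tau> s) v"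
proof (rule HS.kfun_eqI)
  show "R (E.kfun (inv s) v) \<in> functions_on S F"
    using s v S_subset by (intro functions_onI) auto
  show "R (E.kfun (inv s) v) t = KS t (sharp G \<tau> s) v" if "t \<in> S" for t
    using s v S_subset that by (simp add: E.kfun_apply fun_kernel_def)
qed (use s v in auto)

lemma R_span: "g \<in> complex_vector.span gens \<Longrightarrow> R g \<in> hspace HS"
proof -
  have "complex_vector.span gens \<subseteq> {g. R g \<in> hspace HS}"
  proof (rule complex_vector.span_minimal)
    show "gens \<subseteq> {g. R g \<in> hspace HS}" by (auto simp: gens_eq R_kfun)
    have "R 0 = 0" by (simp add: fun_eq_iff)
    then show "complex_vector.subspace {g. R g \<in> hspace HS}"
      by (simp add: complex_vector.subspace_def R_add R_scale)
  qed
  then show "g \<in> complex_vector.span gens \<Longrightarrow> R g \<in> hspace HS" by blast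
qed

text \<open>The two kernels evaluate \<phi> at \<open>sharp G \<tau> t \<otimes> s\<close> and at
  \<open>inv t \<otimes> \<tau> s\<close>. These points are exchanged by \<tau>, which leaves \<phi>
  invariant.\<close>

lemma R_inner_gens:
  assumes s: "s \<in> S" and t: "t \<in> S" and v: "v \<in> hspace F" and w: "w \<in> hspace F"
  shows "hinner HS (R (E.kfun (inv s) v)) (R (E.kfun (inv t) w))
    = hinner E (\<theta> (E.kfun (inv s) v)) (E.kfun (inv t) w)"
proof -
  note sG = S_subset[OF s] S_subset[OF t]
  have "\<tau> (inv t \<otimes> \<tau> s) = sharp G \<tau> t \<otimes> s" using sG by (simp add: \<tau>_mult \<tau>_inv sharp_def)
  then have "\<phi> (inv t \<otimes> \<tau> s) v = \<phi> (sharp G \<tau> t \<otimes> s) v"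
    using \<phi>_\<tau>[of "inv t \<otimes> \<tau> s" v] sG v by simp
  then show ?thesis
    using s t v w sG
    by (simp add: R_kfun HS.kfun_inner theta_kfun E.kfun_inner fun_kernel_def \<tau>_inv)
qed

lemma R_inner_span:
  assumes "g \<in> complex_vector.span gens" "h \<in> complex_vector.span gens"
  shows "hinner HS (R g) (R h) = hinner E (\<theta> g) h"
proof (rule inner_eq_on_span[OF E.H.semi_hilb_axioms HS.H.semi_hilb_axioms gens_subset theta_linear _ _ assms])
  show "linear_between (complex_vector.span gens) (hspace HS) R"
    by (intro R_linear_between R_span)
  show "hinner HS (R a) (R b) = hinner E (\<theta> a) b" if "a \<in> gens" "b \<in> gens" for a b
    using that by (auto simp: gens_eq R_inner_gens)
qed

lemma R_bound_span:
  assumes g: "g \<in> complex_vector.span gens" shows "hnorm HS (R g) \<le> 1 * hnorm E g"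
proof -
  have gE: "g \<in> hspace E" using g E.H.span_subset[OF gens_subset] by blast
  have "(hnorm HS (R g))\<^sup>2 = Re (hinner E (\<theta> g) g)"
    using R_span[OF g] by (simp add: HS.H.norm_sq R_inner_span g)
  also have "\<dots> \<le> hnorm E (\<theta> g) * hnorm E g" using gE by (intro E.H.Re_inner_le) auto
  finally have "(hnorm HS (R g))\<^sup>2 \<le> (hnorm E g)\<^sup>2" using gE by (simp add: theta_norm power2_eq_square)
  then have "hnorm HS (R g) \<le> hnorm E g" using E.H.norm_nonneg[OF gE] by (rule power2_le_imp_le)
  then show ?thesis by simp
qed

text \<open>One sequence converges in both spaces at once, so relations known on the span pass to
  the limit on both sides.\<close>

lemma Ep_approx:
  assumes "f \<in> Ep"
  obtains a where "\<And>n. a n \<in> complex_vector.span gens" "hconv E a f" "hconv HS (\<lambda>n. R (a n)) (R f)"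
proof -
  note A = complex_vector.subspace_span E.H.span_subset[OF gens_subset]
  obtain a where a: "\<And>n. a n \<in> complex_vector.span gens" "hconv E a f"
    using assms E.H.in_closure_of_iff[OF A(2)] unfolding Ep_eq by blast
  have "hconv HS (\<lambda>n. R (a n)) (R f)"
    using hconv_composition[OF E.rkhs_space_axioms HS.rkhs_space_axioms S_subset A R_span R_bound_span a]
    by simp
  with a that show ?thesis by blast
qed

lemma R_mem [simp]: "f \<in> Ep \<Longrightarrow> R f \<in> hspace HS"
  using Ep_approx[of f] by (metis hconv_def)

lemma R_inner:
  assumes f: "f \<in> Ep" shows "hinner HS (R f) (R f) = hinner E (\<theta> f) f"
proof -
  obtain a where a: "\<And>n. a n \<in> complex_vector.span gens" "hconv E a f" "hconv HS (\<lambda>n. R (a n)) (R f)"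
    using Ep_approx[OF f] by blast
  have "hconv E (\<lambda>n. \<theta> (a n)) (\<theta> f)"
    by (rule hconv_map[OF E.H.semi_hilb_axioms E.H.semi_hilb_axioms theta_linear _ a(2), of 1])
      (simp add: theta_norm)
  then have "(\<lambda>n. hinner E (\<theta> (a n)) (a n)) \<longlonglongrightarrow> hinner E (\<theta> f) f"
    using a(2) by (rule E.H.hconv_inner)
  moreover have "(\<lambda>n. hinner E (\<theta> (a n)) (a n)) \<longlonglongrightarrow> hinner HS (R f) (R f)"
    using HS.H.hconv_inner[OF a(3) a(3)] a(1) by (simp add: R_inner_span)
  ultimately show ?thesis using LIMSEQ_unique by blast
qed

theorem cyclic_rep: "reflection_positive_cyclic_rep G \<tau> S \<pi> E F'"
  unfolding reflection_positive_cyclic_rep_def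
proof (intro conjI ballI)
  show "hilbert E" unfolding hilbert_iff by (rule E.H.hilb_axioms)
  show "\<theta> v = v" if "v \<in> F'" for v using that by (auto simp: \<iota>_eq theta_kfun)
  show "hinner E (\<theta> v) v \<in> \<real>\<^sub>\<ge>\<^sub>0" if "v \<in> Ep" for v
    using that by (simp add: R_inner[symmetric] HS.H.inner_self del: of_real_power)
qed (rule rep F'_closed cyclic)+

sublocale rp: rp_rep G \<tau> S E \<pi> F'
  by (rule rp_rep_of[OF cyclic_rep])

lemma R_norm: "f \<in> Ep \<Longrightarrow> hnorm HS (R f) = sqrt (Re (hinner E (\<theta> f) f))"
  by (simp add: hnorm_def R_inner)

lemma R_linear: "linear_between Ep (hspace HS) R"
  by (rule R_linear_between) simp

lemma Ep_subspace: "complex_vector.subspace Ep"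
  using rp.plus.subspace by simp

lemma R_image_subspace: "complex_vector.subspace (R ` Ep)"
proof (rule complex_vector.subspaceI)
  show "0 \<in> R ` Ep"
    using linear_between_zero[OF R_linear] complex_vector.subspace_0[OF Ep_subspace] by (metis image_eqI)
qed (use complex_vector.subspace_add[OF Ep_subspace] complex_vector.subspace_scale[OF Ep_subspace] in
    \<open>auto simp flip: linear_betweenD(2,3)[OF R_linear]\<close>)

lemma R_dense: "htop HS closure_of (R ` Ep) = hspace HS"
proof
  show "htop HS closure_of (R ` Ep) \<subseteq> hspace HS"
    using closure_of_subset_topspace[of "htop HS"] by simp
  have "HS.kfuns \<subseteq> R ` Ep"
  proof
    fix a assume "a \<in> HS.kfuns"
    then obtain s v where sv: "s \<in> S" "v \<in> hspace F" "a = HS.kfun s v" unfolding HS.kfuns_def by blast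
    then have "a = R (\<pi> (sharp G \<tau> s, False) (\<iota> v))"
      using R_kfun[of "sharp G \<tau> s" v] S_subset by (simp add: pi_phi_\<iota>)
    moreover have "\<pi> (sharp G \<tau> s, False) (\<iota> v) \<in> Ep"
      using sv by (intro Eplus_generator[OF F'_subset] imageI) simp_all
    ultimately show "a \<in> R ` Ep" by (rule image_eqI)
  qed
  then have "complex_vector.span HS.kfuns \<subseteq> R ` Ep"
    using R_image_subspace by (rule complex_vector.span_minimal)
  then have "closed_span HS HS.kfuns \<subseteq> htop HS closure_of (R ` Ep)"
    unfolding closed_span_def by (rule closure_of_mono)
  then show "hspace HS \<subseteq> htop HS closure_of (R ` Ep)" using HS.closed_span_kfuns by simp
qed

text \<open>For \<open>t\<close> in \<open>S\<close> the product \<open>t \<otimes> s\<close> stays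
  in \<open>S\<close>, so the values on \<open>S\<close> of the translate depend only on the
  restriction of \<open>f\<close>.\<close>

lemma right_transl_R:
  assumes s: "s \<in> S" and f: "f \<in> Ep" shows "right_transl G S s (R f) = R (\<pi> (s, False) f)"
  using s S_subset by (auto simp: right_transl_def fun_eq_iff pi_phi_eq act_def)

lemma plus_norm: "f \<in> Ep \<Longrightarrow> hnorm rp.plus f = hnorm HS (R f)"
  by (simp add: hnorm_def R_inner)

lemma right_transl_bounded:
  assumes s: "s \<in> S" and h: "h \<in> hspace HS"
  shows "right_transl G S s h \<in> hspace HS" "hnorm HS (right_transl G S s h) \<le> 1 * hnorm HS h"
proof -
  have mem: "right_transl G S s k \<in> hspace HS" if "k \<in> R ` Ep" for k
    using that s Eplus_invariant[OF F'_subset s] by (auto simp: right_transl_R)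
  have bound: "hnorm HS (right_transl G S s k) \<le> 1 * hnorm HS k" if "k \<in> R ` Ep" for k
    using that s rp.plus_contractive[OF s] Eplus_invariant[OF F'_subset s]
    by (auto simp: right_transl_R plus_norm)
  have sub: "R ` Ep \<subseteq> hspace HS" by auto
  have hcl: "h \<in> htop HS closure_of (R ` Ep)" using h R_dense by simp
  show "right_transl G S s h \<in> hspace HS" "hnorm HS (right_transl G S s h) \<le> 1 * hnorm HS h"
    using composition_bounded[OF HS.rkhs_space_axioms HS.rkhs_space_axioms S_mult[OF _ s]
        R_image_subspace sub mem[unfolded right_transl_def] bound[unfolded right_transl_def] hcl]
    unfolding right_transl_def by auto
qed

lemma right_transl_linear: "s \<in> S \<Longrightarrow> linear_between (hspace HS) (hspace HS) (right_transl G S s)"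
  using linear_between_restrict0[of "hspace HS" S "\<lambda>t. t \<otimes> s"] right_transl_bounded(1)
  unfolding right_transl_def by blast

text \<open>The class \<open>J f\<close> and the restriction \<open>R f\<close> have the same norm
  and both ranges are dense, so \<open>isometric_extension\<close> supplies the unitary.
  Equivariance requires in addition that the operator chosen in \<open>hat_action\<close> be
  identified.\<close>

theorem hat_unitary:
  fixes Eh :: "('h::complex_vector) hilb"
  assumes hat: "hat_completion G S \<pi> E F' Eh j"
  shows "\<exists>\<Gamma>. unitary_map Eh HS \<Gamma> \<and>
      (\<forall>f\<in>Ep. \<Gamma> (j (null_class G S \<pi> E F' f)) = restrict0 S f) \<and>
      (\<forall>s\<in>S. \<forall>x\<in>hspace Eh. \<Gamma> (hat_action G S \<pi> E F' Eh j s x) = right_transl G S s (\<Gamma> x))"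
proof -
  define J where "J f = j (null_class G S \<pi> E F' f)" for f
  have "hilb Eh" and J: "linear_between Ep (hspace Eh) J"
    and J_norm: "\<And>f. f \<in> Ep \<Longrightarrow> hnorm Eh (J f) = sqrt (Re (hinner E (\<theta> f) f))"
    and J_dense: "htop Eh closure_of (J ` Ep) = hspace Eh"
    using hat unfolding hat_completion_def J_def hilbert_iff by auto
  interpret Eh: hilb Eh by fact
  obtain \<Gamma> where \<Gamma>: "unitary_map Eh HS \<Gamma>" and \<Gamma>_J: "\<And>f. f \<in> Ep \<Longrightarrow> \<Gamma> (J f) = R f"
    using isometric_extension[OF Eh.hilb_axioms HS.H.hilb_axioms Ep_subspace J R_linear _ J_dense R_dense]
    by (auto simp: J_norm R_norm)
  have \<Gamma>_lin: "linear_between (hspace Eh) (hspace HS) \<Gamma>" and bij: "bij_betw \<Gamma> (hspace Eh) (hspace HS)"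
    using \<Gamma> by (auto simp: unitary_map_def)
  have "\<Gamma> (hat_action G S \<pi> E F' Eh j s x) = right_transl G S s (\<Gamma> x)"
    if s: "s \<in> S" and x: "x \<in> hspace Eh" for s x
  proof -
    define Q where "Q A \<longleftrightarrow> bounded_op Eh A \<and> (\<forall>f\<in>Ep. A (J f) = J (\<pi> (s, False) f))" for A
    note inv_lin = unitary_map_inv_linear[OF Eh.semi_hilb_axioms \<Gamma>]
    \<comment> \<open>The right translation, transported to \<open>Eh\<close> through
      \<open>\<Gamma>\<close>, is the bounded operator whose existence the \<open>SOME\<close> in
      \<open>hat_action\<close> presupposes.\<close>
    define A0 where "A0 x = inv_into (hspace Eh) \<Gamma> (right_transl G S s (\<Gamma> x))" for x
    have \<Gamma>_A0: "\<Gamma> (A0 x) = right_transl G S s (\<Gamma> x)" "A0 x \<in> hspace Eh" if "x \<in> hspace Eh" for x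
      using right_transl_bounded(1)[OF s linear_betweenD(1)[OF \<Gamma>_lin that]] bij
        linear_betweenD(1)[OF inv_lin]
      by (auto simp: A0_def bij_betw_def f_inv_into_f)
    have "linear_between (hspace Eh) (hspace Eh) A0"
      unfolding linear_between_def
      using \<Gamma>_A0(2) linear_betweenD[OF \<Gamma>_lin] linear_betweenD[OF right_transl_linear[OF s]]
        linear_betweenD[OF inv_lin]
      by (auto simp: A0_def)
    moreover have "hnorm Eh (A0 x) \<le> 1 * hnorm Eh x" if "x \<in> hspace Eh" for x
      using unitary_map_norm[OF \<Gamma> \<Gamma>_A0(2)[OF that]] unitary_map_norm[OF \<Gamma> that] \<Gamma>_A0(1)[OF that]
        right_transl_bounded(2)[OF s linear_betweenD(1)[OF \<Gamma>_lin that]] by simp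
    moreover have "A0 (J f) = J (\<pi> (s, False) f)" if f: "f \<in> Ep" for f
    proof -
      have sf: "\<pi> (s, False) f \<in> Ep" by (rule Eplus_invariant[OF F'_subset s f])
      have "A0 (J f) = inv_into (hspace Eh) \<Gamma> (\<Gamma> (J (\<pi> (s, False) f)))"
        by (simp add: A0_def \<Gamma>_J f sf right_transl_R s)
      then show ?thesis
        using bij linear_betweenD(1)[OF J sf] by (simp add: bij_betw_def inv_into_f_f)
    qed
    ultimately have "Q A0" unfolding Q_def bounded_op_def by blast
    then have "Q (SOME A. Q A)" by (rule someI[of Q])
    then have hat_Q: "Q (hat_action G S \<pi> E F' Eh j s)" (is "Q ?A")
      unfolding Q_def J_def hat_action_def .
    then obtain C where A_lin: "linear_between (hspace Eh) (hspace Eh) ?A"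
      and A_bound: "\<And>x. x \<in> hspace Eh \<Longrightarrow> hnorm Eh (?A x) \<le> C * hnorm Eh x"
      unfolding Q_def bounded_op_def by blast
    \<comment> \<open>\<open>Q\<close> prescribes the values on the dense range of \<open>J\<close>,
      so any two bounded operators satisfying it agree on \<open>Eh\<close>.\<close>
    have "?A x = A0 x"
    proof (rule bounded_linear_eq_on_closure[OF Eh.hilb_axioms Eh.hilb_axioms A_lin A_bound])
      show "x \<in> htop Eh closure_of (J ` Ep)" using x J_dense by simp
      show "?A a = A0 a" if "a \<in> J ` Ep" for a
        using that hat_Q \<open>Q A0\<close> unfolding Q_def by auto
      show "J ` Ep \<subseteq> hspace Eh" using linear_betweenD(1)[OF J] by blast
      show "linear_between (hspace Eh) (hspace Eh) A0" by fact
      show "hnorm Eh (A0 x) \<le> 1 * hnorm Eh x" if "x \<in> hspace Eh" for x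
        using that by fact
    qed
    then show ?thesis using \<Gamma>_A0(1)[OF x] by simp
  qed
  with \<Gamma> \<Gamma>_J show ?thesis unfolding J_def by blast
qed

end

theorem proposition1p11:
  fixes G :: "('g, 'm) monoid_scheme" and \<tau> :: "'g \<Rightarrow> 'g" and S :: "'g set"
  assumes "symmetric_group G \<tau>" and "sharp_subsemigroup G \<tau> S"
  shows
    "(\<forall>(E :: 'e::complex_vector hilb) \<pi> F.
        reflection_positive_cyclic_rep G \<tau> S \<pi> E F \<longrightarrow>
          reflection_positive_function G \<tau> S (hsub E F) (compression E F \<pi>) \<and>
          (\<forall>v\<in>F. compression E F \<pi> \<one>\<^bsub>G\<^esub> v = v))
     \<and>
     (\<forall>(F :: 'f::complex_vector hilb) \<phi>.
        hilbert F \<and> reflection_positive_function G \<tau> S F \<phi> \<and> (\<forall>v\<in>hspace F. \<phi> \<one>\<^bsub>G\<^esub> v = v) \<longrightarrow>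
          (let E = fun_rkhs G (carrier G) (\<lambda>g. inv\<^bsub>G\<^esub> g) F \<phi>;
               \<iota> = hadjoint E F (\<lambda>f. f \<one>\<^bsub>G\<^esub>);
               F' = \<iota> ` hspace F;
               \<pi> = pi_phi G \<tau>;
               HS = fun_rkhs G S (sharp G \<tau>) F \<phi>
           in unitary_map F (hsub E F') \<iota> \<and>
              reflection_positive_cyclic_rep G \<tau> S \<pi> E F' \<and>
              (\<forall>(Eh :: 'h::complex_vector hilb) j.
                 hat_completion G S \<pi> E F' Eh j \<longrightarrow>
                   (\<exists>\<Gamma>. unitary_map Eh HS \<Gamma> \<and>
                        (\<forall>f\<in>Eplus S E \<pi> F'. \<Gamma> (j (null_class G S \<pi> E F' f)) = restrict0 S f) \<and>
                        (\<forall>s\<in>S. \<forall>x\<in>hspace Eh.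
                           \<Gamma> (hat_action G S \<pi> E F' Eh j s x) = right_transl G S s (\<Gamma> x))))))"
proof (intro conjI allI impI, goal_cases)
  interpret sym_semigroup G \<tau> S using assms by unfold_locales
  case (1 E \<pi> F)
  then interpret rp_rep G \<tau> S E \<pi> F by (rule rp_rep_of)
  show ?case by (rule compression_reflection_positive)
next
  interpret sym_semigroup G \<tau> S using assms by unfold_locales
  case (2 E \<pi> F)
  then interpret rp_rep G \<tau> S E \<pi> F by (rule rp_rep_of)
  show ?case using compression_one by blast
next
  case (3 F \<phi>)
  then interpret rp_function G \<tau> S F \<phi>
    using assms by (simp add: rp_function_def rp_function_axioms_def sym_semigroup_def hilbert_iff)
  show ?case
    unfolding Let_def using \<iota>_unitary cyclic_rep hat_unitary by blast
qed

end
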